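(* Let $N\ge1$, $b+1-a>0$ and $b\le\frac{N-2}{2}$. Then for $u\in C_0^\infty(\mathbb{R}^N)$: $$\delta_1(u)\ge C_{PI}(a,b,N)\inf_{c\in\mathbb{R}}\int_{\mathbb{R}^N}\left|u-cE_1\right|^2\frac{dx}{|x|^{1+b+a}}$$ and $$\delta_2(u)\ge\frac{C_{PI}(a,b,N)}{2}\inf_{c\in\mathbb{R},\lambda>0}\int_{\mathbb{R}^N}\left|u-cE_\lambda\right|^2\frac{dx}{|x|^{1+b+a}}.$$ Moreover, write $$R_1(u)=\delta_1(u)-C_{PI}(a,b,N)\inf_{c\in\mathbb{R}}\int_{\mathbb{R}^N}|u-cE_1|^2\frac{dx}{|x|^{1+b+a}},\qquad R_2(u)=\delta_2(u)-\frac{C_{PI}(a,b,N)}{2}\inf_{c\in\mathbb{R},\lambda>0}\int_{\mathbb{R}^N}|u-cE_\lambda|^2\frac{dx}{|x|^{1+b+a}}.$$ If $C_1<D_1$, then $$R_1(u)\ge\min\{C_1,D_1-C_1\}\inf_{c,d\in\mathbb{R}}\int_{\mathbb{R}^N}\left|u-(c+d|x|^{1+b-a})E_1\right|^2\frac{dx}{|x|^{a+b+1}}$$ and $$R_2(u)\ge\frac{\min\{C_1,D_1-C_1\}}{2}\inf_{c,d\in\mathbb{R},\lambda>0}\int_{\mathbb{R}^N}\left|u-(c+d|x|^{1+b-a})E_\lambda\right|^2\frac{dx}{|x|^{a+b+1}}.$$ If $C_1>D_1$, then $$R_1(u)\ge\min\{C_1-D_1,D_2-D_1\}\inf_{c\in\mathbb{R},\mathbf{d}\in\mathbb{R}^N}\int_{\mathbb{R}^N}\left|u-(c+|x|^{\frac{D_1}{2}-1}\mathbf{d}\cdot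 x)E_1\right|^2\frac{dx}{|x|^{a+b+1}}$$ and $$R_2(u)\ge\frac{\min\{C_1-D_1,D_2-D_1\}}{2}\inf_{c\in\mathbb{R},\lambda>0,\mathbf{d}\in\mathbb{R}^N}\int_{\mathbb{R}^N}\left|u-(c+|x|^{\frac{D_1}{2}-1}\mathbf{d}\cdot x)E_\lambda\right|^2\frac{dx}{|x|^{a+b+1}}.$$ If $C_1=D_1$, then $$R_1(u)\ge\min\{D_1,D_2-D_1\}\inf_{c,d\in\mathbb{R},\mathbf{d}\in\mathbb{R}^N}\int_{\mathbb{R}^N}\left|u-(c+d|x|^{1+b-a}+|x|^{\frac{D_1}{2}-1}\mathbf{d}\cdot x)E_1\right|^2\frac{dx}{|x|^{a+b+1}}$$ and $$R_2(u)\ge\frac{\min\{D_1,D_2-D_1\}}{2}\inf_{c,d\in\mathbb{R},\lambda>0,\mathbf{d}\in\mathbb{R}^N}\int_{\mathbb{R}^N}\left|u-(c+d|x|^{1+b-a}+|x|^{\frac{D_1}{2}-1}\mathbf{d}\cdot x)E_\lambda\right|^2\frac{dx}{|x|^{a+b+1}}.$$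
   Context: Here $a,b\in\mathbb{R}$, functions are real-valued, and for $\lambda>0$, $E_\lambda(x)=e^{-\frac{\lambda|x|^{1+b-a}}{1+b-a}}$. Constants: $$C_1=2(1+b-a),\quad D_1=\sqrt{(N-2-2b)^2+4(N-1)}-(N-2-2b),\quad D_2=\sqrt{(N-2-2b)^2+8N}-(N-2-2b),$$ $C_{PI}(a,b,N)=\min\{C_1,D_1\}$, and $$C(N,a,b)=\max\left\{\frac{|N-(a+b+1)|}{2},\frac{|N-(3b-a+3)|}{2}\right\}.$$ Deficits: $$\delta_1(u)=\int_{\mathbb{R}^N}\frac{|\nabla u|^2}{|x|^{2b}}dx+\int_{\mathbb{R}^N}\frac{|u|^2}{|x|^{2a}}dx-2C(N,a,b)\int_{\mathbb{R}^N}\frac{|u|^2}{|x|^{a+b+1}}dx,$$ $$\delta_2(u)=\left(\int_{\mathbb{R}^N}\frac{|\nabla u|^2}{|x|^{2b}}dx\right)^{1/2}\left(\int_{\mathbb{R}^N}\frac{|u|^2}{|x|^{2a}}dx\right)^{1/2}-C(N,a,b)\int_{\mathbb{R}^N}\frac{|u|^2}{|x|^{a+b+1}}dx.$$ The scalar $d\in\mathbb{R}$ and the vector $\mathbf{d}\in\mathbb{R}^N$ are independent parameters. *)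

theory Defs
  imports "HOL-Analysis.Analysis"
begin

primrec iter_pderiv :: "'n list \<Rightarrow> (real^'n \<Rightarrow> real) \<Rightarrow> real^'n \<Rightarrow> real" where
  "iter_pderiv [] u = u"
| "iter_pderiv (i # is) u = (\<lambda>x. frechet_derivative (iter_pderiv is u) (at x) (axis i 1))"

(* Total differentiability of all iterated partial derivatives makes each of them
   continuous, so the first conjunct is the usual C-infinity condition. *)
definition test_function :: "(real^'n \<Rightarrow> real) \<Rightarrow> bool" where
  "test_function u \<longleftrightarrow>
     (\<forall>is x. iter_pderiv is u differentiable (at x)) \<and> compact (closure {x. u x \<noteq> 0})"

definition grad :: "(real^'n \<Rightarrow> real) \<Rightarrow> real^'n \<Rightarrow> real^'n" where
  "grad u x = (THE D. GDERIV u x :> D)"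

(* Powers of |x| are written with powr. At x = 0 its value, and that of the quotients by it,
   is 0, which may differ from the intended one only on a Lebesgue null set. If
   1 + b - a > 0 and b <= (N - 2) / 2, then a + b + 1, 2 * a and 2 * b are all less than N,
   so every integral below converges for the functions considered. *)

definition wnorm2 :: "real \<Rightarrow> real \<Rightarrow> (real^'n \<Rightarrow> real) \<Rightarrow> real" where
  "wnorm2 a b f = (LINT x|lborel. \<bar>f x\<bar>\<^sup>2 / norm x powr (a + b + 1))"

definition E :: "real \<Rightarrow> real \<Rightarrow> real \<Rightarrow> real^'n \<Rightarrow> real" where
  "E a b l x = exp (- (l * norm x powr (1 + b - a) / (1 + b - a)))"

definition C1 :: "real \<Rightarrow> real \<Rightarrow> real" where
  "C1 a b = 2 * (1 + b - a)"

definition D1 :: "real \<Rightarrow> nat \<Rightarrow> real" where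
  "D1 b N = sqrt ((real N - 2 - 2 * b)\<^sup>2 + 4 * (real N - 1)) - (real N - 2 - 2 * b)"

definition D2 :: "real \<Rightarrow> nat \<Rightarrow> real" where
  "D2 b N = sqrt ((real N - 2 - 2 * b)\<^sup>2 + 8 * real N) - (real N - 2 - 2 * b)"

definition C_PI :: "real \<Rightarrow> real \<Rightarrow> nat \<Rightarrow> real" where
  "C_PI a b N = min (C1 a b) (D1 b N)"

definition C_CKN :: "nat \<Rightarrow> real \<Rightarrow> real \<Rightarrow> real" where
  "C_CKN N a b = max (\<bar>real N - (a + b + 1)\<bar> / 2) (\<bar>real N - (3 * b - a + 3)\<bar> / 2)"

definition delta1 :: "real \<Rightarrow> real \<Rightarrow> (real^'n \<Rightarrow> real) \<Rightarrow> real" where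
  "delta1 a b u =
     (LINT x|lborel. (norm (grad u x))\<^sup>2 / norm x powr (2 * b))
     + (LINT x|lborel. \<bar>u x\<bar>\<^sup>2 / norm x powr (2 * a))
     - 2 * C_CKN CARD('n) a b * (LINT x|lborel. \<bar>u x\<bar>\<^sup>2 / norm x powr (a + b + 1))"

definition delta2 :: "real \<Rightarrow> real \<Rightarrow> (real^'n \<Rightarrow> real) \<Rightarrow> real" where
  "delta2 a b u =
     sqrt (LINT x|lborel. (norm (grad u x))\<^sup>2 / norm x powr (2 * b))
       * sqrt (LINT x|lborel. \<bar>u x\<bar>\<^sup>2 / norm x powr (2 * a))
     - C_CKN CARD('n) a b * (LINT x|lborel. \<bar>u x\<bar>\<^sup>2 / norm x powr (a + b + 1))"

definition R1 :: "real \<Rightarrow> real \<Rightarrow> (real^'n \<Rightarrow> real) \<Rightarrow> real" where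
  "R1 a b u = delta1 a b u
     - C_PI a b CARD('n) * (INF c. wnorm2 a b (\<lambda>x. u x - c * E a b 1 x))"

definition R2 :: "real \<Rightarrow> real \<Rightarrow> (real^'n \<Rightarrow> real) \<Rightarrow> real" where
  "R2 a b u = delta2 a b u
     - C_PI a b CARD('n) / 2
         * (INF (c, l) \<in> UNIV \<times> {0<..}. wnorm2 a b (\<lambda>x. u x - c * E a b l x))"

end

theory Submission
  imports Defs "HOL-Computational_Algebra.Polynomial"
begin

text \<open>
  Write \<open>\<alpha> = 1 + b - a\<close>, \<open>\<nu> = N - 2 - 2b \<ge> 0\<close> and \<open>u = v E\<^sub>\<lambda>\<close>. Completing the square turns
  \<open>\<integral> |\<nabla>u|\<^sup>2|x|\<^sup>-\<^sup>2\<^sup>b + \<lambda>\<^sup>2 \<integral> u\<^sup>2|x|\<^sup>-\<^sup>2\<^sup>a - 2\<lambda> C \<integral> u\<^sup>2|x|\<^sup>-\<^sup>a\<^sup>-\<^sup>b\<^sup>-\<^sup>1\<close> into the Dirichlet form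
  \<open>\<integral> |\<nabla>v|\<^sup>2 E\<^sub>\<lambda>\<^sup>2|x|\<^sup>-\<^sup>2\<^sup>b\<close>, so all claims are spectral gap estimates in \<open>L\<^sup>2(E\<^sub>\<lambda>\<^sup>2|x|\<^sup>-\<^sup>a\<^sup>-\<^sup>b\<^sup>-\<^sup>1)\<close>. The eigenfunctions are
  \<open>|x|\<^sup>s p(|x|\<^sup>\<alpha>) P\<^sub>k(x\<sqdot>y/|x|)\<close> with \<open>P\<^sub>k\<close> a Gegenbauer polynomial, \<open>y\<close> a unit vector,
  \<open>s (s + \<nu>) = k (k + N - 2)\<close> and \<open>p\<close> a Laguerre type polynomial of degree \<open>j\<close>; the eigenvalue is
  \<open>\<lambda> (2 s + 2 \<alpha> j)\<close>. Since eigenfunctions with different eigenvalues are orthogonal, Bessel's inequality for the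
  Dirichlet form gives the gaps once the eigenfunctions are known to span a dense subspace. Density follows from
  the approximation of continuous functions by sums of \<open>exp (x\<sqdot>y)\<close>, whose Taylor terms are radial functions times
  polynomials in \<open>x\<sqdot>y/|x|\<close>, together with the expansion of \<open>exp (-c|x|\<^sup>\<alpha>)\<close> in powers of \<open>|x|\<^sup>\<alpha>\<close>. No
  integration over spheres is used. The bounds for \<open>\<delta>\<^sub>2\<close> come from the choice of \<open>\<lambda>\<close> that balances the two energies.
\<close>

subsection \<open>Powers of the norm\<close>

text \<open>Orthogonality is needed only between different eigenvalues, where it follows from the
  symmetry of the Dirichlet form. Zonal functions about different axes, and different pairs
  \<open>(k, j)\<close> with a common eigenvalue, are simply added up, so no orthonormal basis of
  spherical harmonics and no addition theorem appears. The first obstacle is the origin: the weights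
  are singular there, the gradient of \<open>v\<close> may behave like
  \<open>norm x powr (al - 1)\<close> and the modes like \<open>norm x powr s\<close>. Hence all
  calculus is done off the origin, in a class whose gradients are bounded by
  \<open>norm x powr (sg - 1)\<close> near 0, with \<open>sg > 0\<close> at most every positive
  exponent in play. The second obstacle is growth: Taylor series serve for density only with a
  square integrable majorant, so \<open>exp (x \<bullet> y)\<close> is expanded under a cutoff, and
  \<open>exp (- m * S / 2)\<close> one factor \<open>exp (- S / 2)\<close> at a time. As for the
  constants, \<open>D1 / 2\<close> and \<open>D2 / 2\<close> are the exponents \<open>s\<close> for
  \<open>k = 1\<close> and \<open>k = 2\<close>, and \<open>C1 = 2 * al\<close> is the price of
  raising \<open>j\<close> by one; the constants of the refined inequalities are thus distances
  between thresholds in this spectrum.\<close>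

lemma powr_le_exp:
  fixes c al d :: real
  assumes "c > 0" "al > 0" "d \<ge> 0"
  obtains K where "K > 0" "\<And>r. r \<ge> 0 \<Longrightarrow> r powr d \<le> K * exp (c * r powr al)"
proof -
  obtain m :: nat where m: "d / al \<le> real m" using real_arch_simple by blast
  hence m: "d \<le> real m * al" using assms by (simp add: field_simps)
  \<comment> \<open>The summand 1 serves \<open>r < 1\<close>, where \<open>r powr d <= 1\<close>;
    the other one compares \<open>r powr (m * al)\<close> with the single term of order
    \<open>m\<close> of the exponential series.\<close>
  define K where "K = 1 + fact m / c ^ m"
  have K: "K > 0" "K \<ge> 1" "fact m / c ^ m \<le> K" using assms by (auto simp: K_def add_pos_pos)
  show ?thesis
  proof (rule that[OF K(1)])
    fix r :: real assume r: "r \<ge> 0"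
    have e: "1 \<le> exp (c * r powr al)" using assms by simp
    show "r powr d \<le> K * exp (c * r powr al)"
    proof (cases "r < 1")
      case True
      hence "r powr d \<le> 1 powr d" using r assms by (intro powr_mono2) auto
      also have "\<dots> \<le> K * exp (c * r powr al)" using mult_mono[OF K(2) e] K by simp
      finally show ?thesis .
    next
      case False
      have "r powr d \<le> r powr (real m * al)" using m False by (intro powr_mono) auto
      also have "\<dots> = (r powr al) ^ m" using False by (simp add: powr_powr[symmetric] powr_realpow mult.commute)
      also have "\<dots> = fact m / c ^ m * ((c * r powr al) ^ m / fact m)"
        using assms by (simp add: power_mult_distrib)
      also have "\<dots> \<le> K * exp (c * r powr al)"
      proof (intro mult_mono K(3))
        show "(c * r powr al) ^ m / fact m \<le> exp (c * r powr al)"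
        proof -
          have x: "0 \<le> c * r powr al" using assms by simp
          have "(c * r powr al) ^ m / fact m \<le> (\<Sum>n\<le>m. (c * r powr al) ^ n / fact n)"
            by (rule member_le_sum[where f="\<lambda>n. (c * r powr al) ^ n / fact n"]) (use x in auto)
          also have "\<dots> \<le> exp (c * r powr al)"
            unfolding exp_def using x assms(1)
            by (intro order.trans[OF _ sum_le_suminf[where I="{..m}"]])
               (auto simp: scaleR_conv_of_real field_simps summable_exp_generic
                  intro!: sum_mono order.refl summable_exp[of "c * r powr al", simplified])
          finally show ?thesis .
        qed
      qed (use assms K in auto)
      finally show ?thesis .
    qed
  qed
qed

text \<open>On the shell between \<open>\<rho> ^ n\<close> and \<open>2 * \<rho> ^ n\<close> the
  integrand is at most a constant times its value at the inner radius, and the volume is of order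
  \<open>(\<rho> ^ n) ^ N\<close>, so the shells contribute a geometric series with ratio
  \<open>q\<close>. Taking \<open>\<rho> = 1/2\<close> handles the origin and
  \<open>\<rho> = 2\<close> infinity, without polar coordinates.\<close>

lemma nn_integral_norm_powr_shells:
  fixes \<rho> \<beta> :: real
  assumes "\<rho> > 0" and "\<rho> powr (\<beta> + real DIM('a::euclidean_space)) < 1"
  shows "(\<integral>\<^sup>+(x::'a). ennreal (norm x powr \<beta>)
      * indicator {x. \<exists>n::nat. \<rho> ^ n \<le> norm x \<and> norm x \<le> 2 * \<rho> ^ n} x \<partial>lborel) < \<infinity>"
proof -
  define N where "N = real DIM('a)"
  define q where "q = \<rho> powr (\<beta> + N)"
  define C where "C = 2 powr \<bar>\<beta>\<bar>"
  have q: "0 < q" "q < 1" using assms by (auto simp: q_def N_def)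
  have term_le: "f n \<le> suminf f" for f :: "nat \<Rightarrow> ennreal" and n
    using sum_le_suminf[of f "{n}"] by simp
  have "(\<integral>\<^sup>+(x::'a). ennreal (norm x powr \<beta>)
      * indicator {x. \<exists>n::nat. \<rho> ^ n \<le> norm x \<and> norm x \<le> 2 * \<rho> ^ n} x \<partial>lborel)
      \<le> (\<integral>\<^sup>+(x::'a). (\<Sum>n. ennreal (C * (\<rho> ^ n) powr \<beta>) * indicator (cball 0 (2 * \<rho> ^ n)) x) \<partial>lborel)"
  proof (rule nn_integral_mono)
    fix x :: 'a
    show "ennreal (norm x powr \<beta>) * indicator {x. \<exists>n::nat. \<rho> ^ n \<le> norm x \<and> norm x \<le> 2 * \<rho> ^ n} x
      \<le> (\<Sum>n. ennreal (C * (\<rho> ^ n) powr \<beta>) * indicator (cball 0 (2 * \<rho> ^ n)) x)" (is "?l \<le> (\<Sum>n. ?f n)")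
    proof (cases "\<exists>n::nat. \<rho> ^ n \<le> norm x \<and> norm x \<le> 2 * \<rho> ^ n")
      case True
      then obtain n where n: "\<rho> ^ n \<le> norm x" "norm x \<le> 2 * \<rho> ^ n" by blast
      have pos: "\<rho> ^ n > 0" using assms by simp
      have C1: "C \<ge> 1" by (simp add: C_def ge_one_powr_ge_zero)
      have "norm x powr \<beta> \<le> C * (\<rho> ^ n) powr \<beta>"
      proof (cases "\<beta> \<ge> 0")
        case True
        have "norm x powr \<beta> \<le> (2 * \<rho> ^ n) powr \<beta>" using n True by (intro powr_mono2) auto
        also have "\<dots> = C * (\<rho> ^ n) powr \<beta>" using pos True by (simp add: powr_mult C_def)
        finally show ?thesis .
      next
        case False
        have "norm x powr \<beta> \<le> (\<rho> ^ n) powr \<beta>" using n pos False by (intro powr_mono2') auto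
        also have "\<dots> \<le> C * (\<rho> ^ n) powr \<beta>" using C1 by (simp add: mult_le_cancel_right1)
        finally show ?thesis .
      qed
      hence "?l \<le> ?f n" using n by (auto simp: indicator_def dist_norm intro!: ennreal_leI)
      also have "\<dots> \<le> (\<Sum>n. ?f n)"
        by (rule term_le)
      finally show ?thesis .
    qed (auto simp: indicator_def)
  qed
  also have "\<dots> = (\<Sum>n. ennreal (C * (\<rho> ^ n) powr \<beta>) * emeasure lborel (cball (0::'a) (2 * \<rho> ^ n)))"
  proof -
    define f where "f n x = ennreal (C * (\<rho> ^ n) powr \<beta>) * indicator (cball 0 (2 * \<rho> ^ n)) x" for n and x :: 'a
    have [measurable]: "f n \<in> borel_measurable lborel" for n
      unfolding f_def by (intro borel_measurable_times_ennreal borel_measurable_indicator) auto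
    have "(\<integral>\<^sup>+x. (\<Sum>n. f n x) \<partial>lborel) = (\<Sum>n. integral\<^sup>N lborel (f n))"
      by (rule nn_integral_suminf) simp
    also have "\<dots> = (\<Sum>n. ennreal (C * (\<rho> ^ n) powr \<beta>) * emeasure lborel (cball (0::'a) (2 * \<rho> ^ n)))"
      unfolding f_def by (rule suminf_cong, rule nn_integral_cmult_indicator) simp
    finally show ?thesis unfolding f_def .
  qed
  also have "\<dots> = (\<Sum>n. ennreal (C * (unit_ball_vol N * 2 powr N) * q ^ n))"
  proof (rule suminf_cong)
    fix n
    have pos: "\<rho> ^ n > 0" using assms by simp
    have "(2 * \<rho> ^ n) ^ DIM('a) = 2 powr N * (\<rho> ^ n) powr N"
      using pos by (simp add: power_mult_distrib N_def powr_realpow)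
    moreover have "(\<rho> ^ n) powr \<beta> * (\<rho> ^ n) powr N = q ^ n"
    proof -
      have "(\<rho> ^ n) powr \<beta> * (\<rho> ^ n) powr N = (\<rho> powr real n) powr (\<beta> + N)"
        using assms by (simp add: powr_add powr_realpow)
      also have "\<dots> = (\<rho> powr (\<beta> + N)) powr real n" by (simp only: powr_powr mult.commute)
      also have "\<dots> = q ^ n" using assms q(1) by (simp add: powr_realpow q_def)
      finally show ?thesis .
    qed
    ultimately have eq: "(C * (\<rho> ^ n) powr \<beta>) * (unit_ball_vol N * (2 * \<rho> ^ n) ^ DIM('a))
        = C * (unit_ball_vol N * 2 powr N) * q ^ n"
      by (metis (no_types, opaque_lifting) mult.assoc mult.commute)
    show "ennreal (C * (\<rho> ^ n) powr \<beta>) * emeasure lborel (cball (0::'a) (2 * \<rho> ^ n))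
      = ennreal (C * (unit_ball_vol N * 2 powr N) * q ^ n)"
    proof -
      have "emeasure lborel (cball (0::'a) (2 * \<rho> ^ n)) = ennreal (unit_ball_vol N * (2 * \<rho> ^ n) ^ DIM('a))"
        using pos by (subst emeasure_cball) (auto simp: N_def)
      moreover have "C * (\<rho> ^ n) powr \<beta> \<ge> 0" by (simp add: C_def)
      ultimately show ?thesis unfolding eq[symmetric] by (simp only: ennreal_mult')
    qed
  qed
  also have "\<dots> = ennreal (\<Sum>n. C * (unit_ball_vol N * 2 powr N) * q ^ n)"
    using q by (intro suminf_ennreal2 summable_mult summable_geometric)
      (auto simp: C_def N_def intro!: mult_nonneg_nonneg)
  also have "\<dots> < \<infinity>" by simp
  finally show ?thesis .
qed

lemma integrable_powr_exp:
  fixes \<beta> c al :: real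
  assumes "\<beta> > - real DIM('a::euclidean_space)" "c > 0" "al > 0"
  shows "integrable lborel (\<lambda>x::'a. norm x powr \<beta> * exp (- (c * norm x powr al)))"
proof (rule integrableI_nonneg)
  define N where "N = real DIM('a)"
  let ?A = "{x::'a. \<exists>n::nat. (1/2) ^ n \<le> norm x \<and> norm x \<le> 2 * (1/2) ^ n}"
  let ?B = "{x::'a. \<exists>n::nat. 2 ^ n \<le> norm x \<and> norm x \<le> 2 * 2 ^ n}"
  \<comment> \<open>The exponent is chosen to leave \<open>norm x powr (- N - 1)\<close> at
    infinity, for which the shells with \<open>\<rho> = 2\<close> have ratio 1/2.\<close>
  obtain K where K: "K > 0" "\<And>r. r \<ge> 0 \<Longrightarrow> r powr (\<beta> + N + 1) \<le> K * exp (c * r powr al)"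
    using powr_le_exp[OF assms(2,3), of "\<beta> + N + 1"] assms(1) unfolding N_def by auto
  have cover: "x \<in> ?A \<union> ?B" if "x \<noteq> 0" for x :: 'a
  proof (cases "norm x < 1")
    case True
    define n where "n = nat \<lfloor>- log 2 (norm x)\<rfloor>"
    have l: "log 2 (norm x) < 0" using True that by (simp add: log_less_zero_cancel_iff)
    have n: "real n \<le> - log 2 (norm x)" "- log 2 (norm x) < real n + 1"
    proof -
      have "real n = of_int \<lfloor>- log 2 (norm x)\<rfloor>" using l by (simp add: n_def)
      thus "real n \<le> - log 2 (norm x)" "- log 2 (norm x) < real n + 1"
        using floor_correct[of "- log 2 (norm x)"] by linarith+
    qed
    have eq: "(1/2::real) ^ k = 2 powr - real k" for k
      by (simp add: powr_minus powr_realpow power_one_over inverse_eq_divide)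
    have nx: "norm x = 2 powr (log 2 (norm x))" using that by simp
    have "(1/2) ^ (n+1) \<le> norm x"
      unfolding eq by (subst nx, intro powr_mono) (use n in auto)
    moreover have "norm x \<le> 2 * (1/2) ^ (n+1)"
    proof -
      have "norm x \<le> (1/2) ^ n" unfolding eq by (subst nx, intro powr_mono) (use n in auto)
      thus ?thesis by simp
    qed
    ultimately show ?thesis by blast
  next
    case False
    define n where "n = nat \<lfloor>log 2 (norm x)\<rfloor>"
    have l: "log 2 (norm x) \<ge> 0" using False that by simp
    have n: "real n \<le> log 2 (norm x)" "log 2 (norm x) < real n + 1"
    proof -
      have "real n = of_int \<lfloor>log 2 (norm x)\<rfloor>" using l by (simp add: n_def)
      thus "real n \<le> log 2 (norm x)" "log 2 (norm x) < real n + 1"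
        using floor_correct[of "log 2 (norm x)"] by linarith+
    qed
    have eq: "(2::real) ^ k = 2 powr real k" for k by (simp add: powr_realpow)
    have nx: "norm x = 2 powr (log 2 (norm x))" using that by simp
    have "2 ^ n \<le> norm x" unfolding eq by (subst nx, intro powr_mono) (use n in auto)
    moreover have "norm x \<le> 2 ^ (n+1)"
      unfolding eq by (subst nx, intro powr_mono) (use n in auto)
    ultimately show ?thesis by (auto intro!: exI[of _ n])
  qed
  have bd: "norm x powr \<beta> * exp (- (c * norm x powr al)) \<le> K * norm x powr (- N - 1)" if "x \<noteq> 0" for x :: 'a
  proof -
    have "norm x powr \<beta> = norm x powr (\<beta> + N + 1) * norm x powr (- N - 1)"
      using that by (simp add: powr_add[symmetric])
    also have "\<dots> \<le> K * exp (c * norm x powr al) * norm x powr (- N - 1)"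
      by (intro mult_right_mono K) auto
    finally have "norm x powr \<beta> * exp (- (c * norm x powr al)) \<le> K * exp (c * norm x powr al) * norm x powr (- N - 1) * exp (- (c * norm x powr al))"
      by (intro mult_right_mono) auto
    thus ?thesis by (simp add: exp_minus field_simps)
  qed
  have "(\<integral>\<^sup>+(x::'a). ennreal (norm x powr \<beta> * exp (- (c * norm x powr al))) \<partial>lborel)
    \<le> (\<integral>\<^sup>+(x::'a). ennreal (norm x powr \<beta>) * indicator ?A x + ennreal K * (ennreal (norm x powr (- N - 1)) * indicator ?B x) \<partial>lborel)"
  proof (rule nn_integral_mono)
    fix x :: 'a
    have 1: "norm x powr \<beta> * exp (- (c * norm x powr al)) \<le> norm x powr \<beta>"
      using assms by (intro mult_left_le) auto
    show "ennreal (norm x powr \<beta> * exp (- (c * norm x powr al))) \<le> ennreal (norm x powr \<beta>) * indicator ?A x + ennreal K * (ennreal (norm x powr (- N - 1)) * indicator ?B x)"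
    proof (cases "x = 0")
      case False
      from cover[OF this] show ?thesis
      proof
        assume "x \<in> ?A"
        hence "ennreal (norm x powr \<beta>) * indicator ?A x = ennreal (norm x powr \<beta>)" by (simp add: indicator_def)
        thus ?thesis using 1 by (metis (no_types, lifting) add_increasing2 ennreal_leI zero_le)
      next
        assume "x \<in> ?B"
        hence "ennreal K * (ennreal (norm x powr (- N - 1)) * indicator ?B x) = ennreal (K * norm x powr (- N - 1))"
          using K by (simp add: indicator_def ennreal_mult')
        thus ?thesis using bd[OF False] by (metis (no_types, lifting) add_increasing ennreal_leI zero_le)
      qed
    qed auto
  qed
  also have "\<dots> = (\<integral>\<^sup>+(x::'a). ennreal (norm x powr \<beta>) * indicator ?A x \<partial>lborel)
     + ennreal K * (\<integral>\<^sup>+(x::'a). ennreal (norm x powr (- N - 1)) * indicator ?B x \<partial>lborel)"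
    by (subst nn_integral_add) (auto simp: nn_integral_cmult)
  also have "\<dots> < \<infinity>"
  proof -
    have 1: "(1/2::real) powr (\<beta> + N) < 1" using assms(1)
      by (simp add: powr_divide N_def)
    have 2: "(2::real) powr ((- N - 1) + N) < 1" by (simp add: powr_minus)
    show ?thesis
      using nn_integral_norm_powr_shells[where 'a='a and \<rho>="1/2" and \<beta>=\<beta>]
        nn_integral_norm_powr_shells[where 'a='a and \<rho>=2 and \<beta>="- N - 1"] 1 2
      by (simp add: N_def[symmetric] ennreal_mult_less_top)
  qed
  finally show "(\<integral>\<^sup>+(x::'a). ennreal (norm x powr \<beta> * exp (- (c * norm x powr al))) \<partial>lborel) < \<infinity>" .
qed auto

subsection \<open>Integration by parts away from the origin\<close>

text \<open>Translation invariance makes every difference quotient of \<open>g\<close> integrate to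
  zero; dominated convergence passes to the derivative. This works in any direction at once and
  needs no iterated integrals.\<close>

lemma integral_dir_deriv_compact_support:
  fixes g :: "'a::euclidean_space \<Rightarrow> real" and D :: "'a \<Rightarrow> 'a"
  assumes der: "\<And>x. (g has_derivative (\<lambda>h. D x \<bullet> h)) (at x)"
    and cont: "continuous_on UNIV D" and supp: "\<And>x. norm x > R \<Longrightarrow> g x = 0"
  shows "integrable lborel (\<lambda>x. D x \<bullet> y)" "(LINT x|lborel. D x \<bullet> y) = 0"
proof -
  have D0: "D x = 0" if "norm x > R" for x
  proof -
    have "((\<lambda>_. 0) has_derivative (\<lambda>h. D x \<bullet> h)) (at x)"
    proof (rule has_derivative_transform_within_open[OF der])
      show "open {x. norm x > R}" by (intro open_Collect_less continuous_intros)
    qed (use that supp in auto)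
    from has_derivative_unique[OF this has_derivative_const]
    have "D x \<bullet> D x = 0" by metis
    thus ?thesis by simp
  qed
  have "compact (D ` cball 0 R)" by (intro compact_continuous_image continuous_on_subset[OF cont]) auto
  then obtain B where B: "\<And>x. norm x \<le> R \<Longrightarrow> norm (D x) \<le> B" "B > 0"
    by (metis (no_types, lifting) bounded_pos compact_imp_bounded imageI mem_cball_0)
  have B': "norm (D x) \<le> B" for x using B D0[of x] by (cases "norm x \<le> R") auto
  have gc: "continuous_on S g" for S
    using der by (auto intro!: continuous_at_imp_continuous_on dest: has_derivative_continuous)
  have int_cont: "integrable lborel f" if "continuous_on UNIV f" "\<And>x. norm x > R \<Longrightarrow> f x = 0" for f :: "'a \<Rightarrow> real"
  proof -
    have "integrable lborel (\<lambda>x. indicator (cball 0 R) x *\<^sub>R f x)"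
      by (intro borel_integrable_compact continuous_on_subset[OF that(1)]) auto
    moreover have "(\<lambda>x. indicator (cball 0 R) x *\<^sub>R f x) = f"
      using that(2) by (auto simp: indicator_def fun_eq_iff)
    ultimately show ?thesis by simp
  qed
  have gi: "integrable lborel g" using gc supp by (rule int_cont)
  show Di: "integrable lborel (\<lambda>x. D x \<bullet> y)"
    by (rule int_cont) (use D0 cont in \<open>auto intro!: continuous_intros\<close>)
  have shift: "integrable lborel (\<lambda>x. g (c + x))" "(LINT x|lborel. g (c + x)) = (LINT x|lborel. g x)" for c
  proof -
    have m: "(+) c \<in> borel_measurable borel" by simp
    have gm: "g \<in> borel_measurable borel" using gc by (intro borel_measurable_continuous_onI)
    show "integrable lborel (\<lambda>x. g (c + x))"
      using gi integrable_distr_eq[of "(+) c" lborel borel g] gm by (simp add: lborel_distr_plus)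
    show "(LINT x|lborel. g (c + x)) = (LINT x|lborel. g x)"
      using integral_distr[of "(+) c" lborel borel g] gm by (simp add: lborel_distr_plus)
  qed
  define t where "t n = inverse (real (Suc n))" for n
  have t: "t n > 0" "t n \<le> 1" for n by (auto simp: t_def field_simps)
  have t0: "t \<longlonglongrightarrow> 0" unfolding t_def by (rule LIMSEQ_inverse_real_of_nat)
  define s where "s n x = (g (t n *\<^sub>R y + x) - g x) / t n" for n x
  have "(\<lambda>n. LINT x|lborel. s n x) \<longlonglongrightarrow> (LINT x|lborel. D x \<bullet> y)"
  \<comment> \<open>Since \<open>t n <= 1\<close>, the quotients vanish outside radius
    \<open>R + norm y\<close>, and the mean value inequality bounds them by
    \<open>B * norm y\<close>.\<close>
  proof (rule integral_dominated_convergence[where w="\<lambda>x. indicator (cball 0 (R + norm y)) x *\<^sub>R (B * norm y)"])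
    show "(\<lambda>x. D x \<bullet> y) \<in> borel_measurable lborel" using Di by auto
    show "s n \<in> borel_measurable lborel" for n
      unfolding s_def using gi shift(1)[of "t n *\<^sub>R y"] by (intro borel_measurable_divide borel_measurable_diff) auto
    show "integrable lborel (\<lambda>x::'a. indicator (cball 0 (R + norm y)) x *\<^sub>R (B * norm y))"
      by (intro borel_integrable_compact) auto
    show "AE x in lborel. (\<lambda>n. s n x) \<longlonglongrightarrow> D x \<bullet> y"
    proof (intro AE_I2)
      fix x
      have gx: "(g has_derivative (\<lambda>h. D x \<bullet> h)) (at (0 *\<^sub>R y + x))" using der by simp
      have "((\<lambda>r::real. r *\<^sub>R y + x) has_derivative (\<lambda>r. r *\<^sub>R y)) (at 0)"
        by (auto intro!: derivative_eq_intros)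
      from has_derivative_compose[OF this gx]
      have "((\<lambda>r::real. g (r *\<^sub>R y + x)) has_field_derivative (D x \<bullet> y)) (at 0)"
        by (simp add: has_field_derivative_def mult_commute_abs)
      hence "((\<lambda>h. (g (h *\<^sub>R y + x) - g x) / h) \<longlongrightarrow> D x \<bullet> y) (at 0)"
        by (simp add: DERIV_def)
      moreover have "filterlim t (at 0) sequentially"
        using t0 less_imp_neq[OF t(1)] unfolding filterlim_at by (metis (mono_tags, lifting) UNIV_I always_eventually)
      ultimately show "(\<lambda>n. s n x) \<longlonglongrightarrow> D x \<bullet> y"
        unfolding s_def by (rule filterlim_compose)
    qed
    show "AE x in lborel. norm (s n x) \<le> indicator (cball 0 (R + norm y)) x *\<^sub>R (B * norm y)" for n
    proof (intro AE_I2)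
      fix x
      have ns: "norm (t n *\<^sub>R y) \<le> norm y" using t[of n] by (simp add: mult_left_le_one_le)
      show "norm (s n x) \<le> indicator (cball 0 (R + norm y)) x *\<^sub>R (B * norm y)"
      proof (cases "norm x \<le> R + norm y")
        case True
        have "norm (g (t n *\<^sub>R y + x) - g x) \<le> B * norm (t n *\<^sub>R y + x - x)"
        proof (rule differentiable_bound[OF convex_UNIV])
          show "onorm (\<lambda>h. D z \<bullet> h) \<le> B" for z
          proof (rule onorm_le)
            fix h show "norm (D z \<bullet> h) \<le> B * norm h"
              using Cauchy_Schwarz_ineq2[of "D z" h] mult_right_mono[OF B'[of z], of "norm h"] by simp
          qed
        qed (use der in auto)
        thus ?thesis using True t[of n] by (simp add: s_def field_simps)
      next
        case False
        hence "norm x > R" using norm_ge_zero[of y] by linarith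
        moreover have "norm (t n *\<^sub>R y + x) > R"
          using False ns norm_triangle_ineq4[of "t n *\<^sub>R y + x" "t n *\<^sub>R y"] by simp
        ultimately show ?thesis using supp False by (simp add: s_def)
      qed
    qed
  qed
  moreover have "(LINT x|lborel. s n x) = 0" for n
    unfolding s_def using shift gi by (simp add: integral_diff)
  ultimately show "(LINT x|lborel. D x \<bullet> y) = 0"
    by (simp add: LIMSEQ_const_iff)
qed

lemma has_derivative_continuous_on_punctured:
  assumes "\<And>x. x \<noteq> 0 \<Longrightarrow> (f has_derivative f' x) (at x)"
  shows "continuous_on (- {0}) f"
  using assms by (auto intro!: continuous_at_imp_continuous_on dest: has_derivative_continuous)

lemma norm_has_derivative:
  fixes x :: "'a::real_inner"
  assumes "x \<noteq> 0"
  shows "(norm has_derivative (\<lambda>h. (x \<bullet> h) / norm x)) (at x)"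
  using has_derivative_norm[OF assms] by (simp add: sgn_div_norm divide_inverse inner_commute mult.commute)

lemma norm_powr_has_derivative:
  fixes x :: "'a::real_inner"
  assumes x: "x \<noteq> 0"
  shows "((\<lambda>x. norm x powr e) has_derivative (\<lambda>h. e * norm x powr (e - 2) * (x \<bullet> h))) (at x)"
proof -
  have "((\<lambda>r. r powr e) has_real_derivative e * norm x powr (e - 1)) (at (norm x))"
    using x by (intro has_real_derivative_powr) auto
  from has_derivative_compose[OF norm_has_derivative[OF x] this[unfolded has_field_derivative_def]]
  have "((\<lambda>x. norm x powr e) has_derivative (\<lambda>h. e * norm x powr (e - 1) * ((x \<bullet> h) / norm x))) (at x)" .
  moreover have "norm x powr (e - 2) = norm x powr (e - 1) / norm x"
    using x powr_diff[of "norm x" "e - 1" 1] by simp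
  ultimately show ?thesis by simp
qed

lemma borel_measurable_punctured:
  fixes f :: "'a::euclidean_space \<Rightarrow> 'b::topological_space"
  assumes "continuous_on (- {0}) f"
  shows "f \<in> borel_measurable borel"
  by (rule borel_measurable_continuous_countable_exceptions[where X="{0}"])
     (use assms in auto)

text \<open>The logarithmic cutoff \<open>\<eta> (ln \<bar>x\<bar> / n)\<close>, with \<open>\<eta> s = (max 0 (1 - s\<^sup>2))\<^sup>2\<close>, has gradient
  \<open>O(1 / (n \<bar>x\<bar>))\<close>, so the error it produces vanishes as soon as \<open>F / \<bar>x\<bar>\<close> is integrable.\<close>

lemma integral_dir_deriv_punctured:
  fixes F :: "'a::euclidean_space \<Rightarrow> real" and D :: "'a \<Rightarrow> 'a"
  assumes der: "\<And>x. x \<noteq> 0 \<Longrightarrow> (F has_derivative (\<lambda>h. D x \<bullet> h)) (at x)"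
    and cont: "continuous_on (- {0}) D"
    and F: "integrable lborel (\<lambda>x. F x / norm x)" and Dy: "integrable lborel (\<lambda>x. D x \<bullet> y)"
  shows "(LINT x|lborel. D x \<bullet> y) = 0"
proof -
  \<comment> \<open>The outer square makes \<open>eta\<close> continuously differentiable also at 1
    and -1, as the lemma for compact support requires.\<close>
  define eta where "eta s = (max 0 (1 - s\<^sup>2))\<^sup>2" for s :: real
  define eta' where "eta' s = - 4 * s * max 0 (1 - s\<^sup>2)" for s :: real
  have m2: "((\<lambda>s::real. (max 0 s)\<^sup>2) has_real_derivative 2 * max 0 s) (at s)" for s
  proof -
    consider "s < 0" | "s = 0" | "s > 0" by linarith
    thus ?thesis
    proof cases
      case 1
      have "((\<lambda>s::real. 0) has_real_derivative 2 * max 0 s) (at s)" using 1 by simp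
      thus ?thesis
        by (rule has_field_derivative_transform_within_open[where S="{..<0}"]) (use 1 in auto)
    next
      case 3
      have "((\<lambda>s::real. s\<^sup>2) has_real_derivative 2 * max 0 s) (at s)" using 3 by (auto intro!: derivative_eq_intros)
      thus ?thesis
        by (rule has_field_derivative_transform_within_open[where S="{0<..}"]) (use 3 in auto)
    next
      case 2
      have "((\<lambda>h. ((max 0 h)\<^sup>2 - 0) / h) \<longlongrightarrow> 0) (at (0::real))"
      proof (rule Lim_null_comparison)
        show "\<forall>\<^sub>F h in at (0::real). norm (((max 0 h)\<^sup>2 - 0) / h) \<le> \<bar>h\<bar>"
          by (intro always_eventually) (auto simp: max_def power2_eq_square)
        show "((\<lambda>h. \<bar>h\<bar>) \<longlongrightarrow> 0) (at (0::real))" by (intro tendsto_eq_intros) auto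
      qed
      thus ?thesis using 2 by (simp add: DERIV_def)
    qed
  qed
  have eta: "(eta has_real_derivative eta' s) (at s)" for s
  proof -
    have d: "((\<lambda>s::real. 1 - s\<^sup>2) has_real_derivative - (2 * s)) (at s)"
      by (rule derivative_eq_intros refl | simp)+
    have e: "((\<lambda>s. (max 0 (1 - s\<^sup>2))\<^sup>2) has_real_derivative 2 * max 0 (1 - s\<^sup>2) * - (2 * s)) (at s)"
      using DERIV_chain2[OF m2 d] .
    have r: "2 * max 0 (1 - s\<^sup>2) * - (2 * s) = - 4 * s * max 0 (1 - s\<^sup>2)" by (simp add: mult_ac)
    show ?thesis unfolding eta_def eta'_def r[symmetric] by (rule e)
  qed
  have eta_b: "0 \<le> eta s" "eta s \<le> 1" "\<bar>eta' s\<bar> \<le> 4" for s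
  proof -
    have a: "0 \<le> max 0 (1 - s\<^sup>2)" "max 0 (1 - s\<^sup>2) \<le> 1" by auto
    show "0 \<le> eta s" by (simp add: eta_def)
    show "eta s \<le> 1" using power_le_one[OF a] by (simp add: eta_def)
    show "\<bar>eta' s\<bar> \<le> 4"
    proof (cases "\<bar>s\<bar> \<le> 1")
      case True
      thus ?thesis using a mult_mono[of "\<bar>s\<bar>" 1 "max 0 (1 - s\<^sup>2)" 1] by (simp add: eta'_def abs_mult)
    next
      case False
      hence "s\<^sup>2 > 1" by (metis one_less_power power2_abs pos2 not_le)
      thus ?thesis by (simp add: eta'_def)
    qed
  qed
  have eta_0: "eta s = 0" "eta' s = 0" if "\<bar>s\<bar> \<ge> 1" for s
  proof -
    have "s\<^sup>2 \<ge> 1" using that by (metis one_le_power power2_abs)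
    thus "eta s = 0" "eta' s = 0" by (auto simp: eta_def eta'_def)
  qed
  define g where "g n x = (if x = 0 then 0 else F x * eta (ln (norm x) / real n))" for n x
  define G where "G n x = (if x = 0 then 0 else eta (ln (norm x) / real n) *\<^sub>R D x
      + (F x * (eta' (ln (norm x) / real n) / real n / (norm x)\<^sup>2)) *\<^sub>R x)" for n x
  \<comment> \<open>The logarithm leaves the interval from \<open>- n\<close> to \<open>n\<close> on
    a whole ball around the origin, so the product extends by zero to a differentiable function and
    the singularity of \<open>F\<close> is never met.\<close>
  have near0: "g n x = 0 \<and> G n x = 0" if "norm x < exp (- real n)" "n > 0" for n x
  proof (cases "x = 0")
    case False
    hence "ln (norm x) < - real n" using that by (metis exp_less_cancel_iff exp_ln zero_less_norm_iff)
    hence "ln (norm x) / real n \<le> - 1" using that by (simp add: field_simps)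
    hence "\<bar>ln (norm x) / real n\<bar> \<ge> 1" by linarith
    thus ?thesis using eta_0 by (simp add: g_def G_def)
  qed (auto simp: g_def G_def)
  have far: "g n x = 0" if "norm x > exp (real n)" "n > 0" for n x
  proof -
    have n: "norm x > 0" using that by (meson exp_gt_zero less_trans)
    hence "ln (norm x) > real n" using that by (metis exp_less_cancel_iff exp_ln)
    hence "ln (norm x) / real n \<ge> 1" using that by (simp add: field_simps)
    hence "\<bar>ln (norm x) / real n\<bar> \<ge> 1" by linarith
    thus ?thesis using eta_0 n by (simp add: g_def)
  qed
  have Fc: "continuous_on (- {0}) F"
    using der by (rule has_derivative_continuous_on_punctured)
  have gder: "(g n has_derivative (\<lambda>h. G n x \<bullet> h)) (at x)" if n: "n > 0" for n x
  proof (cases "x = 0")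
    case True
    have "((\<lambda>_. 0) has_derivative (\<lambda>h. G n x \<bullet> h)) (at x)" using True by (simp add: G_def)
    thus ?thesis
      by (rule has_derivative_transform_within_open[where s="ball 0 (exp (- real n))"])
         (use near0[of _ n] True n in auto)
  next
    case False
    have "((\<lambda>x. ln (norm x) / real n) has_derivative (\<lambda>h. (x \<bullet> h) / (norm x)\<^sup>2 / real n)) (at x)"
      using False n by (auto intro!: derivative_eq_intros norm_has_derivative simp: power2_eq_square divide_simps)
    from has_derivative_compose[OF this eta[unfolded has_field_derivative_def]]
    have "((\<lambda>x. eta (ln (norm x) / real n)) has_derivative
      (\<lambda>h. eta' (ln (norm x) / real n) * ((x \<bullet> h) / (norm x)\<^sup>2 / real n))) (at x)" .
    from has_derivative_mult[OF der[OF False] this]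
    have "((\<lambda>x. F x * eta (ln (norm x) / real n)) has_derivative (\<lambda>h. G n x \<bullet> h)) (at x)"
      using False by (simp add: G_def inner_add_left algebra_simps)
    thus ?thesis
      by (rule has_derivative_transform_within_open[where s="-{0}"]) (use False in \<open>auto simp: g_def\<close>)
  qed
  have Gcont: "continuous_on UNIV (G n)" if n: "n > 0" for n
  proof (rule continuous_at_imp_continuous_on, rule ballI)
    fix x :: 'a
    show "isCont (G n) x"
    proof (cases "x = 0")
      case True
      have "\<forall>\<^sub>F y in nhds x. G n y = 0"
        unfolding eventually_nhds using near0[of _ n] n True
        by (intro exI[of _ "ball 0 (exp (- real n))"]) auto
      thus ?thesis by (simp add: isCont_cong)
    next
      case False
      have c1: "continuous_on UNIV eta" "continuous_on UNIV eta'"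
        unfolding eta_def eta'_def by (auto intro!: continuous_intros)
      have ct: "continuous_on (-{0}) (\<lambda>x. eta (ln (norm x) / real n))" "continuous_on (-{0}) (\<lambda>x. eta' (ln (norm x) / real n))"
        using n by (auto intro!: continuous_on_compose2[OF c1(1)] continuous_on_compose2[OF c1(2)] continuous_intros)
      have "continuous_on (-{0}) (\<lambda>x. eta (ln (norm x) / real n) *\<^sub>R D x
         + (F x * (eta' (ln (norm x) / real n) / real n / (norm x)\<^sup>2)) *\<^sub>R x)"
        using n by (intro continuous_intros ct Fc cont) auto
      hence "continuous_on (-{0}) (G n)"
        by (rule continuous_on_cong[THEN iffD1, rotated -1]) (auto simp: G_def)
      thus ?thesis using False continuous_on_eq_continuous_at[of "- {0::'a}" "G n"] by auto
    qed
  qed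
  define E where "E n x = F x * (eta' (ln (norm x) / real n) / real n / (norm x)\<^sup>2) * (x \<bullet> y)" for n x
  have Fm: "F \<in> borel_measurable borel"
    using Fc by (rule borel_measurable_punctured)
  have em: "eta \<in> borel_measurable borel" "eta' \<in> borel_measurable borel"
    unfolding eta_def eta'_def by (auto intro!: borel_measurable_continuous_onI continuous_intros)
  have Em: "E n \<in> borel_measurable lborel" for n
    unfolding E_def using Fm em by measurable
  have Eb: "\<bar>E n x\<bar> \<le> 4 * norm y / real n * \<bar>F x / norm x\<bar>" if "n > 0" for n x
  proof (cases "x = 0")
    case False
    have "\<bar>E n x\<bar> = \<bar>eta' (ln (norm x) / real n)\<bar> * \<bar>x \<bullet> y\<bar> * (\<bar>F x\<bar> / real n / (norm x)\<^sup>2)"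
      by (simp add: E_def abs_mult)
    also have "\<dots> \<le> 4 * (norm x * norm y) * (\<bar>F x\<bar> / real n / (norm x)\<^sup>2)"
      by (intro mult_mono eta_b Cauchy_Schwarz_ineq2) auto
    also have "\<dots> = 4 * norm y / real n * \<bar>F x / norm x\<bar>"
      using False by (simp add: power2_eq_square)
    finally show ?thesis .
  qed (simp add: E_def)
  have Ei: "integrable lborel (E n)" if "n > 0" for n
  proof (rule Bochner_Integration.integrable_bound)
    show "integrable lborel (\<lambda>x. 4 * norm y / real n * \<bar>F x / norm x\<bar>)"
      using F by (intro integrable_mult_right integrable_abs)
    show "AE x in lborel. norm (E n x) \<le> norm (4 * norm y / real n * \<bar>F x / norm x\<bar>)"
      using Eb[OF that] by (intro AE_I2) (metis abs_ge_self order.trans real_norm_def)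
  qed (rule Em)
  have key: "\<bar>LINT x|lborel. eta (ln (norm x) / real n) * (D x \<bullet> y)\<bar>
     \<le> 4 * norm y / real n * (LINT x|lborel. \<bar>F x / norm x\<bar>)" if n: "n > 0" for n
  proof -
    have 1: "integrable lborel (\<lambda>x. G n x \<bullet> y)" "(LINT x|lborel. G n x \<bullet> y) = 0"
      using integral_dir_deriv_compact_support[OF gder[OF n] Gcont[OF n] far[OF _ n]] by auto
    have ae: "AE x in lborel. x \<noteq> (0::'a)" by (rule AE_lborel_singleton)
    have "(LINT x|lborel. eta (ln (norm x) / real n) * (D x \<bullet> y)) = (LINT x|lborel. G n x \<bullet> y - E n x)"
    proof (rule integral_cong_AE)
      show "AE x in lborel. eta (ln (norm x) / real n) * (D x \<bullet> y) = G n x \<bullet> y - E n x"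
        using ae by eventually_elim (simp add: G_def E_def inner_add_left)
      show "(\<lambda>x. eta (ln (norm x) / real n) * (D x \<bullet> y)) \<in> borel_measurable lborel"
        using em Dy by measurable
    qed (use 1 Em in auto)
    also have "\<dots> = - (LINT x|lborel. E n x)" using 1 Ei[OF n] by simp
    finally have "\<bar>LINT x|lborel. eta (ln (norm x) / real n) * (D x \<bullet> y)\<bar> \<le> (LINT x|lborel. \<bar>E n x\<bar>)"
      using integral_abs_bound[of lborel "E n"] by simp
    also have "\<dots> \<le> (LINT x|lborel. 4 * norm y / real n * \<bar>F x / norm x\<bar>)"
      using Eb[OF n] by (intro integral_mono integrable_abs Ei[OF n] integrable_mult_right F)
    finally show ?thesis by (simp only: integral_mult_right_zero)
  qed
  have "(\<lambda>n. LINT x|lborel. eta (ln (norm x) / real n) * (D x \<bullet> y)) \<longlonglongrightarrow> (LINT x|lborel. D x \<bullet> y)"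
  proof (rule integral_dominated_convergence[where w="\<lambda>x. \<bar>D x \<bullet> y\<bar>"])
    show "AE x in lborel. (\<lambda>n. eta (ln (norm x) / real n) * (D x \<bullet> y)) \<longlonglongrightarrow> D x \<bullet> y"
    proof (intro AE_I2)
      fix x :: 'a
      have "(\<lambda>n. ln (norm x) / real n) \<longlonglongrightarrow> 0" by (rule lim_const_over_n)
      moreover have "isCont eta 0" using eta DERIV_isCont by blast
      ultimately have "(\<lambda>n. eta (ln (norm x) / real n)) \<longlonglongrightarrow> eta 0"
        using isCont_tendsto_compose by blast
      from tendsto_mult[OF this tendsto_const[of "D x \<bullet> y"]]
      show "(\<lambda>n. eta (ln (norm x) / real n) * (D x \<bullet> y)) \<longlonglongrightarrow> D x \<bullet> y" by (simp add: eta_def)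
    qed
    show "AE x in lborel. norm (eta (ln (norm x) / real n) * (D x \<bullet> y)) \<le> \<bar>D x \<bullet> y\<bar>" for n
      using eta_b by (intro AE_I2) (auto simp: abs_mult intro!: mult_left_le_one_le)
  qed (use Dy em in \<open>auto intro!: borel_measurable_times\<close>)
  moreover have "(\<lambda>n. LINT x|lborel. eta (ln (norm x) / real n) * (D x \<bullet> y)) \<longlonglongrightarrow> 0"
  proof (rule Lim_null_comparison)
    show "\<forall>\<^sub>F n in sequentially. norm (LINT x|lborel. eta (ln (norm x) / real n) * (D x \<bullet> y))
      \<le> 4 * norm y * (LINT x|lborel. \<bar>F x / norm x\<bar>) / real n"
      using eventually_gt_at_top[of 0] by eventually_elim (use key in simp)
    show "(\<lambda>n. 4 * norm y * (LINT x|lborel. \<bar>F x / norm x\<bar>) / real n) \<longlonglongrightarrow> 0"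
      by (rule lim_const_over_n)
  qed
  ultimately show ?thesis using LIMSEQ_unique by blast
qed

text \<open>The previous result is applied to \<open>(x \<bullet> i) * F x\<close> in each
  coordinate direction \<open>i\<close>. The factor \<open>x \<bullet> i\<close> compensates the
  division by \<open>norm x\<close>, so integrability of \<open>F\<close> itself is enough, and its
  own derivative contributes one integral of \<open>F\<close> per dimension.\<close>

lemma integral_divergence_radial:
  fixes F :: "'a::euclidean_space \<Rightarrow> real" and D :: "'a \<Rightarrow> 'a"
  assumes der: "\<And>x. x \<noteq> 0 \<Longrightarrow> (F has_derivative (\<lambda>h. D x \<bullet> h)) (at x)"
    and cont: "continuous_on (- {0}) D"
    and F: "integrable lborel F" and Dn: "integrable lborel (\<lambda>x. norm x * norm (D x))"
  shows "integrable lborel (\<lambda>x. D x \<bullet> x)"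
    "(LINT x|lborel. D x \<bullet> x) = - real DIM('a) * (LINT x|lborel. F x)"
proof -
  have Dm: "D \<in> borel_measurable borel"
    using cont by (rule borel_measurable_punctured)
  have Dxi: "integrable lborel (\<lambda>x. (x \<bullet> i) * (D x \<bullet> i))" if "i \<in> Basis" for i
  proof (rule Bochner_Integration.integrable_bound[OF Dn])
    show "AE x in lborel. norm ((x \<bullet> i) * (D x \<bullet> i)) \<le> norm (norm x * norm (D x))"
      using Basis_le_norm[OF that] by (intro AE_I2) (auto simp: abs_mult intro!: mult_mono)
  qed (use Dm in measurable)
  show "integrable lborel (\<lambda>x. D x \<bullet> x)"
    by (subst euclidean_inner) (use Dxi in \<open>auto simp: mult.commute\<close>)
  have z: "(LINT x|lborel. (x \<bullet> i) * (D x \<bullet> i)) = - (LINT x|lborel. F x)" if i: "i \<in> Basis" for i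
  proof -
    have "(LINT x|lborel. ((x \<bullet> i) *\<^sub>R D x + F x *\<^sub>R i) \<bullet> i) = 0"
    proof (rule integral_dir_deriv_punctured[where F="\<lambda>x. (x \<bullet> i) * F x"])
      show "((\<lambda>x. (x \<bullet> i) * F x) has_derivative (\<lambda>h. ((x \<bullet> i) *\<^sub>R D x + F x *\<^sub>R i) \<bullet> h)) (at x)" if "x \<noteq> 0" for x
        using that by (auto intro!: derivative_eq_intros der simp: fun_eq_iff inner_add_left inner_add_right inner_commute mult_ac)
      have "continuous_on (- {0}) F"
        using der by (rule has_derivative_continuous_on_punctured)
      thus "continuous_on (- {0}) (\<lambda>x. (x \<bullet> i) *\<^sub>R D x + F x *\<^sub>R i)"
        using cont by (intro continuous_intros)
      show "integrable lborel (\<lambda>x. (x \<bullet> i) * F x / norm x)"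
      proof (rule Bochner_Integration.integrable_bound[OF F])
        show "AE x in lborel. norm ((x \<bullet> i) * F x / norm x) \<le> norm (F x)"
        proof (intro AE_I2)
          fix x show "norm ((x \<bullet> i) * F x / norm x) \<le> norm (F x)"
            using mult_right_mono[OF Basis_le_norm[OF i, of x], of "\<bar>F x\<bar>"]
            by (cases "x = 0") (auto simp: abs_mult divide_simps mult_ac)
        qed
        show "(\<lambda>x. (x \<bullet> i) * F x / norm x) \<in> borel_measurable lborel"
          using F by (intro borel_measurable_divide borel_measurable_times) auto
      qed
      show "integrable lborel (\<lambda>x. ((x \<bullet> i) *\<^sub>R D x + F x *\<^sub>R i) \<bullet> i)"
        using Dxi[OF i] F i by (simp add: inner_add_left)
    qed
    moreover have "(LINT x|lborel. ((x \<bullet> i) *\<^sub>R D x + F x *\<^sub>R i) \<bullet> i)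
      = (LINT x|lborel. (x \<bullet> i) * (D x \<bullet> i)) + (LINT x|lborel. F x)"
      using Dxi[OF i] F i by (simp add: inner_add_left)
    ultimately show ?thesis by simp
  qed
  have "(LINT x|lborel. D x \<bullet> x) = (LINT x|lborel. (\<Sum>i\<in>Basis. (x \<bullet> i) * (D x \<bullet> i)))"
    by (subst euclidean_inner) (simp add: mult.commute)
  also have "\<dots> = (\<Sum>i\<in>Basis. LINT x|lborel. (x \<bullet> i) * (D x \<bullet> i))"
    using Dxi by simp
  also have "\<dots> = (\<Sum>i\<in>(Basis::'a set). - (LINT x|lborel. F x))" by (intro sum.cong refl z)
  finally show "(LINT x|lborel. D x \<bullet> x) = - real DIM('a) * (LINT x|lborel. F x)" by simp
qed

subsection \<open>Weighted spaces\<close>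

lemma abs_inner_divide_norm_le: "norm y = 1 \<Longrightarrow> \<bar>x \<bullet> y / norm x\<bar> \<le> 1"
  using Cauchy_Schwarz_ineq2[of x y] by (cases "x = 0") (auto simp: divide_simps)

lemma poly_bounded_unit_interval:
  fixes P :: "real poly"
  obtains K where "K > 0" "\<And>t. \<bar>t\<bar> \<le> 1 \<Longrightarrow> \<bar>poly P t\<bar> \<le> K"
proof -
  have "compact (poly P ` {-1..1})" by (intro compact_continuous_image continuous_intros) auto
  then obtain K where "K > 0" "\<And>y. y \<in> poly P ` {-1..1} \<Longrightarrow> norm y \<le> K"
    using compact_imp_bounded bounded_pos by metis
  thus ?thesis using that[of K] by (auto simp: abs_le_iff)
qed

text \<open>All weights contain a factor \<open>norm x powr _\<close>, which is \<open>0\<close> at \<open>x = 0\<close>, so values at the origin never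
  matter. The parameter \<open>sg\<close> only measures the admissible growth of gradients at the origin.\<close>

locale weighted_space =
  fixes al b l sg :: real and dim :: "'a::euclidean_space itself"
  assumes al: "al > 0" and l: "l > 0" and sg: "sg > 0" and nu_nonneg: "real DIM('a) - 2 - 2 * b \<ge> 0"
begin

definition "nu = real DIM('a) - 2 - 2 * b"

definition S :: "'a \<Rightarrow> real" where "S x = l * norm x powr al / al"

text \<open>\<open>wm\<close> is the weight for gradients, \<open>wmu\<close> the one for functions,
  both after division by the Gaussian-like \<open>exp (- S)\<close>. The parameter \<open>a\<close>
  is replaced by \<open>al = 1 + b - a\<close>, so that \<open>al - 2 - 2 * b\<close> is
  \<open>- (a + b + 1)\<close>.\<close>

definition wm :: "'a \<Rightarrow> real" where "wm x = norm x powr (- 2 * b) * exp (- 2 * S x)"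

definition wmu :: "'a \<Rightarrow> real" where "wmu x = norm x powr (al - 2 - 2 * b) * exp (- 2 * S x)"

text \<open>One family for all purposes: \<open>c = 0\<close> for the terms of eigenfunctions,
  \<open>c = 2\<close> for fields that already contain the weight, \<open>c = m / 2\<close> for
  powers of \<open>exp (- S / 2)\<close> in the density argument.\<close>

definition mon :: "real \<Rightarrow> real \<Rightarrow> real poly \<Rightarrow> 'a \<Rightarrow> 'a \<Rightarrow> real" where
  "mon c d P y x = norm x powr d * exp (- c * S x) * poly P (x \<bullet> y / norm x)"

definition dmon :: "real \<Rightarrow> real \<Rightarrow> real poly \<Rightarrow> 'a \<Rightarrow> 'a \<Rightarrow> 'a" where
  "dmon c d P y x = (norm x powr (d - 2) * exp (- c * S x) * ((d - c * l * norm x powr al) * poly P (x \<bullet> y / norm x)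
       - x \<bullet> y / norm x * poly (pderiv P) (x \<bullet> y / norm x))) *\<^sub>R x
     + (norm x powr (d - 1) * exp (- c * S x) * poly (pderiv P) (x \<bullet> y / norm x)) *\<^sub>R y"

text \<open>The rate 1/4 lets a product of two members cost \<open>exp (S / 2)\<close>, which leaves
  \<open>exp (- (3/2) * S)\<close> of the weights. At the origin two gradients give the power
  \<open>2 * sg - 2 - 2 * b\<close>, integrable because \<open>sg > 0\<close> and
  \<open>2 + 2 * b\<close> is at most the dimension.\<close>

definition cls :: "('a \<Rightarrow> real) \<Rightarrow> ('a \<Rightarrow> 'a) \<Rightarrow> bool" where
  "cls f D \<longleftrightarrow> (\<forall>x. x \<noteq> 0 \<longrightarrow> (f has_derivative (\<lambda>h. D x \<bullet> h)) (at x)) \<and> continuous_on (- {0}) D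
     \<and> (\<exists>K. \<forall>x. x \<noteq> 0 \<longrightarrow> \<bar>f x\<bar> \<le> K * exp (S x / 4) \<and> norm (D x) \<le> K * (norm x powr (sg - 1) * exp (S x / 4)))"

lemma S_nonneg: "S x \<ge> 0" using al l by (simp add: S_def)

lemma nu0: "nu \<ge> 0" using nu_nonneg by (simp add: nu_def)

lemma S_measurable [measurable]: "S \<in> borel_measurable borel"
  unfolding S_def by measurable

lemma wm_measurable [measurable]: "wm \<in> borel_measurable borel"
  unfolding wm_def by measurable

lemma wmu_measurable [measurable]: "wmu \<in> borel_measurable borel"
  unfolding wmu_def by measurable

lemma wmu_nonneg: "wmu x \<ge> 0" by (simp add: wmu_def)
lemma wm_nonneg: "wm x \<ge> 0" by (simp add: wm_def)

lemma integrable_of_bound: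
  fixes f :: "'a \<Rightarrow> real"
  assumes f: "f \<in> borel_measurable borel" and c: "c > 0" and \<beta>: "\<beta> > - real DIM('a)"
    and bound: "\<And>x. x \<noteq> 0 \<Longrightarrow> \<bar>f x\<bar> \<le> K * (norm x powr \<beta> * exp (- c * S x))"
  shows "integrable lborel f"
proof (rule Bochner_Integration.integrable_bound)
  show "integrable lborel (\<lambda>x::'a. K * (norm x powr \<beta> * exp (- (c * l / al * norm x powr al))))"
    using c l al \<beta> by (intro integrable_mult_right integrable_powr_exp) auto
  show "AE x in lborel. norm (f x) \<le> norm (K * (norm x powr \<beta> * exp (- (c * l / al * norm x powr al))))"
    using AE_lborel_singleton[of "0::'a"]
  proof eventually_elim
    case (elim x)
    have e: "- c * S x = - (c * l / al * norm x powr al)" by (simp add: S_def)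
    show ?case using bound[OF elim] unfolding e real_norm_def by (rule order.trans[OF _ abs_ge_self])
  qed
qed (use f in simp)

lemma powr_le_exp_S:
  assumes "c > 0" "d \<ge> 0"
  obtains K where "K > 0" "\<And>x. norm x powr d \<le> K * exp (c * S x)"
proof -
  have "c * l / al > 0" using assms l al by simp
  from powr_le_exp[OF this al assms(2)] obtain K where "K > 0"
    "\<And>r. r \<ge> 0 \<Longrightarrow> r powr d \<le> K * exp (c * l / al * r powr al)" by blast
  moreover have "c * l / al * norm x powr al = c * S x" for x by (simp add: S_def)
  ultimately show ?thesis using that[of K] by (metis norm_ge_zero)
qed

lemma S_has_derivative:
  assumes "x \<noteq> 0"
  shows "(S has_derivative (\<lambda>h. l * norm x powr (al - 2) * (x \<bullet> h))) (at x)"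
  using has_derivative_mult_right[OF norm_powr_has_derivative[OF assms, of al], of "l / al"] al
  unfolding S_def by (simp add: mult.assoc)

lemma mon_has_derivative:
  assumes x: "x \<noteq> 0"
  shows "(mon c d P y has_derivative (\<lambda>h. dmon c d P y x \<bullet> h)) (at x)"
proof -
  define r t where "r = norm x" and "t = x \<bullet> y / norm x"
  have r: "r > 0" using x by (simp add: r_def)
  note nd = norm_has_derivative[OF x, folded r_def]
  note 1 = norm_powr_has_derivative[OF x, of d, folded r_def]
  have 2: "((\<lambda>x. exp (- c * S x)) has_derivative (\<lambda>h. exp (- c * S x) * (- c * (l * r powr (al - 2) * (x \<bullet> h))))) (at x)"
    unfolding r_def
    using has_derivative_exp[OF has_derivative_mult_right[OF S_has_derivative[OF x], of "- c"]]
    by (rule has_derivative_eq_rhs) (simp add: fun_eq_iff mult_ac)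
  have 3: "((\<lambda>x. x \<bullet> y / norm x) has_derivative (\<lambda>h. (y \<bullet> h) / r - t * (x \<bullet> h) / r\<^sup>2)) (at x)"
    using x r by (auto intro!: derivative_eq_intros nd simp: r_def t_def fun_eq_iff inner_commute power2_eq_square divide_simps)
  have 4: "((\<lambda>x. poly P (x \<bullet> y / norm x)) has_derivative
      (\<lambda>h. poly (pderiv P) t * ((y \<bullet> h) / r - t * (x \<bullet> h) / r\<^sup>2))) (at x)"
    using has_derivative_compose[OF 3 poly_DERIV[of P "x \<bullet> y / norm x", unfolded has_field_derivative_def]] by (simp add: t_def)
  have pw: "r powr (d - 1) = r powr (d - 2) * r" "r powr d = r powr (d - 2) * r\<^sup>2"
     "r powr d * r powr (al - 2) = r powr (d - 2) * r powr al"
    using r by (simp_all add: powr_diff power2_eq_square powr_add[symmetric])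
  have "((\<lambda>x. norm x powr d * exp (- c * S x) * poly P (x \<bullet> y / norm x)) has_derivative
     (\<lambda>h. r powr d * exp (- c * S x) * (poly (pderiv P) t * ((y \<bullet> h) / r - t * (x \<bullet> h) / r\<^sup>2))
       + (r powr d * (exp (- c * S x) * (- c * (l * r powr (al - 2) * (x \<bullet> h)))) + d * r powr (d - 2) * (x \<bullet> h) * exp (- c * S x)) * poly P t)) (at x)"
    using has_derivative_mult[OF has_derivative_mult[OF 1 2] 4] unfolding r_def t_def .
  moreover have "(\<lambda>h. r powr d * exp (- c * S x) * (poly (pderiv P) t * ((y \<bullet> h) / r - t * (x \<bullet> h) / r\<^sup>2))
       + (r powr d * (exp (- c * S x) * (- c * (l * r powr (al - 2) * (x \<bullet> h)))) + d * r powr (d - 2) * (x \<bullet> h) * exp (- c * S x)) * poly P t)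
      = (\<lambda>h. dmon c d P y x \<bullet> h)" (is "?L = ?R")
  proof
    fix h
    have "?L h = exp (- c * S x) * (poly (pderiv P) t * (r powr d * ((y \<bullet> h) / r) - t * (x \<bullet> h) * (r powr d / r\<^sup>2)))
       + (- c * l * (r powr d * r powr (al - 2)) + d * r powr (d - 2)) * (x \<bullet> h) * (exp (- c * S x) * poly P t)"
      by (simp add: algebra_simps)
    also have "r powr d * ((y \<bullet> h) / r) = r powr (d - 1) * (y \<bullet> h)"
      using r by (simp add: pw power2_eq_square)
    also have "r powr d / r\<^sup>2 = r powr (d - 2)" using r by (simp add: pw)
    also note pw(3)
    also have "exp (- c * S x) * (poly (pderiv P) t * (r powr (d - 1) * (y \<bullet> h) - t * (x \<bullet> h) * r powr (d - 2)))
        + (- c * l * (r powr (d - 2) * r powr al) + d * r powr (d - 2)) * (x \<bullet> h) * (exp (- c * S x) * poly P t) = ?R h"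
      unfolding dmon_def t_def[symmetric] unfolding r_def[symmetric] by (simp add: inner_add_left algebra_simps)
    finally show "?L h = ?R h" .
  qed
  ultimately show ?thesis unfolding mon_def by simp
qed

lemma dmon_continuous: "continuous_on (- {0}) (dmon c d P y)"
proof -
  have S: "continuous_on (- {0}) S" unfolding S_def using al by (auto intro!: continuous_intros)
  show ?thesis unfolding dmon_def by (intro continuous_intros S) auto
qed

lemma mon_measurable [measurable]: "mon c d P y \<in> borel_measurable borel"
  using mon_has_derivative by (intro borel_measurable_punctured has_derivative_continuous_on_punctured)

text \<open>The factor \<open>x \<bullet> y / norm x\<close> stays in the interval from -1 to 1,
  where polynomials are bounded. Differentiating \<open>exp (- c * S x)\<close> produces
  \<open>c * l * norm x powr al = al * c * S x\<close>, hence the term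
  \<open>\<bar>c\<bar> * S x\<close> and the summand \<open>al\<close> in the constant.\<close>

lemma mon_bounds:
  assumes y: "norm y = 1"
  obtains K where "K > 0" "\<And>x. \<bar>mon c d P y x\<bar> \<le> K * (norm x powr d * exp (- c * S x))"
    "\<And>x. x \<noteq> 0 \<Longrightarrow> norm (dmon c d P y x) \<le> K * (norm x powr (d - 1) * exp (- c * S x) * (1 + \<bar>c\<bar> * S x))"
proof -
  obtain K0 where K0: "K0 > 0" "\<And>t. \<bar>t\<bar> \<le> 1 \<Longrightarrow> \<bar>poly P t\<bar> \<le> K0"
    using poly_bounded_unit_interval[of P] by blast
  obtain K1 where K1: "K1 > 0" "\<And>t. \<bar>t\<bar> \<le> 1 \<Longrightarrow> \<bar>poly (pderiv P) t\<bar> \<le> K1"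
    using poly_bounded_unit_interval[of "pderiv P"] by blast
  define K where "K = (1 + \<bar>d\<bar> + al) * K0 + 2 * K1"
  have "K = K0 + (\<bar>d\<bar> * K0 + al * K0 + 2 * K1)" by (simp add: K_def algebra_simps)
  moreover have "\<bar>d\<bar> * K0 + al * K0 + 2 * K1 \<ge> 0" using K0 K1 al by (intro add_nonneg_nonneg mult_nonneg_nonneg) auto
  ultimately have K: "K > 0" "K0 \<le> K" using K0 by linarith+
  show ?thesis
  proof (rule that[OF K(1)])
    fix x
    define t where "t = x \<bullet> y / norm x"
    have t: "\<bar>t\<bar> \<le> 1" unfolding t_def by (rule abs_inner_divide_norm_le[OF y])
    have pK: "\<bar>poly P t\<bar> \<le> K" using K0(2)[OF t] K by linarith
    show "\<bar>mon c d P y x\<bar> \<le> K * (norm x powr d * exp (- c * S x))"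
      using mult_left_mono[OF pK, of "norm x powr d * exp (- c * S x)"]
      by (simp add: mon_def abs_mult t_def mult_ac)
    assume x: "x \<noteq> 0"
    have cl: "\<bar>c * l * norm x powr al\<bar> = al * (\<bar>c\<bar> * S x)"
      using al l by (simp add: S_def abs_mult)
    have cs: "\<bar>c\<bar> * S x \<ge> 0" using S_nonneg by simp
    have "\<bar>(d - c * l * norm x powr al) * poly P t - t * poly (pderiv P) t\<bar>
        \<le> \<bar>d - c * l * norm x powr al\<bar> * \<bar>poly P t\<bar> + \<bar>t\<bar> * \<bar>poly (pderiv P) t\<bar>"
      using abs_triangle_ineq4[of "(d - c * l * norm x powr al) * poly P t" "t * poly (pderiv P) t"] by (simp add: abs_mult)
    also have "\<dots> \<le> (\<bar>d\<bar> + al * (\<bar>c\<bar> * S x)) * K0 + 1 * K1"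
      using abs_triangle_ineq4[of d "c * l * norm x powr al"] unfolding cl
      by (intro add_mono mult_mono K0(2) K1(2) t) auto
    finally have A: "\<bar>(d - c * l * norm x powr al) * poly P t - t * poly (pderiv P) t\<bar> \<le> (\<bar>d\<bar> + al * (\<bar>c\<bar> * S x)) * K0 + K1" by simp
    have pw: "norm x powr (d - 2) * norm x = norm x powr (d - 1)"
      using x powr_add[of "norm x" "d - 2" 1] by simp
    have "norm (dmon c d P y x) \<le> norm x powr (d - 2) * exp (- c * S x) * \<bar>(d - c * l * norm x powr al) * poly P t - t * poly (pderiv P) t\<bar> * norm x
        + norm x powr (d - 1) * exp (- c * S x) * \<bar>poly (pderiv P) t\<bar> * norm y"
      unfolding dmon_def t_def by (rule order.trans[OF norm_triangle_ineq]) (simp add: abs_mult)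
    also have "\<dots> = norm x powr (d - 1) * exp (- c * S x) * (\<bar>(d - c * l * norm x powr al) * poly P t - t * poly (pderiv P) t\<bar> + \<bar>poly (pderiv P) t\<bar>)"
      unfolding pw[symmetric] y by (simp add: algebra_simps)
    also have "\<dots> \<le> norm x powr (d - 1) * exp (- c * S x) * (((\<bar>d\<bar> + al * (\<bar>c\<bar> * S x)) * K0 + K1) + K1)"
      by (intro mult_left_mono add_mono A K1(2) t) auto
    also have "\<dots> \<le> norm x powr (d - 1) * exp (- c * S x) * (K * (1 + \<bar>c\<bar> * S x))"
    proof (intro mult_left_mono)
      have "K * (1 + \<bar>c\<bar> * S x) - ((\<bar>d\<bar> + al * (\<bar>c\<bar> * S x)) * K0 + K1 + K1)
         = K0 + al * K0 + (1 + \<bar>d\<bar>) * K0 * (\<bar>c\<bar> * S x) + 2 * K1 * (\<bar>c\<bar> * S x)"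
        by (simp add: K_def algebra_simps)
      also have "\<dots> \<ge> 0" using K0 K1 al S_nonneg by (intro add_nonneg_nonneg mult_nonneg_nonneg) auto
      finally show "(\<bar>d\<bar> + al * (\<bar>c\<bar> * S x)) * K0 + K1 + K1 \<le> K * (1 + \<bar>c\<bar> * S x)" by simp
    qed auto
    finally show "norm (dmon c d P y x) \<le> K * (norm x powr (d - 1) * exp (- c * S x) * (1 + \<bar>c\<bar> * S x))"
      by (simp add: mult_ac)
  qed
qed

section \<open>The class of admissible functions and its integrability\<close>

lemma clsD:
  assumes "cls f D"
  shows "x \<noteq> 0 \<Longrightarrow> (f has_derivative (\<lambda>h. D x \<bullet> h)) (at x)" "continuous_on (- {0}) D"
    "f \<in> borel_measurable borel" "D \<in> borel_measurable borel"
proof -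
  show d: "(f has_derivative (\<lambda>h. D x \<bullet> h)) (at x)" if "x \<noteq> 0" for x
    using assms that unfolding cls_def by blast
  show c: "continuous_on (- {0}) D" using assms unfolding cls_def by blast
  show "f \<in> borel_measurable borel"
    using d by (intro borel_measurable_punctured has_derivative_continuous_on_punctured)
  show "D \<in> borel_measurable borel" using c by (rule borel_measurable_punctured)
qed

lemma cls_boundE:
  assumes "cls f D"
  obtains K where "K > 0" "\<And>x. x \<noteq> 0 \<Longrightarrow> \<bar>f x\<bar> \<le> K * exp (S x / 4)"
    "\<And>x. x \<noteq> 0 \<Longrightarrow> norm (D x) \<le> K * (norm x powr (sg - 1) * exp (S x / 4))"
proof -
  from assms obtain K where K: "\<And>x. x \<noteq> 0 \<Longrightarrow> \<bar>f x\<bar> \<le> K * exp (S x / 4)"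
    "\<And>x. x \<noteq> 0 \<Longrightarrow> norm (D x) \<le> K * (norm x powr (sg - 1) * exp (S x / 4))" unfolding cls_def by blast
  have le: "K * z \<le> (\<bar>K\<bar> + 1) * z" if "z \<ge> 0" for z using that by (intro mult_right_mono) auto
  show ?thesis
    by (rule that[of "\<bar>K\<bar> + 1"]) (auto intro!: order.trans[OF K(1)] order.trans[OF K(2)] le)
qed

lemma cls_add:
  assumes "cls f D" "cls g G"
  shows "cls (\<lambda>x. f x + g x) (\<lambda>x. D x + G x)"
proof -
  obtain K where K: "K > 0" "\<And>x. x \<noteq> 0 \<Longrightarrow> \<bar>f x\<bar> \<le> K * exp (S x / 4)"
    "\<And>x. x \<noteq> 0 \<Longrightarrow> norm (D x) \<le> K * (norm x powr (sg - 1) * exp (S x / 4))" using cls_boundE[OF assms(1)] by blast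
  obtain L where L: "L > 0" "\<And>x. x \<noteq> 0 \<Longrightarrow> \<bar>g x\<bar> \<le> L * exp (S x / 4)"
    "\<And>x. x \<noteq> 0 \<Longrightarrow> norm (G x) \<le> L * (norm x powr (sg - 1) * exp (S x / 4))" using cls_boundE[OF assms(2)] by blast
  have "\<bar>f x + g x\<bar> \<le> (K + L) * exp (S x / 4) \<and> norm (D x + G x) \<le> (K + L) * (norm x powr (sg - 1) * exp (S x / 4))"
    if "x \<noteq> 0" for x
    using K(2,3)[OF that] L(2,3)[OF that] norm_triangle_ineq[of "D x" "G x"] unfolding distrib_right by linarith
  thus ?thesis unfolding cls_def using clsD[OF assms(1)] clsD[OF assms(2)]
    by (auto simp: fun_eq_iff inner_add_left intro!: continuous_intros has_derivative_eq_rhs[OF has_derivative_add])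
qed

lemma cls_cmult:
  assumes "cls f D"
  shows "cls (\<lambda>x. c * f x) (\<lambda>x. c *\<^sub>R D x)"
proof -
  obtain K where K: "K > 0" "\<And>x. x \<noteq> 0 \<Longrightarrow> \<bar>f x\<bar> \<le> K * exp (S x / 4)"
    "\<And>x. x \<noteq> 0 \<Longrightarrow> norm (D x) \<le> K * (norm x powr (sg - 1) * exp (S x / 4))" using cls_boundE[OF assms(1)] by blast
  have "\<bar>c * f x\<bar> \<le> (\<bar>c\<bar> * K) * exp (S x / 4) \<and> norm (c *\<^sub>R D x) \<le> (\<bar>c\<bar> * K) * (norm x powr (sg - 1) * exp (S x / 4))"
    if "x \<noteq> 0" for x
    using mult_left_mono[OF K(2)[OF that], of "\<bar>c\<bar>"] mult_left_mono[OF K(3)[OF that], of "\<bar>c\<bar>"] by (simp add: abs_mult mult.assoc)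
  thus ?thesis unfolding cls_def using clsD[OF assms(1)]
    by (auto simp: fun_eq_iff intro!: continuous_intros has_derivative_eq_rhs[OF has_derivative_mult_right])
qed

lemma cls_zero: "cls (\<lambda>x. 0) (\<lambda>x. 0)"
  unfolding cls_def by (auto intro!: exI[of _ 0] has_derivative_eq_rhs[OF has_derivative_const])

lemma cls_sum:
  assumes "\<And>i. i \<in> I \<Longrightarrow> cls (f i) (D i)"
  shows "cls (\<lambda>x. \<Sum>i\<in>I. f i x) (\<lambda>x. \<Sum>i\<in>I. D i x)"
  using assms by (induction I rule: infinite_finite_induct) (auto intro: cls_zero cls_add)

text \<open>The surplus \<open>norm x powr (d - sg)\<close> of the gradient over the allowed
  singularity is absorbed by \<open>exp (S x / 4)\<close>, and so is the power \<open>d\<close> of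
  the function itself.\<close>

lemma cls_mon:
  assumes y: "norm y = 1" and d: "d \<ge> sg"
  shows "cls (mon 0 d P y) (dmon 0 d P y)"
proof -
  obtain K where K: "K > 0" "\<And>x. \<bar>mon 0 d P y x\<bar> \<le> K * (norm x powr d * exp (- 0 * S x))"
    "\<And>x. x \<noteq> 0 \<Longrightarrow> norm (dmon 0 d P y x) \<le> K * (norm x powr (d - 1) * exp (- 0 * S x) * (1 + \<bar>0\<bar> * S x))"
    using mon_bounds[OF y, of 0 d P] by blast
  obtain L where L: "L > 0" "\<And>x. norm x powr d \<le> L * exp (1 / 4 * S x)"
    using powr_le_exp_S[of "1/4" d] d sg by auto
  obtain L' where L': "L' > 0" "\<And>x. norm x powr (d - sg) \<le> L' * exp (1 / 4 * S x)"
    using powr_le_exp_S[of "1/4" "d - sg"] d sg by auto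
  have "\<bar>mon 0 d P y x\<bar> \<le> (K * (L + L')) * exp (S x / 4)
      \<and> norm (dmon 0 d P y x) \<le> (K * (L + L')) * (norm x powr (sg - 1) * exp (S x / 4))" if x: "x \<noteq> 0" for x
  proof
    have "\<bar>mon 0 d P y x\<bar> \<le> K * norm x powr d" using K(2)[of x] by simp
    also have "\<dots> \<le> K * (L * exp (S x / 4))" using L(2)[of x] K(1) by simp
    also have "\<dots> \<le> K * ((L + L') * exp (S x / 4))"
      using L(1) L'(1) K(1) by (intro mult_left_mono mult_right_mono) auto
    finally show "\<bar>mon 0 d P y x\<bar> \<le> (K * (L + L')) * exp (S x / 4)" by (simp add: mult.assoc)
    have "norm (dmon 0 d P y x) \<le> K * norm x powr (d - 1)" using K(3)[OF x] by simp
    also have "norm x powr (d - 1) = norm x powr (sg - 1) * norm x powr (d - sg)"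
      using x by (simp add: powr_add[symmetric])
    also have "K * (norm x powr (sg - 1) * norm x powr (d - sg)) \<le> K * (norm x powr (sg - 1) * ((L + L') * exp (S x / 4)))"
    proof (intro mult_left_mono)
      show "norm x powr (d - sg) \<le> (L + L') * exp (S x / 4)"
        using L'(2)[of x] L(1) by (simp add: distrib_right add_increasing)
    qed (use K in auto)
    finally show "norm (dmon 0 d P y x) \<le> (K * (L + L')) * (norm x powr (sg - 1) * exp (S x / 4))" by (simp add: mult_ac)
  qed
  thus ?thesis unfolding cls_def using mon_has_derivative dmon_continuous by blast
qed

lemma integrable_wmu:
  assumes "cls f D" "cls g G"
  shows "integrable lborel (\<lambda>x. f x * g x * wmu x)"
proof -
  obtain K where K: "K > 0" "\<And>x. x \<noteq> 0 \<Longrightarrow> \<bar>f x\<bar> \<le> K * exp (S x / 4)"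
    "\<And>x. x \<noteq> 0 \<Longrightarrow> norm (D x) \<le> K * (norm x powr (sg - 1) * exp (S x / 4))"
    using cls_boundE[OF assms(1)] by blast
  obtain L where L: "L > 0" "\<And>x. x \<noteq> 0 \<Longrightarrow> \<bar>g x\<bar> \<le> L * exp (S x / 4)"
    "\<And>x. x \<noteq> 0 \<Longrightarrow> norm (G x) \<le> L * (norm x powr (sg - 1) * exp (S x / 4))"
    using cls_boundE[OF assms(2)] by blast
  show ?thesis
  proof (rule integrable_of_bound[where c="3/2" and \<beta>="al - 2 - 2*b" and K="K * L"])
    show "(\<lambda>x. f x * g x * wmu x) \<in> borel_measurable borel"
      using clsD(3)[OF assms(1)] clsD(3)[OF assms(2)] by measurable
    show "- real DIM('a) < al - 2 - 2 * b" using al nu_nonneg by linarith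
    fix x :: 'a assume x: "x \<noteq> 0"
    have "\<bar>f x * g x * wmu x\<bar> = \<bar>f x\<bar> * \<bar>g x\<bar> * wmu x" by (simp add: abs_mult wmu_nonneg)
    also have "\<dots> \<le> (K * exp (S x / 4)) * (L * exp (S x / 4)) * wmu x"
      using K(1) by (intro mult_right_mono mult_mono K(2) L(2) x wmu_nonneg) auto
    also have "\<dots> = K * L * (norm x powr (al - 2 - 2 * b) * exp (S x / 4 + S x / 4 + - 2 * S x))"
      unfolding exp_add wmu_def by (simp add: mult_ac)
    also have "S x / 4 + S x / 4 + - 2 * S x = - (3/2) * S x" by simp
    finally show "\<bar>f x * g x * wmu x\<bar> \<le> K * L * (norm x powr (al - 2 - 2 * b) * exp (- (3/2) * S x))" .
  qed simp
qed

lemma integrable_wm: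
  assumes "cls f D" "cls g G"
  shows "integrable lborel (\<lambda>x. (D x \<bullet> G x) * wm x)"
proof -
  obtain K where K: "K > 0" "\<And>x. x \<noteq> 0 \<Longrightarrow> \<bar>f x\<bar> \<le> K * exp (S x / 4)"
    "\<And>x. x \<noteq> 0 \<Longrightarrow> norm (D x) \<le> K * (norm x powr (sg - 1) * exp (S x / 4))"
    using cls_boundE[OF assms(1)] by blast
  obtain L where L: "L > 0" "\<And>x. x \<noteq> 0 \<Longrightarrow> \<bar>g x\<bar> \<le> L * exp (S x / 4)"
    "\<And>x. x \<noteq> 0 \<Longrightarrow> norm (G x) \<le> L * (norm x powr (sg - 1) * exp (S x / 4))"
    using cls_boundE[OF assms(2)] by blast
  show ?thesis
  proof (rule integrable_of_bound[where c="3/2" and \<beta>="2 * sg - 2 - 2*b" and K="K * L"])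
    show "(\<lambda>x. (D x \<bullet> G x) * wm x) \<in> borel_measurable borel"
      using clsD(4)[OF assms(1)] clsD(4)[OF assms(2)] by measurable
    show "- real DIM('a) < 2 * sg - 2 - 2 * b" using sg nu_nonneg by linarith
    fix x :: 'a assume x: "x \<noteq> 0"
    have "\<bar>(D x \<bullet> G x) * wm x\<bar> = \<bar>D x \<bullet> G x\<bar> * wm x" by (simp add: abs_mult wm_nonneg)
    also have "\<dots> \<le> norm (D x) * norm (G x) * wm x" by (intro mult_right_mono Cauchy_Schwarz_ineq2 wm_nonneg)
    also have "\<dots> \<le> (K * (norm x powr (sg - 1) * exp (S x / 4))) * (L * (norm x powr (sg - 1) * exp (S x / 4))) * wm x"
      using K(1) by (intro mult_right_mono mult_mono K(3) L(3) x wm_nonneg) auto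
    also have "\<dots> = K * L * (norm x powr ((sg - 1) + (sg - 1) + - 2 * b) * exp (S x / 4 + S x / 4 + - 2 * S x))"
      unfolding exp_add powr_add wm_def by (simp add: mult_ac)
    also have "S x / 4 + S x / 4 + - 2 * S x = - (3/2) * S x" by simp
    also have "(sg - 1) + (sg - 1) + - 2 * b = 2 * sg - 2 - 2 * b" by simp
    finally show "\<bar>(D x \<bullet> G x) * wm x\<bar> \<le> K * L * (norm x powr (2 * sg - 2 - 2 * b) * exp (- (3/2) * S x))" .
  qed simp
qed

end

subsection \<open>The weak eigenvalue equation\<close>

text \<open>An operator acting by \<open>e i \<mapsto> lam i * e i - c i * e (i - 1)\<close> is
  triangular, so it has an eigenvector for \<open>lam n\<close> with leading coefficient 1.
  Quantifying over the values \<open>B\<close> allows the use both for polynomials, evaluated at a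
  point, and for integrals against a fixed test function. The condition \<open>c 0 = 0\<close>
  removes the term with the truncated index at \<open>i = 0\<close>.\<close>

lemma triangular_eigenvector:
  fixes lam c :: "nat \<Rightarrow> real"
  assumes "\<And>i. i < n \<Longrightarrow> lam i \<noteq> lam n" "c 0 = 0"
  obtains a where "a n = 1"
    "\<And>B. (\<Sum>i\<le>n. a i * (lam i * B i - c i * B (i - 1))) = lam n * (\<Sum>i\<le>n. a i * B i)"
proof -
  \<comment> \<open>Solution by descent from \<open>a n = 1\<close> of the recursion obtained by
    comparing the coefficients of \<open>B i\<close>.\<close>
  define a where "a i = (\<Prod>j\<in>{i..<n}. c (Suc j) / (lam j - lam n))" for i
  have a_step: "a (Suc i) * c (Suc i) = a i * (lam i - lam n)" if "i < n" for i
  proof -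
    have "a i = c (Suc i) / (lam i - lam n) * a (Suc i)"
      unfolding a_def using that by (simp add: prod.atLeast_Suc_lessThan)
    thus ?thesis using assms(1)[OF that] by simp
  qed
  show ?thesis
  proof (rule that[of a])
    show "a n = 1" by (simp add: a_def)
    fix B
    have "(\<Sum>i\<le>n. a i * c i * B (i - 1)) = (\<Sum>i<n. a (Suc i) * c (Suc i) * B i)"
      by (cases n) (simp_all add: sum.atMost_Suc_shift lessThan_Suc_atMost assms(2) del: sum.atMost_Suc)
    also have "\<dots> = (\<Sum>i<n. a i * (lam i - lam n) * B i)" by (intro sum.cong) (auto simp: a_step)
    also have "\<dots> = (\<Sum>i\<le>n. a i * (lam i - lam n) * B i)" by (simp add: lessThan_Suc_atMost[symmetric])
    finally have "(\<Sum>i\<le>n. a i * (lam i * B i - c i * B (i - 1)))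
        = (\<Sum>i\<le>n. a i * lam i * B i) - (\<Sum>i\<le>n. a i * (lam i - lam n) * B i)"
      by (simp add: sum_subtractf algebra_simps)
    also have "\<dots> = lam n * (\<Sum>i\<le>n. a i * B i)"
      by (simp add: sum_subtractf[symmetric] sum_distrib_left algebra_simps)
    finally show "(\<Sum>i\<le>n. a i * (lam i * B i - c i * B (i - 1))) = lam n * (\<Sum>i\<le>n. a i * B i)" .
  qed
qed

text \<open>The Laplace-Beltrami operator of the unit sphere of \<open>\<real>\<^sup>N\<close> on zonal functions, i.e. on polynomials in
  the cosine of the angle to a fixed axis.\<close>

definition gegenbauer_op :: "real \<Rightarrow> real poly \<Rightarrow> real poly" where
  "gegenbauer_op N P = [:1, 0, -1:] * pderiv (pderiv P) - smult (N - 1) ([:0, 1:] * pderiv P)"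

lemma poly_gegenbauer_op:
  "poly (gegenbauer_op N P) t = (1 - t\<^sup>2) * poly (pderiv (pderiv P)) t - (N - 1) * (t * poly (pderiv P) t)"
  by (simp add: gegenbauer_op_def power2_eq_square algebra_simps)

text \<open>The operator is triangular on monomials of equal parity. For \<open>m < 2\<close> the
  truncated exponent \<open>m - 2\<close> is multiplied by 0.\<close>

lemma gegenbauer_op_monom:
  "poly (gegenbauer_op N (monom 1 m)) t = - (real m * (real m + N - 2)) * t ^ m + real m * (real m - 1) * t ^ (m - 2)"
proof -
  consider "m = 0" | "m = 1" | k where "m = k + 2" by (metis One_nat_def add_2_eq_Suc' not0_implies_Suc)
  thus ?thesis
  proof cases
    case 3
    thus ?thesis by (simp add: poly_gegenbauer_op pderiv_monom poly_monom power2_eq_square algebra_simps)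
  qed (simp_all add: poly_gegenbauer_op pderiv_monom poly_monom algebra_simps)
qed

lemma gegenbauer_op_sum:
  "poly (gegenbauer_op N (\<Sum>i\<in>I. smult (a i) (p i))) t = (\<Sum>i\<in>I. a i * poly (gegenbauer_op N (p i)) t)"
proof -
  have z: "poly (gegenbauer_op N 0) t = 0" by (simp add: gegenbauer_op_def)
  have add: "poly (gegenbauer_op N (p + q)) t = poly (gegenbauer_op N p) t + poly (gegenbauer_op N q) t" for p q
    by (simp add: poly_gegenbauer_op pderiv_add algebra_simps)
  have sm: "poly (gegenbauer_op N (smult c p)) t = c * poly (gegenbauer_op N p) t" for p c
    by (simp add: poly_gegenbauer_op pderiv_smult algebra_simps)
  show ?thesis by (induction I rule: infinite_finite_induct) (simp_all add: z add sm)
qed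

text \<open>The triangular scheme runs over the exponents \<open>ix k i\<close> of the parity of
  \<open>k\<close>, so a step in \<open>i\<close> lowers the degree by 2. Restricting to one parity
  keeps the eigenvalues \<open>k * (k + N - 2)\<close> distinct also for \<open>N = 1\<close>, where
  0 and 1 share one. The polynomials are monic, hence span all monomials.\<close>

lemma gegenbauer_polynomials:
  fixes N :: real
  assumes N: "N \<ge> 1"
  obtains P :: "nat \<Rightarrow> real poly" where
    "\<And>k. gegenbauer_op N (P k) = smult (- (real k * (real k + N - 2))) (P k)"
    "P 0 = 1" "P 1 = [:0, 1:]" "\<And>n. \<exists>c. \<forall>t. t ^ n = (\<Sum>j\<le>n. c j * poly (P j) t)"
proof -
  define ix where "ix k i = k mod 2 + 2 * i" for k i :: nat
  define kap where "kap m = real m * (real m + N - 2)" for m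
  have ex: "\<exists>a. a (k div 2) = 1 \<and> (\<forall>B. (\<Sum>i\<le>k div 2. a i * (- kap (ix k i) * B i - (- real (ix k i) * (real (ix k i) - 1)) * B (i - 1)))
      = - kap (ix k (k div 2)) * (\<Sum>i\<le>k div 2. a i * B i))" for k
  proof -
    have ne: "- kap (ix k i) \<noteq> - kap (ix k (k div 2))" if i: "i < k div 2" for i
    proof -
      define m m' where "m = real (ix k i)" and "m' = real (ix k (k div 2))"
      have "ix k (k div 2) \<ge> ix k i + 2" using i unfolding ix_def by presburger
      hence m: "m \<ge> 0" "m' \<ge> m + 2" unfolding m_def m'_def by linarith+
      have "kap (ix k (k div 2)) - kap (ix k i) = (m' - m) * (m' + m + N - 2)"
        by (simp add: kap_def m_def m'_def algebra_simps)
      moreover have "\<dots> > 0" using m N by (intro mult_pos_pos) auto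
      ultimately show ?thesis by simp
    qed
    have c0: "- real (ix k 0) * (real (ix k 0) - 1) = 0"
      by (cases "even k") (auto simp: ix_def odd_iff_mod_2_eq_one)
    show ?thesis
    proof (rule triangular_eigenvector[of "k div 2" "\<lambda>i. - kap (ix k i)" "\<lambda>i. - real (ix k i) * (real (ix k i) - 1)", OF ne c0])
      fix a :: "nat \<Rightarrow> real"
      assume "a (k div 2) = 1" "\<And>B. (\<Sum>i\<le>k div 2. a i * (- kap (ix k i) * B i - (- real (ix k i) * (real (ix k i) - 1)) * B (i - 1)))
        = - kap (ix k (k div 2)) * (\<Sum>i\<le>k div 2. a i * B i)"
      thus ?thesis by (intro exI[of _ a]) blast
    qed
  qed
  obtain a where a: "\<forall>k. a k (k div 2) = 1 \<and> (\<forall>B. (\<Sum>i\<le>k div 2. a k i * (- kap (ix k i) * B i - (- real (ix k i) * (real (ix k i) - 1)) * B (i - 1)))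
      = - kap (ix k (k div 2)) * (\<Sum>i\<le>k div 2. a k i * B i))"
    by (rule exE[OF choice[OF allI[OF ex]]])
  hence a1: "a k (k div 2) = 1"
    and a2: "(\<Sum>i\<le>k div 2. a k i * (- kap (ix k i) * B i - (- real (ix k i) * (real (ix k i) - 1)) * B (i - 1)))
      = - kap (ix k (k div 2)) * (\<Sum>i\<le>k div 2. a k i * B i)" for k B by blast+
  have ixk: "ix k (k div 2) = k" for k by (simp add: ix_def)
  define P where "P k = (\<Sum>i\<le>k div 2. smult (a k i) (monom 1 (ix k i)))" for k
  have Pt: "poly (P k) t = (\<Sum>i\<le>k div 2. a k i * t ^ ix k i)" for k t
    by (simp add: P_def poly_sum poly_monom)
  show ?thesis
  proof (rule that[of P])
    fix k
    have "poly (gegenbauer_op N (P k)) t = poly (smult (- (real k * (real k + N - 2))) (P k)) t" for t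
    proof -
      have "poly (gegenbauer_op N (P k)) t = (\<Sum>i\<le>k div 2. a k i * (- kap (ix k i) * t ^ ix k i
          - (- real (ix k i) * (real (ix k i) - 1)) * t ^ ix k (i - 1)))"
        unfolding P_def gegenbauer_op_sum
      proof (intro sum.cong refl, goal_cases)
        case (1 i)
        have "real (ix k i) * (real (ix k i) - 1) * t ^ (ix k i - 2) = real (ix k i) * (real (ix k i) - 1) * t ^ ix k (i - 1)"
          by (cases i; cases "even k") (auto simp: ix_def odd_iff_mod_2_eq_one)
        thus ?case unfolding gegenbauer_op_monom by (simp add: kap_def)
      qed
      also have "\<dots> = - kap k * poly (P k) t"
        using a2[of k "\<lambda>i. t ^ ix k i"] unfolding ixk Pt .
      finally show ?thesis by (simp add: kap_def)
    qed
    thus "gegenbauer_op N (P k) = smult (- (real k * (real k + N - 2))) (P k)"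
      by (subst poly_eq_poly_eq_iff[symmetric]) (rule ext)
  next
    show "P 0 = 1" using a1[of 0] by (simp add: P_def ix_def one_poly_eq_simps monom_0)
    show "P 1 = [:0, 1:]" using a1[of 1] by (simp add: P_def ix_def monom_Suc monom_0)
  next
    fix n show "\<exists>c. \<forall>t. t ^ n = (\<Sum>j\<le>n. c j * poly (P j) t)"
    proof (induction n rule: less_induct)
      case (less n)
      then obtain c where c: "\<And>m t. m < n \<Longrightarrow> t ^ m = (\<Sum>j\<le>m. c m j * poly (P j) t)" by metis
      \<comment> \<open>Coefficients of \<open>P n\<close> minus its lower monomials, the latter
        expanded by the induction hypothesis.\<close>
      define c' where "c' j = (if j = n then 1 else 0) - (\<Sum>i<n div 2. if j \<le> ix n i then a n i * c (ix n i) j else 0)" for j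
      have "t ^ n = (\<Sum>j\<le>n. c' j * poly (P j) t)" for t
      proof -
        have lt: "ix n i < n" if "i < n div 2" for i using that unfolding ix_def by presburger
        have "poly (P n) t = t ^ n + (\<Sum>i<n div 2. a n i * t ^ ix n i)"
          unfolding Pt lessThan_Suc_atMost[symmetric] by (simp add: a1 ixk)
        also have "(\<Sum>i<n div 2. a n i * t ^ ix n i) = (\<Sum>i<n div 2. \<Sum>j\<le>n. (if j \<le> ix n i then a n i * c (ix n i) j else 0) * poly (P j) t)"
        proof (intro sum.cong refl, goal_cases)
          case (1 i)
          hence i: "ix n i < n" using lt by simp
          have "(\<Sum>j\<le>n. (if j \<le> ix n i then a n i * c (ix n i) j else 0) * poly (P j) t)
            = (\<Sum>j\<le>ix n i. a n i * c (ix n i) j * poly (P j) t)"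
            by (rule sum.mono_neutral_cong_right) (use i in auto)
          also have "\<dots> = a n i * t ^ ix n i" unfolding c[OF i] by (simp add: sum_distrib_left mult.assoc)
          finally show ?case by simp
        qed
        also have "\<dots> = (\<Sum>j\<le>n. (\<Sum>i<n div 2. if j \<le> ix n i then a n i * c (ix n i) j else 0) * poly (P j) t)"
          by (subst sum.swap) (simp add: sum_distrib_right)
        finally have "t ^ n = poly (P n) t - (\<Sum>j\<le>n. (\<Sum>i<n div 2. if j \<le> ix n i then a n i * c (ix n i) j else 0) * poly (P j) t)" by simp
        also have "poly (P n) t = (\<Sum>j\<le>n. (if j = n then 1 else 0) * poly (P j) t)"
          by (simp add: if_distrib[of "\<lambda>z. z * _"] cong: if_cong)
        finally show ?thesis by (simp add: c'_def sum_subtractf[symmetric] left_diff_distrib)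
      qed
      thus ?case by blast
    qed
  qed
qed

context weighted_space
begin

text \<open>The cosine is homogeneous of degree 0, so the radial derivative does not act on
  \<open>P\<close>. Along the axis, \<open>norm y = 1\<close> produces the factor
  \<open>1 - t\<^sup>2\<close> of the Gegenbauer operator.\<close>

lemma dmon_inner_radial:
  "x \<noteq> 0 \<Longrightarrow> dmon c d P y x \<bullet> x = (d - c * l * norm x powr al) * mon c d P y x"
  and dmon_inner_axis:
  "x \<noteq> 0 \<Longrightarrow> norm y = 1 \<Longrightarrow> dmon c d P y x \<bullet> y = norm x powr (d - 1) * exp (- c * S x) *
     ((d - c * l * norm x powr al) * (x \<bullet> y / norm x) * poly P (x \<bullet> y / norm x)
       + (1 - (x \<bullet> y / norm x)\<^sup>2) * poly (pderiv P) (x \<bullet> y / norm x))"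
proof -
  assume x: "x \<noteq> 0"
  define r t where "r = norm x" and "t = x \<bullet> y / norm x"
  have r: "r > 0" using x by (simp add: r_def)
  have pw: "r powr (d - 1) = r powr (d - 2) * r" "r powr d = r powr (d - 2) * r * r"
    using r by (simp_all add: powr_diff power2_eq_square)
  have xx: "x \<bullet> x = r * r" "x \<bullet> y = r * t" "y \<bullet> x = r * t"
    using r by (simp_all add: r_def t_def dot_square_norm power2_eq_square inner_commute)
  show "dmon c d P y x \<bullet> x = (d - c * l * norm x powr al) * mon c d P y x"
    unfolding dmon_def mon_def t_def[symmetric] unfolding r_def[symmetric] pw inner_add_left inner_scaleR_left xx
    by (simp add: algebra_simps)
  assume y: "norm y = 1"
  have yy: "y \<bullet> y = 1" using y by (simp add: dot_square_norm)
  show "dmon c d P y x \<bullet> y = norm x powr (d - 1) * exp (- c * S x) *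
     ((d - c * l * norm x powr al) * (x \<bullet> y / norm x) * poly P (x \<bullet> y / norm x)
       + (1 - (x \<bullet> y / norm x)\<^sup>2) * poly (pderiv P) (x \<bullet> y / norm x))"
    unfolding dmon_def t_def[symmetric] unfolding r_def[symmetric] pw inner_add_left inner_scaleR_left xx yy
    by (simp add: algebra_simps power2_eq_square)
qed

lemma mon_cls_integrable:
  assumes f: "cls f D" and y: "norm y = 1"
  shows "k + e > - real DIM('a) \<Longrightarrow> integrable lborel (\<lambda>x. norm x powr k * (f x * mon 2 e R y x))"
    and "k + e - 1 > - real DIM('a) \<Longrightarrow> integrable lborel
       (\<lambda>x. norm x powr k * norm (mon 2 e R y x *\<^sub>R D x + f x *\<^sub>R dmon 2 e R y x))"
proof -
  obtain K where K: "K > 0" "\<And>x. \<bar>mon 2 e R y x\<bar> \<le> K * (norm x powr e * exp (- 2 * S x))"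
    "\<And>x. x \<noteq> 0 \<Longrightarrow> norm (dmon 2 e R y x) \<le> K * (norm x powr (e - 1) * exp (- 2 * S x) * (1 + \<bar>2\<bar> * S x))"
    using mon_bounds[OF y, of 2 e R] by blast
  obtain L where L: "L > 0" "\<And>x. x \<noteq> 0 \<Longrightarrow> \<bar>f x\<bar> \<le> L * exp (S x / 4)"
    "\<And>x. x \<noteq> 0 \<Longrightarrow> norm (D x) \<le> L * (norm x powr (sg - 1) * exp (S x / 4))"
    using cls_boundE[OF f] by blast
  note [measurable] = clsD(3,4)[OF f]
  have [measurable]: "dmon 2 e R y \<in> borel_measurable borel"
    by (rule borel_measurable_punctured[OF dmon_continuous])
  show "integrable lborel (\<lambda>x. norm x powr k * (f x * mon 2 e R y x))" if ke: "k + e > - real DIM('a)"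
  proof (rule integrable_of_bound[where c="7/4" and \<beta>="k + e" and K="K * L", OF _ _ ke])
    fix x :: 'a assume x: "x \<noteq> 0"
    have "\<bar>norm x powr k * (f x * mon 2 e R y x)\<bar> = norm x powr k * (\<bar>f x\<bar> * \<bar>mon 2 e R y x\<bar>)" by (simp add: abs_mult)
    also have "\<dots> \<le> norm x powr k * ((L * exp (S x / 4)) * (K * (norm x powr e * exp (- 2 * S x))))"
      using L(1) by (intro mult_left_mono mult_mono K(2) L(2) x) auto
    also have "\<dots> = K * L * (norm x powr (k + e) * exp (S x / 4 + - 2 * S x))"
      unfolding exp_add powr_add by (simp add: mult_ac)
    also have "S x / 4 + - 2 * S x = - (7/4) * S x" by simp
    finally show "\<bar>norm x powr k * (f x * mon 2 e R y x)\<bar> \<le> K * L * (norm x powr (k + e) * exp (- (7/4) * S x))" .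
  qed auto
  assume ke: "k + e - 1 > - real DIM('a)"
  have 1: "integrable lborel (\<lambda>x. norm x powr k * (\<bar>mon 2 e R y x\<bar> * norm (D x)))"
  proof (rule integrable_of_bound[where c="7/4" and \<beta>="k + e + (sg - 1)" and K="K * L"])
    show "- real DIM('a) < k + e + (sg - 1)" using ke sg by linarith
    fix x :: 'a assume x: "x \<noteq> 0"
    have "\<bar>norm x powr k * (\<bar>mon 2 e R y x\<bar> * norm (D x))\<bar> = norm x powr k * (\<bar>mon 2 e R y x\<bar> * norm (D x))" by (simp add: abs_mult)
    also have "\<dots> \<le> norm x powr k * ((K * (norm x powr e * exp (- 2 * S x))) * (L * (norm x powr (sg - 1) * exp (S x / 4))))"
      using K(1) by (intro mult_left_mono mult_mono K(2) L(3) x) auto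
    also have "\<dots> = K * L * (norm x powr (k + e + (sg - 1)) * exp (S x / 4 + - 2 * S x))"
      unfolding exp_add powr_add by (simp add: mult_ac)
    also have "S x / 4 + - 2 * S x = - (7/4) * S x" by simp
    finally show "\<bar>norm x powr k * (\<bar>mon 2 e R y x\<bar> * norm (D x))\<bar> \<le> K * L * (norm x powr (k + e + (sg - 1)) * exp (- (7/4) * S x))" .
  qed auto
  have 2: "integrable lborel (\<lambda>x. norm x powr k * (\<bar>f x\<bar> * norm (dmon 2 e R y x)))"
  proof (rule integrable_of_bound[where c="3/4" and \<beta>="k + e - 1" and K="2 * K * L", OF _ _ ke])
    fix x :: 'a assume x: "x \<noteq> 0"
    \<comment> \<open>The linear factor from the gradient of \<open>exp (- 2 * S)\<close> is traded
      for one \<open>exp (S x)\<close>; the remaining rate is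
      \<open>2 - 1/4 - 1 = 3/4\<close>.\<close>
    have eS: "1 + \<bar>2\<bar> * S x \<le> 2 * exp (S x)"
      using exp_ge_add_one_self[of "S x"] S_nonneg[of x] unfolding abs_numeral by linarith
    have "\<bar>norm x powr k * (\<bar>f x\<bar> * norm (dmon 2 e R y x))\<bar> = norm x powr k * (\<bar>f x\<bar> * norm (dmon 2 e R y x))" by (simp add: abs_mult)
    also have "\<dots> \<le> norm x powr k * ((L * exp (S x / 4)) * (K * (norm x powr (e - 1) * exp (- 2 * S x) * (1 + \<bar>2\<bar> * S x))))"
      using L(1) by (intro mult_left_mono mult_mono K(3) L(2) x) auto
    also have "\<dots> \<le> norm x powr k * ((L * exp (S x / 4)) * (K * (norm x powr (e - 1) * exp (- 2 * S x) * (2 * exp (S x)))))"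
      using L(1) K(1) by (intro mult_left_mono eS) auto
    also have "\<dots> = 2 * K * L * (norm x powr (k + (e - 1)) * exp (S x / 4 + - 2 * S x + S x))"
      unfolding exp_add powr_add by (simp add: mult_ac)
    also have "S x / 4 + - 2 * S x + S x = - (3/4) * S x" by simp
    also have "k + (e - 1) = k + e - 1" by simp
    finally show "\<bar>norm x powr k * (\<bar>f x\<bar> * norm (dmon 2 e R y x))\<bar> \<le> 2 * K * L * (norm x powr (k + e - 1) * exp (- (3/4) * S x))" .
  qed auto
  show "integrable lborel (\<lambda>x. norm x powr k * norm (mon 2 e R y x *\<^sub>R D x + f x *\<^sub>R dmon 2 e R y x))"
  proof (rule Bochner_Integration.integrable_bound[OF Bochner_Integration.integrable_add[OF 1 2]])
    show "AE x in lborel. norm (norm x powr k * norm (mon 2 e R y x *\<^sub>R D x + f x *\<^sub>R dmon 2 e R y x))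
       \<le> norm (norm x powr k * (\<bar>mon 2 e R y x\<bar> * norm (D x)) + norm x powr k * (\<bar>f x\<bar> * norm (dmon 2 e R y x)))"
    proof (intro AE_I2)
      fix x
      have "norm (mon 2 e R y x *\<^sub>R D x + f x *\<^sub>R dmon 2 e R y x) \<le> \<bar>mon 2 e R y x\<bar> * norm (D x) + \<bar>f x\<bar> * norm (dmon 2 e R y x)"
        by (rule order.trans[OF norm_triangle_ineq]) simp
      from mult_left_mono[OF this, of "norm x powr k"]
      show "norm (norm x powr k * norm (mon 2 e R y x *\<^sub>R D x + f x *\<^sub>R dmon 2 e R y x))
       \<le> norm (norm x powr k * (\<bar>mon 2 e R y x\<bar> * norm (D x)) + norm x powr k * (\<bar>f x\<bar> * norm (dmon 2 e R y x)))"
        by (simp add: distrib_left)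
    qed
  qed measurable
qed

text \<open>The field \<open>f e\<^sup>-\<^sup>2\<^sup>S \<bar>x\<bar>\<^sup>-\<^sup>2\<^sup>b \<nabla>(mon 0 d P y)\<close> is a combination of \<open>x\<close> and \<open>y\<close>; both parts have a
  divergence that integrates to zero.\<close>

lemma mon_weak_equation:
  fixes P :: "real poly"
  assumes f: "cls f D" and y: "norm y = 1" and d: "d \<ge> sg"
  defines "R \<equiv> smult (d * (d + nu)) P + gegenbauer_op (real DIM('a)) P"
  shows "(LINT x|lborel. (D x \<bullet> dmon 0 d P y x) * wm x)
    = 2 * l * d * (LINT x|lborel. f x * mon 0 d P y x * wmu x) - (LINT x|lborel. f x * mon 0 (d - al) R y x * wmu x)"
proof -
  \<comment> \<open>The gradient of \<open>mon 0 d P y\<close> is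
    \<open>norm x powr (d - 2) * poly A t\<close> times \<open>x\<close> plus
    \<open>norm x powr (d - 1) * poly (pderiv P) t\<close> times \<open>y\<close>; \<open>F1\<close>
    and \<open>F2\<close> are the coefficients of \<open>x\<close> and \<open>y\<close> in the
    weighted field multiplied by \<open>f\<close>.\<close>
  define A where "A = smult d P - [:0, 1:] * pderiv P"
  define F1 where "F1 x = f x * mon 2 (d - 2 - 2*b) A y x" for x
  define F2 where "F2 x = f x * mon 2 (d - 1 - 2*b) (pderiv P) y x" for x
  define G1 where "G1 x = mon 2 (d - 2 - 2*b) A y x *\<^sub>R D x + f x *\<^sub>R dmon 2 (d - 2 - 2*b) A y x" for x
  define G2 where "G2 x = mon 2 (d - 1 - 2*b) (pderiv P) y x *\<^sub>R D x + f x *\<^sub>R dmon 2 (d - 1 - 2*b) (pderiv P) y x" for x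
  have ae: "AE x in lborel. x \<noteq> (0::'a)" by (rule AE_lborel_singleton)
  have dN: "d - 2 - 2*b > - real DIM('a)" using d sg nu_nonneg by linarith
  have der: "((\<lambda>x. f x * mon 2 e Q y x) has_derivative (\<lambda>h. (mon 2 e Q y x *\<^sub>R D x + f x *\<^sub>R dmon 2 e Q y x) \<bullet> h)) (at x)"
    if "x \<noteq> 0" for x e Q
    using has_derivative_mult[OF clsD(1)[OF f that] mon_has_derivative[OF that, of 2 e Q y]]
    by (rule has_derivative_eq_rhs) (simp add: fun_eq_iff inner_add_left)
  have cont: "continuous_on (- {0}) (\<lambda>x. mon 2 e Q y x *\<^sub>R D x + f x *\<^sub>R dmon 2 e Q y x)" for e Q
    by (intro continuous_intros clsD(2)[OF f] dmon_continuous has_derivative_continuous_on_punctured[OF mon_has_derivative]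
         has_derivative_continuous_on_punctured[OF clsD(1)[OF f]])
  note [measurable] = clsD(3,4)[OF f]
  have meas: "(\<lambda>x. mon 2 e Q y x *\<^sub>R D x + f x *\<^sub>R dmon 2 e Q y x) \<in> borel_measurable borel" for e Q
    by (rule borel_measurable_punctured[OF cont])
  have [measurable]: "F1 \<in> borel_measurable borel" "F2 \<in> borel_measurable borel"
    unfolding F1_def[abs_def] F2_def[abs_def] by measurable
  have F1i: "integrable lborel F1"
  proof (subst integrable_cong_AE)
    show "AE x in lborel. F1 x = norm x powr 0 * (f x * mon 2 (d - 2 - 2*b) A y x)"
      using ae by eventually_elim (simp add: F1_def)
    show "integrable lborel (\<lambda>x. norm x powr 0 * (f x * mon 2 (d - 2 - 2*b) A y x))"
      by (rule mon_cls_integrable(1)[OF f y]) (use dN in simp)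
  qed (auto simp: F1_def)
  have 1: "(LINT x|lborel. G1 x \<bullet> x) = - real DIM('a) * (LINT x|lborel. F1 x)" "integrable lborel (\<lambda>x. G1 x \<bullet> x)"
    using integral_divergence_radial[of F1 G1] der cont F1i
      mon_cls_integrable(2)[OF f y, where k=1 and e="d - 2 - 2*b" and R=A] dN
    unfolding G1_def F1_def by auto
  have G2i: "integrable lborel (\<lambda>x. G2 x \<bullet> y)"
  proof (rule Bochner_Integration.integrable_bound[OF mon_cls_integrable(2)[OF f y, where k=0 and e="d - 1 - 2*b" and R="pderiv P"]])
    show "AE x in lborel. norm (G2 x \<bullet> y) \<le> norm (norm x powr 0 * norm (mon 2 (d - 1 - 2*b) (pderiv P) y x *\<^sub>R D x + f x *\<^sub>R dmon 2 (d - 1 - 2*b) (pderiv P) y x))"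
      using ae
    proof eventually_elim
      case (elim x) thus ?case using Cauchy_Schwarz_ineq2[of "G2 x" y] y by (simp add: G2_def)
    qed
    show "(\<lambda>x. G2 x \<bullet> y) \<in> borel_measurable lborel" using meas unfolding G2_def by simp
  qed (use dN in simp)
  have 2: "(LINT x|lborel. G2 x \<bullet> y) = 0"
  proof (rule integral_dir_deriv_punctured[of F2])
    show "integrable lborel (\<lambda>x. F2 x / norm x)"
    proof (subst integrable_cong_AE)
      show "AE x in lborel. F2 x / norm x = norm x powr (-1) * (f x * mon 2 (d - 1 - 2*b) (pderiv P) y x)"
        using ae by eventually_elim (simp add: F2_def powr_minus field_simps)
      show "integrable lborel (\<lambda>x. norm x powr (-1) * (f x * mon 2 (d - 1 - 2*b) (pderiv P) y x))"
        by (rule mon_cls_integrable(1)[OF f y]) (use dN in simp)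
    qed (auto simp: F2_def)
  qed (use der cont G2i in \<open>auto simp: F2_def[abs_def] G2_def[abs_def]\<close>)
  have i1: "integrable lborel (\<lambda>x. (D x \<bullet> dmon 0 d P y x) * wm x)"
    by (rule integrable_wm[OF f cls_mon[OF y d]])
  have i2: "integrable lborel (\<lambda>x. f x * mon 0 d P y x * wmu x)"
    by (rule integrable_wmu[OF f cls_mon[OF y d]])
  have i3: "integrable lborel (\<lambda>x. f x * mon 0 (d - al) R y x * wmu x)"
  proof (subst integrable_cong_AE)
    show "AE x in lborel. f x * mon 0 (d - al) R y x * wmu x = norm x powr 0 * (f x * mon 2 (d - 2 - 2*b) R y x)"
      using ae
    proof eventually_elim
      case (elim x)
      have "norm x powr (d - al) * norm x powr (al - 2 - 2*b) = norm x powr (d - 2 - 2*b)"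
        unfolding powr_add[symmetric] by (rule arg_cong[where f="\<lambda>z. norm x powr z"]) simp
      thus ?case using elim by (simp add: mon_def wmu_def mult_ac)
    qed
    show "integrable lborel (\<lambda>x. norm x powr 0 * (f x * mon 2 (d - 2 - 2*b) R y x))"
      by (rule mon_cls_integrable(1)[OF f y]) (use dN in simp)
  qed auto
  \<comment> \<open>The left side is the divergence of
    \<open>F1 x *\<^sub>R x + F2 x *\<^sub>R y\<close>. On the right, the derivative of
    \<open>exp (- 2 * S)\<close> gives the term with \<open>2 * l * d\<close>, and the Laplacian of
    \<open>norm x powr d * poly P t\<close> together with the drift from
    \<open>norm x powr (- 2 * b)\<close> gives \<open>R\<close>: the drift turns
    \<open>d * (d + N - 2)\<close> into \<open>d * (d + nu)\<close>.\<close>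
  have pt: "G1 x \<bullet> x + real DIM('a) * F1 x + G2 x \<bullet> y = (D x \<bullet> dmon 0 d P y x) * wm x
      - 2 * l * d * (f x * mon 0 d P y x * wmu x) + f x * mon 0 (d - al) R y x * wmu x" if x: "x \<noteq> 0" for x
  proof -
    define r t where "r = norm x" and "t = x \<bullet> y / norm x"
    define e where "e = exp (- 2 * S x)"
    define w where "w = r powr (d - 2 - 2*b)"
    have r: "r > 0" using x by (simp add: r_def)
    have p: "r powr u * r powr v = r powr z" if "u + v = z" for u v z
      unfolding powr_add[symmetric] that ..
    have rr: "r = r powr 1" using r by simp
    have p1: "r powr (d - 1 - 2*b) = w * r" "r powr (d - 1 - 2*b - 1) = w"
      "r powr (d - 2) * r powr (- 2 * b) = w" "r powr (d - 1) * r powr (- 2 * b) = w * r"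
      "r powr d * r powr (al - 2 - 2*b) = w * r powr al"
      "r powr (d - al) * r powr (al - 2 - 2*b) = w"
    proof -
      have w1: "w * r = r powr (d - 1 - 2*b)" by (subst rr, unfold w_def, rule p) simp
      thus "r powr (d - 1 - 2*b) = w * r" ..
      show "r powr (d - 1 - 2*b - 1) = w" unfolding w_def by (rule arg_cong[where f="\<lambda>z. r powr z"]) simp
      show "r powr (d - 2) * r powr (- 2 * b) = w" unfolding w_def by (rule p) simp
      show "r powr (d - 1) * r powr (- 2 * b) = w * r" unfolding w1 by (rule p) simp
      have "w * r powr al = r powr (d + (al - 2 - 2*b))" unfolding w_def by (rule p) simp
      thus "r powr d * r powr (al - 2 - 2*b) = w * r powr al" using p[of d "al - 2 - 2*b"] by simp
      show "r powr (d - al) * r powr (al - 2 - 2*b) = w" unfolding w_def by (rule p) simp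
    qed
    have A: "poly A t = d * poly P t - t * poly (pderiv P) t" by (simp add: A_def)
    have R: "poly R t = d * (d + nu) * poly P t + ((1 - t\<^sup>2) * poly (pderiv (pderiv P)) t - (real DIM('a) - 1) * (t * poly (pderiv P) t))"
      by (simp add: R_def poly_gegenbauer_op)
    have m1: "mon 2 (d - 2 - 2*b) A y x = w * e * poly A t"
      by (simp add: mon_def w_def r_def e_def t_def)
    have m2: "mon 2 (d - 1 - 2*b) (pderiv P) y x = w * r * e * poly (pderiv P) t"
      unfolding mon_def r_def[symmetric] p1 by (simp add: e_def t_def r_def)
    have m3: "mon 0 d P y x * wmu x = w * r powr al * e * poly P t"
      unfolding p1(5)[symmetric] by (simp add: mon_def wmu_def e_def t_def r_def)
    have m4: "mon 0 (d - al) R y x * wmu x = w * e * poly R t"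
      unfolding p1(6)[symmetric] by (simp add: mon_def wmu_def e_def t_def r_def)
    have m5: "(D x \<bullet> dmon 0 d P y x) * wm x = w * e * poly A t * (D x \<bullet> x) + w * r * e * poly (pderiv P) t * (D x \<bullet> y)"
    proof -
      have "(D x \<bullet> dmon 0 d P y x) * wm x = (r powr (d - 2) * r powr (- 2 * b)) * e * poly A t * (D x \<bullet> x)
         + (r powr (d - 1) * r powr (- 2 * b)) * e * poly (pderiv P) t * (D x \<bullet> y)"
        unfolding A by (simp add: dmon_def wm_def inner_add_right e_def t_def r_def algebra_simps)
      thus ?thesis unfolding p1 .
    qed
    have m6: "dmon 2 (d - 1 - 2*b) (pderiv P) y x \<bullet> y = w * e * ((d - 1 - 2*b - 2 * l * r powr al) * t * poly (pderiv P) t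
        + (1 - t\<^sup>2) * poly (pderiv (pderiv P)) t)"
      unfolding dmon_inner_axis[OF x y] r_def[symmetric] p1 by (simp add: e_def t_def r_def)
    have m7: "dmon 2 (d - 2 - 2*b) A y x \<bullet> x = (d - 2 - 2*b - 2 * l * r powr al) * (w * e * poly A t)"
      unfolding dmon_inner_radial[OF x] m1 by (simp add: r_def)
    have mm: "f x * mon 0 d P y x * wmu x = f x * (w * r powr al * e * poly P t)"
      "f x * mon 0 (d - al) R y x * wmu x = f x * (w * e * poly R t)"
      unfolding m3[symmetric] m4[symmetric] by (simp_all add: mult.assoc)
    show ?thesis
      unfolding G1_def G2_def F1_def inner_add_left inner_scaleR_left mm m1 m2 m5 m6 m7 R A nu_def
      by (simp add: algebra_simps)
  qed
  have "0 = (LINT x|lborel. G1 x \<bullet> x + real DIM('a) * F1 x + G2 x \<bullet> y)"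
    using 1 2 F1i G2i by simp
  also have "\<dots> = (LINT x|lborel. (D x \<bullet> dmon 0 d P y x) * wm x
      - 2 * l * d * (f x * mon 0 d P y x * wmu x) + f x * mon 0 (d - al) R y x * wmu x)"
  proof (rule integral_cong_AE)
    show "AE x in lborel. G1 x \<bullet> x + real DIM('a) * F1 x + G2 x \<bullet> y = (D x \<bullet> dmon 0 d P y x) * wm x
      - 2 * l * d * (f x * mon 0 d P y x * wmu x) + f x * mon 0 (d - al) R y x * wmu x"
      using ae by eventually_elim (rule pt)
  qed (use 1(2) F1i G2i i1 i2 i3 in auto)
  also have "\<dots> = (LINT x|lborel. (D x \<bullet> dmon 0 d P y x) * wm x) - 2 * l * d * (LINT x|lborel. f x * mon 0 d P y x * wmu x)
      + (LINT x|lborel. f x * mon 0 (d - al) R y x * wmu x)"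
    using i1 i2 i3 by simp
  finally show ?thesis by simp
qed

end

subsection \<open>Orthogonal expansion\<close>

text \<open>Stated for values in an inner product space so that it serves twice: for functions with
  \<open>wmu\<close> and for gradients with \<open>wm\<close>.\<close>

lemma weighted_square_expansion:
  fixes v :: "'m \<Rightarrow> 'b::real_inner" and w :: "'i \<Rightarrow> 'm \<Rightarrow> 'b"
  assumes I: "finite I" and vv: "integrable M (\<lambda>x. (v x \<bullet> v x) * \<rho> x)"
    and vw: "\<And>i. i \<in> I \<Longrightarrow> integrable M (\<lambda>x. (v x \<bullet> w i x) * \<rho> x)"
    and ww: "\<And>i j. i \<in> I \<Longrightarrow> j \<in> I \<Longrightarrow> integrable M (\<lambda>x. (w i x \<bullet> w j x) * \<rho> x)"
    and orth: "\<And>i j. i \<in> I \<Longrightarrow> j \<in> I \<Longrightarrow> i \<noteq> j \<Longrightarrow> (LINT x|M. (w i x \<bullet> w j x) * \<rho> x) = 0"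
  shows "(LINT x|M. ((v x - (\<Sum>i\<in>I. d i *\<^sub>R w i x)) \<bullet> (v x - (\<Sum>i\<in>I. d i *\<^sub>R w i x))) * \<rho> x)
    = (LINT x|M. (v x \<bullet> v x) * \<rho> x) - 2 * (\<Sum>i\<in>I. d i * (LINT x|M. (v x \<bullet> w i x) * \<rho> x))
      + (\<Sum>i\<in>I. (d i)\<^sup>2 * (LINT x|M. (w i x \<bullet> w i x) * \<rho> x))"
proof -
  have pt: "((v x - (\<Sum>i\<in>I. d i *\<^sub>R w i x)) \<bullet> (v x - (\<Sum>i\<in>I. d i *\<^sub>R w i x))) * \<rho> x
     = (v x \<bullet> v x) * \<rho> x - 2 * (\<Sum>i\<in>I. d i * ((v x \<bullet> w i x) * \<rho> x))
       + (\<Sum>i\<in>I. \<Sum>j\<in>I. d i * d j * ((w i x \<bullet> w j x) * \<rho> x))" for x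
  proof -
    define s where "s = (\<Sum>i\<in>I. d i *\<^sub>R w i x)"
    have "(v x - s) \<bullet> (v x - s) = v x \<bullet> v x - 2 * (v x \<bullet> s) + s \<bullet> s"
      by (simp add: inner_diff_left inner_diff_right inner_commute)
    also have "v x \<bullet> s = (\<Sum>i\<in>I. d i * (v x \<bullet> w i x))" by (simp add: s_def inner_sum_right)
    also have "s \<bullet> s = (\<Sum>i\<in>I. \<Sum>j\<in>I. d i * d j * (w i x \<bullet> w j x))"
      by (simp add: s_def inner_sum_right inner_sum_left sum_distrib_left mult_ac inner_commute)
    finally show ?thesis unfolding s_def
      by (simp add: distrib_right left_diff_distrib sum_distrib_right mult.assoc)
  qed
  have i1: "integrable M (\<lambda>x. \<Sum>i\<in>I. d i * ((v x \<bullet> w i x) * \<rho> x))"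
    and i2: "integrable M (\<lambda>x. \<Sum>i\<in>I. \<Sum>j\<in>I. d i * d j * ((w i x \<bullet> w j x) * \<rho> x))"
    using vw ww by auto
  have "(\<Sum>i\<in>I. \<Sum>j\<in>I. d i * d j * (LINT x|M. (w i x \<bullet> w j x) * \<rho> x))
     = (\<Sum>i\<in>I. \<Sum>j\<in>I. if i = j then (d i)\<^sup>2 * (LINT x|M. (w i x \<bullet> w i x) * \<rho> x) else 0)"
    by (intro sum.cong refl) (simp add: orth power2_eq_square)
  also have "\<dots> = (\<Sum>i\<in>I. (d i)\<^sup>2 * (LINT x|M. (w i x \<bullet> w i x) * \<rho> x))" using I by simp
  finally have dd: "(LINT x|M. (\<Sum>i\<in>I. \<Sum>j\<in>I. d i * d j * ((w i x \<bullet> w j x) * \<rho> x)))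
      = (\<Sum>i\<in>I. (d i)\<^sup>2 * (LINT x|M. (w i x \<bullet> w i x) * \<rho> x))"
    using ww by (simp add: Bochner_Integration.integral_sum)
  have vd: "(LINT x|M. (\<Sum>i\<in>I. d i * ((v x \<bullet> w i x) * \<rho> x))) = (\<Sum>i\<in>I. d i * (LINT x|M. (v x \<bullet> w i x) * \<rho> x))"
    using vw by (simp add: Bochner_Integration.integral_sum)
  show ?thesis unfolding pt dd[symmetric] vd[symmetric]
    using i1 i2 vv by (simp add: Bochner_Integration.integral_add Bochner_Integration.integral_diff)
qed

context weighted_space
begin

text \<open>The tests range over all of \<open>cls\<close>, which contains the other eigenfunctions
  as well as the function \<open>v\<close> to be estimated; orthogonality and the Fourier
  coefficients of the Dirichlet form both come out of this one identity.\<close>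

definition eig :: "real \<Rightarrow> ('a \<Rightarrow> real) \<Rightarrow> ('a \<Rightarrow> 'a) \<Rightarrow> bool" where
  "eig lam f D \<longleftrightarrow> cls f D \<and> (\<forall>g G. cls g G \<longrightarrow>
     (LINT x|lborel. (G x \<bullet> D x) * wm x) = lam * (LINT x|lborel. g x * f x * wmu x))"

lemma eigD: "eig lam f D \<Longrightarrow> cls f D"
  "eig lam f D \<Longrightarrow> cls g G \<Longrightarrow> (LINT x|lborel. (G x \<bullet> D x) * wm x) = lam * (LINT x|lborel. g x * f x * wmu x)"
  unfolding eig_def by blast+

lemma eig_zero: "eig lam (\<lambda>x. 0) (\<lambda>x. 0)"
  by (simp add: eig_def cls_zero)

lemma eig_add:
  assumes "eig lam f D" "eig lam g G"
  shows "eig lam (\<lambda>x. f x + g x) (\<lambda>x. D x + G x)"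
proof -
  note c = eigD(1)[OF assms(1)] eigD(1)[OF assms(2)]
  have "(LINT x|lborel. (H x \<bullet> (D x + G x)) * wm x) = lam * (LINT x|lborel. h x * (f x + g x) * wmu x)" if h: "cls h H" for h H
    using integrable_wm[OF h c(1)] integrable_wm[OF h c(2)] integrable_wmu[OF h c(1)] integrable_wmu[OF h c(2)]
      eigD(2)[OF assms(1) h] eigD(2)[OF assms(2) h]
    by (simp add: inner_add_right distrib_left distrib_right)
  thus ?thesis using cls_add[OF c] by (simp add: eig_def)
qed

lemma eig_cmult:
  assumes "eig lam f D"
  shows "eig lam (\<lambda>x. c * f x) (\<lambda>x. c *\<^sub>R D x)"
proof -
  have "(LINT x|lborel. (H x \<bullet> (c *\<^sub>R D x)) * wm x) = lam * (LINT x|lborel. h x * (c * f x) * wmu x)" if h: "cls h H" for h H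
  proof -
    have "(LINT x|lborel. (H x \<bullet> (c *\<^sub>R D x)) * wm x) = (LINT x|lborel. c * ((H x \<bullet> D x) * wm x))"
      by (simp add: mult_ac)
    also have "\<dots> = lam * (LINT x|lborel. c * (h x * f x * wmu x))"
      using eigD(2)[OF assms h] by simp
    finally show ?thesis by (simp add: mult_ac)
  qed
  thus ?thesis using cls_cmult[OF eigD(1)[OF assms]] by (simp add: eig_def)
qed

text \<open>By the weak equation the powers \<open>d i = s + al * i\<close> form a triangular chain
  with diagonal \<open>2 * l * d i\<close> and off-diagonal \<open>d i * (d i + nu) - kap\<close>,
  which vanishes at \<open>i = 0\<close> because \<open>s\<close> solves the indicial equation. The
  second alternative of \<open>base\<close> covers an exponent \<open>s = 0\<close> below
  \<open>sg\<close>, where the lowest function has zero gradient and its equation is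
  trivial.\<close>

lemma eig_chain:
  assumes y: "norm y = 1" and P: "gegenbauer_op (real DIM('a)) P = smult (- kap) P"
    and s: "s * (s + nu) = kap" and sg_al: "sg \<le> al"
    and base: "sg \<le> s \<or> s = 0 \<and> (\<forall>x. x \<noteq> 0 \<longrightarrow> dmon 0 0 P y x = 0)"
  obtains a D where "a n = 1"
    "eig (2 * l * (s + al * real n)) (\<lambda>x. \<Sum>i\<le>n. a i * mon 0 (s + al * real i) P y x) D"
proof -
  define d where "d i = s + al * real i" for i
  define e where "e i = mon 0 (d i) P y" for i
  define De where "De i = dmon 0 (d i) P y" for i
  define lam where "lam i = 2 * l * d i" for i
  define c where "c i = d i * (d i + nu) - kap" for i
  have s0: "s \<ge> 0" using base sg by auto
  have dpos: "d i \<ge> sg" if "i > 0 \<or> sg \<le> s" for i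
  proof -
    have "al * real i \<ge> 0" using al by simp
    moreover have "al * real i \<ge> al" if "i > 0" using al that by simp
    ultimately show ?thesis using that sg_al s0 unfolding d_def by linarith
  qed
  have de0: "De 0 x = 0" if "\<not> sg \<le> s" "x \<noteq> 0" for x
    using base that by (auto simp: De_def d_def)
  have ce: "cls (e i) (De i)" for i
  proof (cases "i > 0 \<or> sg \<le> s")
    case True
    thus ?thesis unfolding e_def De_def by (intro cls_mon[OF y] dpos)
  next
    case False
    hence i: "i = 0" "s = 0" "\<not> sg \<le> s" using base by auto
    obtain K where K: "K > 0" "\<And>x. \<bar>mon 0 0 P y x\<bar> \<le> K * (norm x powr 0 * exp (- 0 * S x))"
      "\<And>x. x \<noteq> 0 \<Longrightarrow> norm (dmon 0 0 P y x) \<le> K * (norm x powr (0 - 1) * exp (- 0 * S x) * (1 + \<bar>0\<bar> * S x))"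
      using mon_bounds[OF y, of 0 0 P] by blast
    have "\<bar>e i x\<bar> \<le> K * exp (S x / 4) \<and> norm (De i x) \<le> K * (norm x powr (sg - 1) * exp (S x / 4))" if "x \<noteq> 0" for x
    proof
      have "\<bar>e i x\<bar> \<le> K * 1" using K(2)[of x] that i by (simp add: e_def d_def)
      also have "\<dots> \<le> K * exp (S x / 4)" using K(1) S_nonneg[of x] by (intro mult_left_mono) auto
      finally show "\<bar>e i x\<bar> \<le> K * exp (S x / 4)" .
      show "norm (De i x) \<le> K * (norm x powr (sg - 1) * exp (S x / 4))"
        using de0[OF i(3) that] i(1) K(1) by simp
    qed
    thus ?thesis unfolding cls_def using mon_has_derivative dmon_continuous by (auto simp: e_def De_def)
  qed
  have rel: "(LINT x|lborel. (G x \<bullet> De i x) * wm x) = lam i * (LINT x|lborel. g x * e i x * wmu x)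
      - c i * (LINT x|lborel. g x * e (i - 1) x * wmu x)" if g: "cls g G" for g G i
  proof (cases "i > 0 \<or> sg \<le> s")
    case True
    have R: "smult (d i * (d i + nu)) P + gegenbauer_op (real DIM('a)) P = smult (c i) P"
      unfolding P c_def by (simp add: smult_diff_left)
    have "(LINT x|lborel. g x * mon 0 (d i - al) (smult (c i) P) y x * wmu x) = c i * (LINT x|lborel. g x * e (i - 1) x * wmu x)"
    proof (cases "i = 0")
      case True
      thus ?thesis using s by (simp add: c_def d_def mon_def)
    next
      case False
      hence "d i - al = d (i - 1)" by (cases i) (auto simp: d_def algebra_simps)
      hence "(LINT x|lborel. g x * mon 0 (d i - al) (smult (c i) P) y x * wmu x) = (LINT x|lborel. c i * (g x * e (i - 1) x * wmu x))"
        by (simp add: e_def mon_def mult_ac)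
      thus ?thesis by simp
    qed
    thus ?thesis using mon_weak_equation[OF g y dpos[OF True], of P] unfolding R e_def De_def lam_def by simp
  next
    case False
    hence i: "i = 0" "s = 0" "\<not> sg \<le> s" using base by auto
    have "(G x \<bullet> De i x) * wm x = 0" for x
      using de0[OF i(3), of x] i(1) by (cases "x = 0") (auto simp: wm_def)
    hence "(LINT x|lborel. (G x \<bullet> De i x) * wm x) = 0" by (simp only: integral_zero)
    thus ?thesis using i s by (simp add: lam_def c_def d_def)
  qed
  have ne: "lam i \<noteq> lam n" if "i < n" for i using that l al by (simp add: lam_def d_def)
  have c0: "c 0 = 0" using s by (simp add: c_def d_def)
  show ?thesis
  proof (rule triangular_eigenvector[of n lam c, OF ne c0])
    fix a :: "nat \<Rightarrow> real"
    assume a: "a n = 1" "\<And>B. (\<Sum>i\<le>n. a i * (lam i * B i - c i * B (i - 1))) = lam n * (\<Sum>i\<le>n. a i * B i)"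
    have cs: "cls (\<lambda>x. \<Sum>i\<le>n. a i * e i x) (\<lambda>x. \<Sum>i\<le>n. a i *\<^sub>R De i x)"
      by (intro cls_sum cls_cmult ce)
    have "eig (lam n) (\<lambda>x. \<Sum>i\<le>n. a i * e i x) (\<lambda>x. \<Sum>i\<le>n. a i *\<^sub>R De i x)"
      unfolding eig_def
    proof (intro conjI allI impI cs)
      fix g G assume g: "cls g G"
      have "(LINT x|lborel. (G x \<bullet> (\<Sum>i\<le>n. a i *\<^sub>R De i x)) * wm x) = (LINT x|lborel. (\<Sum>i\<le>n. a i * ((G x \<bullet> De i x) * wm x)))"
        by (simp add: inner_sum_right sum_distrib_right mult.assoc)
      also have "\<dots> = (\<Sum>i\<le>n. a i * (LINT x|lborel. (G x \<bullet> De i x) * wm x))"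
        using integrable_wm[OF g ce] by (simp add: Bochner_Integration.integral_sum)
      also have "\<dots> = lam n * (\<Sum>i\<le>n. a i * (LINT x|lborel. g x * e i x * wmu x))"
        unfolding rel[OF g] by (rule a(2))
      also have "(\<Sum>i\<le>n. a i * (LINT x|lborel. g x * e i x * wmu x)) = (LINT x|lborel. (\<Sum>i\<le>n. a i * (g x * e i x * wmu x)))"
        using integrable_wmu[OF g ce] by (simp add: Bochner_Integration.integral_sum)
      also have "\<dots> = (LINT x|lborel. g x * (\<Sum>i\<le>n. a i * e i x) * wmu x)"
        by (simp add: sum_distrib_left sum_distrib_right mult_ac)
      finally show "(LINT x|lborel. (G x \<bullet> (\<Sum>i\<le>n. a i *\<^sub>R De i x)) * wm x) = lam n * (LINT x|lborel. g x * (\<Sum>i\<le>n. a i * e i x) * wmu x)" .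
    qed
    thus ?thesis using that[of a] a(1) unfolding lam_def d_def e_def by blast
  qed
qed

end

section \<open>Two-level spectral gap for functions near the span of the eigenfunctions\<close>

locale spectral_gap = weighted_space +
  fixes t1 t2 :: real and radial axial :: bool
  assumes t: "0 \<le> t1" "t1 \<le> t2"
begin

text \<open>The nonnegative root \<open>s\<close> of \<open>s * (s + nu) = k * (k + N - 2)\<close>.
  The constants \<open>D1\<close> and \<open>D2\<close> are \<open>2 * sk 1\<close> and
  \<open>2 * sk 2\<close>.\<close>

definition sk :: "nat \<Rightarrow> real" where
  "sk k = (sqrt (nu\<^sup>2 + 4 * (real k * (real k + real DIM('a) - 2))) - nu) / 2"

text \<open>The admissible corrections: constants for the first gap; for the second one also the modes switched on by
  \<open>radial\<close> and \<open>axial\<close>. The thresholds \<open>t1\<close>, \<open>t2\<close> are eigenvalues for \<open>l = 1\<close>.\<close>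

definition low1 :: "('a \<Rightarrow> real) \<Rightarrow> bool" where
  "low1 f \<longleftrightarrow> (\<exists>c. \<forall>x. x \<noteq> 0 \<longrightarrow> f x = c)"

definition low2 :: "('a \<Rightarrow> real) \<Rightarrow> bool" where
  "low2 f \<longleftrightarrow> (\<exists>c d v. (\<not> radial \<longrightarrow> d = 0) \<and> (\<not> axial \<longrightarrow> v = 0) \<and>
     (\<forall>x. x \<noteq> 0 \<longrightarrow> f x = c + d * norm x powr al + norm x powr (sk 1 - 1) * (v \<bullet> x)))"

text \<open>All that the gap argument has to know about an eigenfunction: if its eigenvalue lies
  below a threshold, it is an admissible correction at that level.\<close>

definition good :: "real \<Rightarrow> ('a \<Rightarrow> real) \<Rightarrow> ('a \<Rightarrow> 'a) \<Rightarrow> bool" where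
  "good lam f D \<longleftrightarrow> eig lam f D \<and> lam \<ge> 0 \<and> (lam < l * t1 \<longrightarrow> low1 f) \<and> (lam < l * t2 \<longrightarrow> low2 f)"

text \<open>The summands are indexed by their eigenvalue, so distinct summands are automatically
  orthogonal, however many axes and pairs \<open>(k, j)\<close> are merged into one of them.\<close>

definition gspan :: "('a \<Rightarrow> real) \<Rightarrow> bool" where
  "gspan g \<longleftrightarrow> (\<exists>\<Lambda> w D. finite \<Lambda> \<and> (\<forall>lam\<in>\<Lambda>. good lam (w lam) (D lam)) \<and>
     (\<forall>x. x \<noteq> 0 \<longrightarrow> g x = (\<Sum>lam\<in>\<Lambda>. w lam x)))"

lemma low1_simps: "low1 (\<lambda>x. 0)" "low1 f \<Longrightarrow> low1 (\<lambda>x. c * f x)" "low1 f \<Longrightarrow> low1 g \<Longrightarrow> low1 (\<lambda>x. f x + g x)"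
  unfolding low1_def by auto

lemma low2_simps: "low2 (\<lambda>x. 0)" "low2 f \<Longrightarrow> low2 (\<lambda>x. c * f x)" "low2 f \<Longrightarrow> low2 g \<Longrightarrow> low2 (\<lambda>x. f x + g x)"
proof -
  show "low2 (\<lambda>x. 0)" unfolding low2_def by (intro exI[of _ 0]) auto
  show "low2 (\<lambda>x. c * f x)" if f: "low2 f"
  proof -
    obtain c' d v where f: "\<not> radial \<longrightarrow> d = 0" "\<not> axial \<longrightarrow> v = 0"
      "\<forall>x. x \<noteq> 0 \<longrightarrow> f x = c' + d * norm x powr al + norm x powr (sk 1 - 1) * (v \<bullet> x)"
      using f unfolding low2_def by blast
    show ?thesis unfolding low2_def
      by (rule exI[of _ "c * c'"], rule exI[of _ "c * d"], rule exI[of _ "c *\<^sub>R v"]) (use f in \<open>auto simp: algebra_simps\<close>)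
  qed
  show "low2 (\<lambda>x. f x + g x)" if f: "low2 f" and g: "low2 g"
  proof -
    obtain c' d v where f: "\<not> radial \<longrightarrow> d = 0" "\<not> axial \<longrightarrow> v = 0"
      "\<forall>x. x \<noteq> 0 \<longrightarrow> f x = c' + d * norm x powr al + norm x powr (sk 1 - 1) * (v \<bullet> x)"
      using f unfolding low2_def by blast
    obtain c2 d2 v2 where g: "\<not> radial \<longrightarrow> d2 = 0" "\<not> axial \<longrightarrow> v2 = 0"
      "\<forall>x. x \<noteq> 0 \<longrightarrow> g x = c2 + d2 * norm x powr al + norm x powr (sk 1 - 1) * (v2 \<bullet> x)"
      using g unfolding low2_def by blast
    show ?thesis unfolding low2_def
      by (rule exI[of _ "c' + c2"], rule exI[of _ "d + d2"], rule exI[of _ "v + v2"]) (use f g in \<open>auto simp: algebra_simps inner_add_left\<close>)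
  qed
qed

lemma low1_sum:
  assumes "\<And>i. i \<in> I \<Longrightarrow> low1 (f i)" shows "low1 (\<lambda>x. \<Sum>i\<in>I. f i x)"
  using assms by (induction I rule: infinite_finite_induct) (auto intro: low1_simps)

lemma low2_sum:
  assumes "\<And>i. i \<in> I \<Longrightarrow> low2 (f i)" shows "low2 (\<lambda>x. \<Sum>i\<in>I. f i x)"
  using assms by (induction I rule: infinite_finite_induct) (auto intro: low2_simps)

lemma good_zero: "lam \<ge> 0 \<Longrightarrow> good lam (\<lambda>x. 0) (\<lambda>x. 0)"
  unfolding good_def by (blast intro: eig_zero low1_simps low2_simps)

lemma good_add: "good lam f D \<Longrightarrow> good lam g G \<Longrightarrow> good lam (\<lambda>x. f x + g x) (\<lambda>x. D x + G x)"
  unfolding good_def by (blast intro: eig_add low1_simps low2_simps)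

lemma good_cmult: "good lam f D \<Longrightarrow> good lam (\<lambda>x. c * f x) (\<lambda>x. c *\<^sub>R D x)"
  unfolding good_def by (blast intro: eig_cmult low1_simps low2_simps)

lemma gspan_cong: "gspan f \<Longrightarrow> (\<And>x. x \<noteq> 0 \<Longrightarrow> f x = g x) \<Longrightarrow> gspan g"
  unfolding gspan_def by metis

lemma gspan_good: "good lam f D \<Longrightarrow> gspan f"
  unfolding gspan_def by (intro exI[of _ "{lam}"] exI[of _ "\<lambda>_. f"] exI[of _ "\<lambda>_. D"]) auto

lemma gspan_zero: "gspan (\<lambda>x. 0)"
  using gspan_good[OF good_zero[of 0]] by simp

lemma gspan_cmult: "gspan f \<Longrightarrow> gspan (\<lambda>x. c * f x)"
proof -
  assume "gspan f"
  then obtain \<Lambda> w D where "finite \<Lambda>" "\<forall>lam\<in>\<Lambda>. good lam (w lam) (D lam)" "\<forall>x. x \<noteq> 0 \<longrightarrow> f x = (\<Sum>lam\<in>\<Lambda>. w lam x)"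
    unfolding gspan_def by blast
  thus ?thesis unfolding gspan_def
    by (intro exI[of _ \<Lambda>] exI[of _ "\<lambda>i x. c * w i x"] exI[of _ "\<lambda>i x. c *\<^sub>R D i x"]) (auto simp: sum_distrib_left intro: good_cmult)
qed

lemma gspan_add:
  assumes "gspan f" "gspan g"
  shows "gspan (\<lambda>x. f x + g x)"
proof -
  obtain A w D where f: "finite A" "\<And>lam. lam \<in> A \<Longrightarrow> good lam (w lam) (D lam)" "\<And>x. x \<noteq> 0 \<Longrightarrow> f x = (\<Sum>lam\<in>A. w lam x)"
    using assms(1) unfolding gspan_def by blast
  obtain B z G where g: "finite B" "\<And>lam. lam \<in> B \<Longrightarrow> good lam (z lam) (G lam)" "\<And>x. x \<noteq> 0 \<Longrightarrow> g x = (\<Sum>lam\<in>B. z lam x)"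
    using assms(2) unfolding gspan_def by blast
  \<comment> \<open>Padding with the zero function, which is good for every nonnegative eigenvalue,
    puts both families on the union of their spectra.\<close>
  define w' D' where "w' lam = (if lam \<in> A then w lam else (\<lambda>x. 0))" and "D' lam = (if lam \<in> A then D lam else (\<lambda>x. 0))" for lam
  define z' G' where "z' lam = (if lam \<in> B then z lam else (\<lambda>x. 0))" and "G' lam = (if lam \<in> B then G lam else (\<lambda>x. 0))" for lam
  have pos: "lam \<ge> 0" if "lam \<in> A \<union> B" for lam using that f(2)[of lam] g(2)[of lam] by (auto simp: good_def)
  have gd: "good lam (\<lambda>x. w' lam x + z' lam x) (\<lambda>x. D' lam x + G' lam x)" if "lam \<in> A \<union> B" for lam
    by (rule good_add) (auto simp: w'_def D'_def z'_def G'_def f(2) g(2) good_zero[OF pos[OF that]])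
  have "f x + g x = (\<Sum>lam\<in>A \<union> B. w' lam x + z' lam x)" if x: "x \<noteq> 0" for x
  proof -
    have "f x = (\<Sum>lam\<in>A \<union> B. w' lam x)" unfolding f(3)[OF x] w'_def
      by (rule sum.mono_neutral_cong_left) (use f g in auto)
    moreover have "g x = (\<Sum>lam\<in>A \<union> B. z' lam x)" unfolding g(3)[OF x] z'_def
      by (rule sum.mono_neutral_cong_left) (use f g in auto)
    ultimately show ?thesis by (simp add: sum.distrib)
  qed
  thus ?thesis unfolding gspan_def using f(1) g(1) gd
    by (intro exI[of _ "A \<union> B"] exI[of _ "\<lambda>lam x. w' lam x + z' lam x"] exI[of _ "\<lambda>lam x. D' lam x + G' lam x"]) auto
qed

lemma gspan_sum:
  assumes "\<And>i. i \<in> I \<Longrightarrow> gspan (f i)" shows "gspan (\<lambda>x. \<Sum>i\<in>I. f i x)"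
  using assms by (induction I rule: infinite_finite_induct) (auto intro: gspan_zero gspan_add)

text \<open>A layer-cake estimate. With \<open>q i\<close> the squared norm of the component of
  \<open>v\<close> at eigenvalue \<open>i\<close>, Bessel bounds the energy below by the sum of
  \<open>i * q i\<close>, and \<open>i\<close> is at least \<open>l * t1\<close> above the first
  threshold plus a further \<open>l * (t2 - t1)\<close> above the second. The two tail sums of
  \<open>q\<close> are at least \<open>I1\<close> and \<open>I2\<close> up to the approximation
  error.\<close>

theorem spectral_gap_approx:
  assumes v: "cls v Dv" and w: "gspan w"
    and I1: "\<And>f. low1 f \<Longrightarrow> I1 \<le> (LINT x|lborel. (v x - f x)\<^sup>2 * wmu x)"
    and I2: "\<And>f. low2 f \<Longrightarrow> I2 \<le> (LINT x|lborel. (v x - f x)\<^sup>2 * wmu x)"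
  shows "l * t1 * I1 + l * (t2 - t1) * I2 - l * t2 * (LINT x|lborel. (v x - w x)\<^sup>2 * wmu x)
    \<le> (LINT x|lborel. (Dv x \<bullet> Dv x) * wm x)"
proof -
  obtain \<Lambda> u D where fin: "finite \<Lambda>" and gd: "\<And>lam. lam \<in> \<Lambda> \<Longrightarrow> good lam (u lam) (D lam)"
    and wu: "\<And>x. x \<noteq> 0 \<Longrightarrow> w x = (\<Sum>lam\<in>\<Lambda>. u lam x)"
    using w unfolding gspan_def by blast
  have ei: "eig lam (u lam) (D lam)" "cls (u lam) (D lam)" "lam \<ge> 0" if "lam \<in> \<Lambda>" for lam
    using gd[OF that] by (auto simp: good_def eigD)
  define bb where "bb i = (LINT x|lborel. u i x * u i x * wmu x)" for i
  define p where "p i = (LINT x|lborel. v x * u i x * wmu x)" for i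
  define c where "c i = p i / bb i" for i
  define q where "q i = (c i)\<^sup>2 * bb i" for i
  define V where "V = (LINT x|lborel. v x * v x * wmu x)"
  have bb0: "bb i \<ge> 0" for i unfolding bb_def by (intro integral_nonneg_AE AE_I2) (auto simp: wmu_nonneg)
  \<comment> \<open>When \<open>bb i = 0\<close> the quotient \<open>c i\<close> is 0 by convention;
    then \<open>u i\<close> vanishes almost everywhere for the weight and \<open>p i\<close> is 0
    too.\<close>
  have pc: "p i = c i * bb i" if i: "i \<in> \<Lambda>" for i
  proof (cases "bb i = 0")
    case True
    have "AE x in lborel. u i x * u i x * wmu x = 0"
      using True integral_nonneg_eq_0_iff_AE[OF integrable_wmu[OF ei(2)[OF i] ei(2)[OF i]]]
      unfolding bb_def by (simp add: wmu_nonneg)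
    hence "AE x in lborel. v x * u i x * wmu x = 0" by eventually_elim auto
    hence "p i = 0" unfolding p_def by (rule integral_eq_zero_AE)
    thus ?thesis using True by simp
  qed (simp add: c_def)
  have orth: "(LINT x|lborel. u i x * u j x * wmu x) = 0" if "i \<in> \<Lambda>" "j \<in> \<Lambda>" "i \<noteq> j" for i j
  proof -
    have "j * (LINT x|lborel. u i x * u j x * wmu x) = (LINT x|lborel. (D i x \<bullet> D j x) * wm x)"
      using eigD(2)[OF ei(1)[OF that(2)] ei(2)[OF that(1)]] by simp
    also have "\<dots> = i * (LINT x|lborel. u j x * u i x * wmu x)"
      using eigD(2)[OF ei(1)[OF that(1)] ei(2)[OF that(2)]] by (simp add: inner_commute)
    finally show ?thesis using that(3) by (simp add: mult.commute)
  qed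
  have expand: "(LINT x|lborel. (v x - (\<Sum>i\<in>A. d i * u i x))\<^sup>2 * wmu x) = V - 2 * (\<Sum>i\<in>A. d i * p i) + (\<Sum>i\<in>A. (d i)\<^sup>2 * bb i)"
    if A: "A \<subseteq> \<Lambda>" for A d
  proof -
    have "integrable lborel (\<lambda>x. (v x \<bullet> v x) * wmu x)" using integrable_wmu[OF v v] by simp
    moreover have "integrable lborel (\<lambda>x. (v x \<bullet> u i x) * wmu x)" if "i \<in> A" for i
      using integrable_wmu[OF v ei(2)] that A by auto
    moreover have "integrable lborel (\<lambda>x. (u i x \<bullet> u j x) * wmu x)" if "i \<in> A" "j \<in> A" for i j
      using integrable_wmu[OF ei(2) ei(2)] that A by auto
    moreover have "(LINT x|lborel. (u i x \<bullet> u j x) * wmu x) = 0" if "i \<in> A" "j \<in> A" "i \<noteq> j" for i j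
      using orth that A by auto
    ultimately show ?thesis
      using weighted_square_expansion[of A lborel v wmu u d] finite_subset[OF A fin]
      by (simp add: V_def p_def bb_def power2_eq_square)
  qed
  have proj: "(LINT x|lborel. (v x - (\<Sum>i\<in>A. c i * u i x))\<^sup>2 * wmu x) = V - (\<Sum>i\<in>A. q i)" if A: "A \<subseteq> \<Lambda>" for A
  proof -
    have "(\<Sum>i\<in>A. c i * p i) = (\<Sum>i\<in>A. q i)"
      using A by (intro sum.cong) (auto simp: pc q_def power2_eq_square)
    thus ?thesis unfolding expand[OF A] by (simp add: q_def)
  qed
  \<comment> \<open>The given approximant has all coefficients 1, and orthogonal projection does at
    least as well.\<close>
  have eps: "V - (\<Sum>i\<in>\<Lambda>. q i) \<le> (LINT x|lborel. (v x - w x)\<^sup>2 * wmu x)"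
  proof -
    have "(LINT x|lborel. (v x - w x)\<^sup>2 * wmu x) = (LINT x|lborel. (v x - (\<Sum>i\<in>\<Lambda>. 1 * u i x))\<^sup>2 * wmu x)"
    proof (rule Bochner_Integration.integral_cong[OF refl])
      fix x show "(v x - w x)\<^sup>2 * wmu x = (v x - (\<Sum>i\<in>\<Lambda>. 1 * u i x))\<^sup>2 * wmu x"
        using wu[of x] by (cases "x = 0") (auto simp: wmu_def)
    qed
    also have "\<dots> = V - (\<Sum>i\<in>\<Lambda>. 2 * p i - bb i)"
      unfolding expand[OF order.refl] by (simp add: sum_subtractf sum_distrib_left)
    also have "(\<Sum>i\<in>\<Lambda>. 2 * p i - bb i) \<le> (\<Sum>i\<in>\<Lambda>. q i)"
    proof (rule sum_mono)
      fix i assume "i \<in> \<Lambda>"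
      have "q i - (2 * p i - bb i) = (c i - 1)\<^sup>2 * bb i"
        unfolding pc[OF \<open>i \<in> \<Lambda>\<close>] q_def by (simp add: power2_eq_square algebra_simps)
      also have "\<dots> \<ge> 0" using bb0 by simp
      finally show "2 * p i - bb i \<le> q i" by simp
    qed
    hence "V - (\<Sum>i\<in>\<Lambda>. q i) \<le> V - (\<Sum>i\<in>\<Lambda>. 2 * p i - bb i)" by simp
    ultimately show ?thesis by linarith
  qed
  have split: "(\<Sum>i\<in>\<Lambda>. q i) = (\<Sum>i\<in>{i\<in>\<Lambda>. i < T}. q i) + (\<Sum>i\<in>\<Lambda>. if i \<ge> T then q i else 0)" for T
  proof -
    have "(\<Sum>i\<in>\<Lambda>. q i) = (\<Sum>i\<in>\<Lambda>. (if i < T then q i else 0) + (if i \<ge> T then q i else 0))"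
      by (intro sum.cong) auto
    thus ?thesis using fin by (simp add: sum.distrib sum.inter_filter)
  qed
  define \<epsilon> where "\<epsilon> = (LINT x|lborel. (v x - w x)\<^sup>2 * wmu x)"
  \<comment> \<open>The projection to the eigenvalues below the threshold is a competitor for
    \<open>I1\<close>, so \<open>V\<close> minus the low part of the sum is at least
    \<open>I1\<close>; \<open>eps\<close> replaces \<open>V\<close> by the full sum.\<close>
  have 1: "(\<Sum>i\<in>\<Lambda>. if i \<ge> l * t1 then q i else 0) \<ge> I1 - \<epsilon>"
  proof -
    have "low1 (\<lambda>x. \<Sum>i\<in>{i\<in>\<Lambda>. i < l * t1}. c i * u i x)"
      using gd by (intro low1_sum low1_simps) (auto simp: good_def)
    from I1[OF this] proj[of "{i\<in>\<Lambda>. i < l * t1}"] split[of "l * t1"] eps show ?thesis unfolding \<epsilon>_def by auto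
  qed
  have 2: "(\<Sum>i\<in>\<Lambda>. if i \<ge> l * t2 then q i else 0) \<ge> I2 - \<epsilon>"
  proof -
    have "low2 (\<lambda>x. \<Sum>i\<in>{i\<in>\<Lambda>. i < l * t2}. c i * u i x)"
      using gd by (intro low2_sum low2_simps) (auto simp: good_def)
    from I2[OF this] proj[of "{i\<in>\<Lambda>. i < l * t2}"] split[of "l * t2"] eps show ?thesis unfolding \<epsilon>_def by auto
  qed
  \<comment> \<open>The coefficients \<open>c i\<close> come from the \<open>wmu\<close> projection;
    by the weak equation they are also the right ones for the Dirichlet form, with each square
    weighted by its eigenvalue.\<close>
  have 3: "(\<Sum>i\<in>\<Lambda>. i * q i) \<le> (LINT x|lborel. (Dv x \<bullet> Dv x) * wm x)"
  proof -
    have QD: "(LINT x|lborel. (D i x \<bullet> D j x) * wm x) = j * (LINT x|lborel. u i x * u j x * wmu x)" if "i \<in> \<Lambda>" "j \<in> \<Lambda>" for i j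
      using eigD(2)[OF ei(1)[OF that(2)] ei(2)[OF that(1)]] .
    have Qv: "(LINT x|lborel. (Dv x \<bullet> D j x) * wm x) = j * p j" if "j \<in> \<Lambda>" for j
      using eigD(2)[OF ei(1)[OF that] v] by (simp add: p_def)
    have "0 \<le> (LINT x|lborel. ((Dv x - (\<Sum>i\<in>\<Lambda>. c i *\<^sub>R D i x)) \<bullet> (Dv x - (\<Sum>i\<in>\<Lambda>. c i *\<^sub>R D i x))) * wm x)"
      by (intro integral_nonneg_AE AE_I2) (auto simp: wm_nonneg)
    also have "\<dots> = (LINT x|lborel. (Dv x \<bullet> Dv x) * wm x) - 2 * (\<Sum>i\<in>\<Lambda>. c i * (LINT x|lborel. (Dv x \<bullet> D i x) * wm x))
      + (\<Sum>i\<in>\<Lambda>. (c i)\<^sup>2 * (LINT x|lborel. (D i x \<bullet> D i x) * wm x))"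
      using fin by (intro weighted_square_expansion integrable_wm[OF v v] integrable_wm[OF v ei(2)] integrable_wm[OF ei(2) ei(2)])
        (auto simp: QD orth)
    also have "(\<Sum>i\<in>\<Lambda>. c i * (LINT x|lborel. (Dv x \<bullet> D i x) * wm x)) = (\<Sum>i\<in>\<Lambda>. i * q i)"
      by (intro sum.cong) (auto simp: Qv pc q_def power2_eq_square)
    also have "(\<Sum>i\<in>\<Lambda>. (c i)\<^sup>2 * (LINT x|lborel. (D i x \<bullet> D i x) * wm x)) = (\<Sum>i\<in>\<Lambda>. i * q i)"
      by (intro sum.cong) (auto simp: QD q_def bb_def power2_eq_square)
    finally show ?thesis by simp
  qed
  have q0: "q i \<ge> 0" for i using bb0 by (simp add: q_def)
  have lt: "0 \<le> l * t1" "0 \<le> l * (t2 - t1)" "l * t1 \<le> l * t2" using l t by auto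
  have "l * t1 * (I1 - \<epsilon>) + l * (t2 - t1) * (I2 - \<epsilon>)
     \<le> l * t1 * (\<Sum>i\<in>\<Lambda>. if i \<ge> l * t1 then q i else 0) + l * (t2 - t1) * (\<Sum>i\<in>\<Lambda>. if i \<ge> l * t2 then q i else 0)"
    by (intro add_mono mult_left_mono 1 2 lt)
  also have "\<dots> = (\<Sum>i\<in>\<Lambda>. l * t1 * (if i \<ge> l * t1 then q i else 0) + l * (t2 - t1) * (if i \<ge> l * t2 then q i else 0))"
    by (simp add: sum_distrib_left sum.distrib)
  also have "\<dots> \<le> (\<Sum>i\<in>\<Lambda>. i * q i)"
  proof (rule sum_mono)
    fix i assume "i \<in> \<Lambda>"
    have i: "i \<ge> 0" by (rule ei(3)[OF \<open>i \<in> \<Lambda>\<close>])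
    have "l * t1 * (if i \<ge> l * t1 then q i else 0) + l * (t2 - t1) * (if i \<ge> l * t2 then q i else 0)
       = (l * t1 * (if i \<ge> l * t1 then 1 else 0) + l * (t2 - t1) * (if i \<ge> l * t2 then 1 else 0)) * q i"
      by (simp add: distrib_right)
    also have "\<dots> \<le> i * q i"
      by (intro mult_right_mono q0) (use i lt in \<open>auto simp: right_diff_distrib\<close>)
    finally show "l * t1 * (if i \<ge> l * t1 then q i else 0) + l * (t2 - t1) * (if i \<ge> l * t2 then q i else 0) \<le> i * q i" .
  qed
  also note 3
  finally show ?thesis unfolding \<epsilon>_def by (simp add: algebra_simps)
qed

end

subsection \<open>Density of the eigenfunctions\<close>

text \<open>For \<open>l = 1\<close> the eigenvalues are \<open>2 * sk k + 2 * al * n\<close>. The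
  bounds place \<open>t1\<close> below all but \<open>(k, n) = (0, 0)\<close>, and \<open>t2\<close>
  below all but \<open>(0, 0)\<close>, \<open>(0, 1)\<close> and \<open>(1, 0)\<close>; the last two
  pairs are exempt only if \<open>radial\<close> respectively \<open>axial\<close> admits their
  modes as corrections.\<close>

locale admissible_gap = spectral_gap al b l sg dim t1 t2 radial axial
  for al b l sg :: real and dim :: "'a::euclidean_space itself" and t1 t2 :: real and radial axial :: bool +
  assumes sg_al: "sg \<le> al" and sg1: "DIM('a) \<ge> 2 \<Longrightarrow> sg \<le> sk 1" and sg2: "sg \<le> sk 2"
    and t1_le: "t1 \<le> 2 * al" "t1 \<le> 2 * sk 1"
    and t2_le: "t2 \<le> 4 * al" "t2 \<le> 2 * al + 2 * sk 1" "t2 \<le> 2 * sk 2"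
      "\<not> radial \<Longrightarrow> t2 \<le> 2 * al" "\<not> axial \<Longrightarrow> t2 \<le> 2 * sk 1"
begin

definition geg :: "nat \<Rightarrow> real poly" where
  "geg = (SOME P. (\<forall>k. gegenbauer_op (real DIM('a)) (P k) = smult (- (real k * (real k + real DIM('a) - 2))) (P k))
     \<and> P 0 = 1 \<and> P 1 = [:0, 1:] \<and> (\<forall>n. \<exists>c. \<forall>t. t ^ n = (\<Sum>j\<le>n. c j * poly (P j) t)))"

lemma geg: "gegenbauer_op (real DIM('a)) (geg k) = smult (- (real k * (real k + real DIM('a) - 2))) (geg k)"
  "geg 0 = 1" "geg 1 = [:0, 1:]" "\<exists>c. \<forall>t. t ^ n = (\<Sum>j\<le>n. c j * poly (geg j) t)"
proof -
  have "(\<forall>k. gegenbauer_op (real DIM('a)) (geg k) = smult (- (real k * (real k + real DIM('a) - 2))) (geg k))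
     \<and> geg 0 = 1 \<and> geg 1 = [:0, 1:] \<and> (\<forall>n. \<exists>c. \<forall>t. t ^ n = (\<Sum>j\<le>n. c j * poly (geg j) t))"
  proof -
    have N: "1 \<le> real DIM('a)" using DIM_positive[where 'a='a] by linarith
    obtain P where "\<And>k. gegenbauer_op (real DIM('a)) (P k) = smult (- (real k * (real k + real DIM('a) - 2))) (P k)"
      "P 0 = 1" "P 1 = [:0, 1:]" "\<And>n. \<exists>c. \<forall>t. t ^ n = (\<Sum>j\<le>n. c j * poly (P j) t)"
      using gegenbauer_polynomials[OF N] by blast
    hence "\<exists>P. (\<forall>k. gegenbauer_op (real DIM('a)) (P k) = smult (- (real k * (real k + real DIM('a) - 2))) (P k))
     \<and> P 0 = 1 \<and> P 1 = [:0, 1:] \<and> (\<forall>n. \<exists>c. \<forall>t. t ^ n = (\<Sum>j\<le>n. c j * poly (P j) t))" by blast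
    from someI_ex[OF this] show ?thesis unfolding geg_def[symmetric] .
  qed
  thus "gegenbauer_op (real DIM('a)) (geg k) = smult (- (real k * (real k + real DIM('a) - 2))) (geg k)"
  "geg 0 = 1" "geg 1 = [:0, 1:]" "\<exists>c. \<forall>t. t ^ n = (\<Sum>j\<le>n. c j * poly (geg j) t)" by blast+
qed

lemma kap_mono: "i \<le> j \<Longrightarrow> real i * (real i + real DIM('a) - 2) \<le> real j * (real j + real DIM('a) - 2)"
proof (cases "i = 0")
  case True
  assume "i \<le> j"
  have "0 \<le> real j * (real j + real DIM('a) - 2)"
  proof (cases "j = 0")
    case False
    hence "real j \<ge> 1" "real DIM('a) \<ge> 1" using DIM_positive[where 'a='a] by linarith+
    thus ?thesis by (intro mult_nonneg_nonneg) linarith+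
  qed simp
  thus ?thesis using True by simp
next
  case False
  assume "i \<le> j"
  moreover have "real i \<ge> 1" "real DIM('a) \<ge> 1" using DIM_positive[where 'a='a] False by linarith+
  ultimately show ?thesis using \<open>i \<le> j\<close> by (intro mult_mono) linarith+
qed

lemma sk_mono: "i \<le> j \<Longrightarrow> sk i \<le> sk j"
  using kap_mono[of i j] by (simp add: sk_def)

lemma sk_0: "sk 0 = 0"
  using nu0 by (simp add: sk_def)

lemma sk_nonneg: "sk k \<ge> 0"
  using sk_mono[of 0 k] sk_0 by simp

lemma sk_equation: "sk k * (sk k + nu) = real k * (real k + real DIM('a) - 2)"
proof -
  define q where "q = nu\<^sup>2 + 4 * (real k * (real k + real DIM('a) - 2))"
  have q: "q \<ge> 0" using kap_mono[of 0 k] by (simp add: q_def)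
  have skq: "sk k = (sqrt q - nu) / 2" by (simp add: sk_def q_def)
  have "sk k * (sk k + nu) = ((sqrt q)\<^sup>2 - nu\<^sup>2) / 4"
    unfolding skq power2_eq_square by (simp add: field_simps)
  also have "\<dots> = real k * (real k + real DIM('a) - 2)" unfolding real_sqrt_pow2[OF q] by (simp add: q_def)
  finally show ?thesis .
qed

text \<open>In dimension one \<open>sk 1 = 0\<close> and the corresponding mode is the sign function.\<close>

lemma sk_base:
  assumes y: "norm y = 1"
  shows "sg \<le> sk k \<or> sk k = 0 \<and> (\<forall>x. x \<noteq> 0 \<longrightarrow> dmon 0 0 (geg k) y x = 0)"
proof -
  consider "k = 0" | "k = 1" "DIM('a) \<ge> 2" | "k = 1" "DIM('a) = 1" | "k \<ge> 2"
    using DIM_positive[where 'a='a] by linarith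
  thus ?thesis
  proof cases
    case 1
    thus ?thesis by (simp add: sk_0 geg dmon_def)
  next
    case 3
    have "dmon 0 0 (geg k) y x = 0" if x: "x \<noteq> 0" for x
    proof -
      obtain i :: 'a where i: "Basis = {i}" using 3(2) card_1_singletonE by metis
      have xi: "x = (x \<bullet> i) *\<^sub>R i" using euclidean_representation[of x] unfolding i by simp
      have yi: "y = (y \<bullet> i) *\<^sub>R i" using euclidean_representation[of y] unfolding i by simp
      have ii: "i \<bullet> i = 1" "norm i = 1" using i by (auto intro!: inner_same_Basis norm_Basis)
      define p q where "p = x \<bullet> i" and "q = y \<bullet> i"
      have x': "x = p *\<^sub>R i" and y': "y = q *\<^sub>R i" using xi yi by (simp_all add: p_def q_def)
      have p: "p \<noteq> 0" using x x' by auto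
      have "\<bar>q\<bar> = 1" using y ii unfolding y' by simp
      hence q: "q * q = 1" by (metis abs_mult_self_eq mult_1)
      have pw: "\<bar>p\<bar> powr (-2) = 1 / (p * p)" "\<bar>p\<bar> powr (-1) = 1 / \<bar>p\<bar>"
        using p by (simp_all add: powr_minus_divide power2_eq_square[symmetric])
      have "dmon 0 0 (geg k) y x = (- (1 / (p * p) * (p * q / \<bar>p\<bar>)) * p + 1 / \<bar>p\<bar> * q) *\<^sub>R i"
        unfolding dmon_def 3(1) geg(3) x' y' using ii
        by (simp add: pw scaleR_add_left pderiv_pCons)
      also have "- (1 / (p * p) * (p * q / \<bar>p\<bar>)) * p + 1 / \<bar>p\<bar> * q = 0" using p by simp
      finally show ?thesis by simp
    qed
    thus ?thesis using 3 nu0 by (simp add: sk_def)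
  qed (use sg1 sg2 sk_mono[of 2 k] in auto)
qed

lemma mon_const: "x \<noteq> 0 \<Longrightarrow> mon 0 0 1 y x = 1"
  by (simp add: mon_def)

text \<open>Monotonicity of \<open>sk\<close> leaves only finitely many pairs \<open>(k, n)\<close>
  below the thresholds. Their eigenfunctions are the constant 1 if \<open>(k, n) = (0, 0)\<close>,
  \<open>a 0 + norm x powr al\<close> for \<open>(0, 1)\<close>, and
  \<open>norm x powr (sk 1 - 1) * (y \<bullet> x)\<close> for \<open>(1, 0)\<close>, so the free
  vector in \<open>low2\<close> is the axis.\<close>

lemma good_chain:
  assumes y: "norm y = 1"
  obtains a D where "a n = 1"
    "good (2 * l * (sk k + al * real n)) (\<lambda>x. \<Sum>i\<le>n. a i * mon 0 (sk k + al * real i) (geg k) y x) D"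
proof (rule eig_chain[OF y geg(1)[of k] sk_equation[of k] sg_al sk_base[OF y, of k], of n])
  fix a :: "nat \<Rightarrow> real" and D :: "'a \<Rightarrow> 'a"
  define lam where "lam = 2 * l * (sk k + al * real n)"
  define f where "f x = (\<Sum>i\<le>n. a i * mon 0 (sk k + al * real i) (geg k) y x)" for x
  assume a: "a n = 1" and e: "eig (2 * l * (sk k + al * real n)) (\<lambda>x. \<Sum>i\<le>n. a i * mon 0 (sk k + al * real i) (geg k) y x) D"
  have aln: "al * real n \<ge> 0" using al by simp
  have lam0: "lam \<ge> 0" using l aln sk_nonneg[of k] by (simp add: lam_def)
  have lamt: "lam < l * t \<longleftrightarrow> 2 * (sk k + al * real n) < t" for t
    using l by (simp add: lam_def mult.assoc[symmetric] mult.commute[of 2 l])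
  have k2: "t2 \<le> 2 * (sk k + al * real n)" if "k \<ge> 2"
    using sk_mono[OF that] t2_le(3) aln by argo
  have n1: "al \<le> al * real n" if "n \<ge> 1" using al that by simp
  have n2: "2 * al \<le> al * real n" if "n \<ge> 2" using mult_left_mono[of 2 "real n" al] al that by simp
  have "low1 f" if "lam < l * t1"
  proof -
    have lt: "2 * (sk k + al * real n) < t1" using that lamt by simp
    have "k = 0"
    proof (rule ccontr)
      assume "k \<noteq> 0"
      hence "sk 1 \<le> sk k" by (intro sk_mono) simp
      thus False using lt t1_le(2) aln by argo
    qed
    moreover have "n = 0"
    proof (rule ccontr)
      assume "n \<noteq> 0"
      hence "al \<le> al * real n" using n1 by simp
      thus False using lt t1_le(1) sk_nonneg[of k] by argo
    qed
    ultimately show ?thesis using a unfolding low1_def f_def by (simp add: sk_0 geg mon_const)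
  qed
  moreover have "low2 f" if "lam < l * t2"
  proof -
    have lt: "2 * (sk k + al * real n) < t2" using that lamt by simp
    have "k < 2" using k2 lt by (meson leI not_less)
    moreover have "n < 2"
    proof (rule ccontr)
      assume "\<not> n < 2"
      hence "2 * al \<le> al * real n" using n2 by simp
      thus False using lt t2_le(1) sk_nonneg[of k] by argo
    qed
    moreover have "\<not> (k = 1 \<and> n = 1)" using lt t2_le(2) by auto
    ultimately consider "k = 0" "n = 0" | "k = 0" "n = 1" | "k = 1" "n = 0" by linarith
    thus ?thesis
    proof cases
      case 1
      thus ?thesis using a unfolding low2_def f_def
        by (intro exI[of _ 1] exI[of _ 0]) (simp add: sk_0 geg mon_const)
    next
      case 2
      hence "radial" using lt t2_le(4) sk_0 by auto
      thus ?thesis using a 2 unfolding low2_def f_def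
        by (intro exI[of _ "a 0"] exI[of _ 1] exI[of _ 0]) (simp add: sk_0 geg mon_def)
    next
      case 3
      hence "axial" using lt t2_le(5) by auto
      moreover have "mon 0 (sk 1) (geg 1) y x = norm x powr (sk 1 - 1) * (y \<bullet> x)" if "x \<noteq> 0" for x
        using that unfolding mon_def geg(3) by (simp add: powr_diff inner_commute)
      ultimately show ?thesis using a 3 unfolding low2_def f_def
        by (intro exI[of _ 0] exI[of _ y]) simp
    qed
  qed
  ultimately have "good lam f D" using e lam0 unfolding good_def lam_def f_def by blast
  thus thesis using that[of a D] a unfolding lam_def f_def by blast
qed

text \<open>The leading coefficient of each chain is 1, so the triangular relation between powers
  and eigenfunctions can be inverted by induction.\<close>

lemma gspan_mon:
  assumes y: "norm y = 1"
  shows "gspan (mon 0 (sk k + al * real n) (geg k) y)"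
proof (induction n rule: less_induct)
  case (less n)
  obtain a D where a: "a n = 1"
    "good (2 * l * (sk k + al * real n)) (\<lambda>x. \<Sum>i\<le>n. a i * mon 0 (sk k + al * real i) (geg k) y x) D"
    by (rule good_chain[OF y])
  have "gspan (\<lambda>x. (\<Sum>i\<le>n. a i * mon 0 (sk k + al * real i) (geg k) y x)
      + (\<Sum>i<n. (- a i) * mon 0 (sk k + al * real i) (geg k) y x))"
    by (intro gspan_add gspan_good[OF a(2)] gspan_sum gspan_cmult less) simp
  thus ?case
    by (rule gspan_cong) (simp add: lessThan_Suc_atMost[symmetric] a(1) sum_negf)
qed

section \<open>The weighted square integrable functions and the closure of the span\<close>

definition L2 :: "('a \<Rightarrow> real) \<Rightarrow> bool" where
  "L2 f \<longleftrightarrow> f \<in> borel_measurable borel \<and> integrable lborel (\<lambda>x. (f x)\<^sup>2 * wmu x)"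

definition cl :: "('a \<Rightarrow> real) \<Rightarrow> bool" where
  "cl f \<longleftrightarrow> L2 f \<and> (\<forall>\<epsilon>>0. \<exists>h. gspan h \<and> L2 h \<and> (LINT x|lborel. (f x - h x)\<^sup>2 * wmu x) < \<epsilon>)"

lemma L2_bound:
  assumes "L2 g" "f \<in> borel_measurable borel" "\<And>x. x \<noteq> 0 \<Longrightarrow> \<bar>f x\<bar> \<le> \<bar>g x\<bar>"
  shows "L2 f"
  unfolding L2_def
proof
  have "integrable lborel (\<lambda>x. (g x)\<^sup>2 * wmu x)" using assms(1) by (simp add: L2_def)
  thus "integrable lborel (\<lambda>x. (f x)\<^sup>2 * wmu x)"
  proof (rule Bochner_Integration.integrable_bound)
    show "AE x in lborel. norm ((f x)\<^sup>2 * wmu x) \<le> norm ((g x)\<^sup>2 * wmu x)"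
      using AE_lborel_singleton[of "0::'a"]
    proof eventually_elim
      case (elim x)
      have "(f x)\<^sup>2 \<le> (g x)\<^sup>2" using assms(3)[OF elim] by (simp add: abs_le_square_iff)
      thus ?case by (simp add: abs_mult wmu_nonneg mult_right_mono)
    qed
  qed (use assms(2) in measurable)
qed (rule assms(2))

lemma L2_add:
  assumes "L2 f" "L2 g" shows "L2 (\<lambda>x. f x + g x)"
  unfolding L2_def
proof
  note [measurable] = assms[unfolded L2_def, THEN conjunct1]
  show m: "(\<lambda>x. f x + g x) \<in> borel_measurable borel" by measurable
  have "integrable lborel (\<lambda>x. 2 * ((f x)\<^sup>2 * wmu x) + 2 * ((g x)\<^sup>2 * wmu x))"
    using assms by (simp add: L2_def)
  thus "integrable lborel (\<lambda>x. (f x + g x)\<^sup>2 * wmu x)"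
  proof (rule Bochner_Integration.integrable_bound)
    show "AE x in lborel. norm ((f x + g x)\<^sup>2 * wmu x) \<le> norm (2 * ((f x)\<^sup>2 * wmu x) + 2 * ((g x)\<^sup>2 * wmu x))"
    proof (intro AE_I2)
      fix x
      have "(f x + g x)\<^sup>2 \<le> 2 * (f x)\<^sup>2 + 2 * (g x)\<^sup>2"
        using zero_le_power2[of "f x - g x"] by (simp add: power2_eq_square algebra_simps)
      from mult_right_mono[OF this wmu_nonneg[of x]]
      show "norm ((f x + g x)\<^sup>2 * wmu x) \<le> norm (2 * ((f x)\<^sup>2 * wmu x) + 2 * ((g x)\<^sup>2 * wmu x))"
        by (simp add: wmu_nonneg distrib_right)
    qed
  qed measurable
qed

lemma L2_cmult: "L2 f \<Longrightarrow> L2 (\<lambda>x. c * f x)"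
  unfolding L2_def by (auto simp: power_mult_distrib mult.assoc)

lemma L2_diff: "L2 f \<Longrightarrow> L2 g \<Longrightarrow> L2 (\<lambda>x. f x - g x)"
  using L2_add[of f "\<lambda>x. (-1) * g x"] L2_cmult[of g "-1"] by simp

lemma L2_triangle:
  assumes "L2 f" "L2 g"
  shows "(LINT x|lborel. (f x + g x)\<^sup>2 * wmu x) \<le> 2 * (LINT x|lborel. (f x)\<^sup>2 * wmu x) + 2 * (LINT x|lborel. (g x)\<^sup>2 * wmu x)"
proof -
  have "(LINT x|lborel. (f x + g x)\<^sup>2 * wmu x) \<le> (LINT x|lborel. 2 * ((f x)\<^sup>2 * wmu x) + 2 * ((g x)\<^sup>2 * wmu x))"
  proof (rule integral_mono)
    show "integrable lborel (\<lambda>x. (f x + g x)\<^sup>2 * wmu x)" using L2_add[OF assms] by (simp add: L2_def)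
    show "integrable lborel (\<lambda>x. 2 * ((f x)\<^sup>2 * wmu x) + 2 * ((g x)\<^sup>2 * wmu x))"
      using assms by (simp add: L2_def)
    fix x
    have "(f x + g x)\<^sup>2 \<le> 2 * (f x)\<^sup>2 + 2 * (g x)\<^sup>2"
      using zero_le_power2[of "f x - g x"] by (simp add: power2_eq_square algebra_simps)
    from mult_right_mono[OF this wmu_nonneg[of x]]
    show "(f x + g x)\<^sup>2 * wmu x \<le> 2 * ((f x)\<^sup>2 * wmu x) + 2 * ((g x)\<^sup>2 * wmu x)" by (simp add: distrib_right)
  qed
  also have "\<dots> = 2 * (LINT x|lborel. (f x)\<^sup>2 * wmu x) + 2 * (LINT x|lborel. (g x)\<^sup>2 * wmu x)"
    using assms by (simp add: L2_def)
  finally show ?thesis .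
qed

lemma cl_of_gspan: "gspan f \<Longrightarrow> L2 f \<Longrightarrow> cl f"
  unfolding cl_def by (auto intro!: exI[of _ f])

lemma cl_cmult:
  assumes "cl f" shows "cl (\<lambda>x. c * f x)"
proof (cases "c = 0")
  case True
  have "L2 (\<lambda>x. 0)" by (simp add: L2_def)
  thus ?thesis using True cl_of_gspan[OF gspan_zero] by simp
next
  case False
  show ?thesis unfolding cl_def
  proof (intro conjI allI impI)
    show "L2 (\<lambda>x. c * f x)" using assms by (simp add: cl_def L2_cmult)
    fix \<epsilon> :: real assume "\<epsilon> > 0"
    hence "\<epsilon> / c\<^sup>2 > 0" using False by simp
    then obtain h where h: "gspan h" "L2 h" "(LINT x|lborel. (f x - h x)\<^sup>2 * wmu x) < \<epsilon> / c\<^sup>2"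
      using assms unfolding cl_def by blast
    have "(LINT x|lborel. (c * f x - c * h x)\<^sup>2 * wmu x) = (LINT x|lborel. c\<^sup>2 * ((f x - h x)\<^sup>2 * wmu x))"
      by (simp add: right_diff_distrib[symmetric] power_mult_distrib mult.assoc)
    also have "\<dots> = c\<^sup>2 * (LINT x|lborel. (f x - h x)\<^sup>2 * wmu x)" by (rule integral_mult_right_zero)
    also have "\<dots> < \<epsilon>" using h(3) False by (simp add: pos_less_divide_eq mult.commute[of "c\<^sup>2"])
    finally show "\<exists>h. gspan h \<and> L2 h \<and> (LINT x|lborel. (c * f x - h x)\<^sup>2 * wmu x) < \<epsilon>"
      using h by (intro exI[of _ "\<lambda>x. c * h x"]) (auto intro: gspan_cmult L2_cmult)
  qed
qed

lemma cl_add: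
  assumes "cl f" "cl g" shows "cl (\<lambda>x. f x + g x)"
  unfolding cl_def
proof (intro conjI allI impI)
  show "L2 (\<lambda>x. f x + g x)" using assms by (simp add: cl_def L2_add)
  fix \<epsilon> :: real assume "\<epsilon> > 0"
  hence e: "\<epsilon> / 4 > 0" by simp
  obtain h where h: "gspan h" "L2 h" "(LINT x|lborel. (f x - h x)\<^sup>2 * wmu x) < \<epsilon> / 4"
    using assms(1) e unfolding cl_def by blast
  obtain k where k: "gspan k" "L2 k" "(LINT x|lborel. (g x - k x)\<^sup>2 * wmu x) < \<epsilon> / 4"
    using assms(2) e unfolding cl_def by blast
  have "(LINT x|lborel. (f x + g x - (h x + k x))\<^sup>2 * wmu x) = (LINT x|lborel. ((f x - h x) + (g x - k x))\<^sup>2 * wmu x)"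
    by (simp add: add_diff_add)
  also have "\<dots> \<le> 2 * (LINT x|lborel. (f x - h x)\<^sup>2 * wmu x) + 2 * (LINT x|lborel. (g x - k x)\<^sup>2 * wmu x)"
    using assms h k by (intro L2_triangle L2_diff) (auto simp: cl_def)
  also have "\<dots> < \<epsilon>" using h k by simp
  finally show "\<exists>h. gspan h \<and> L2 h \<and> (LINT x|lborel. (f x + g x - h x)\<^sup>2 * wmu x) < \<epsilon>"
    using h k by (intro exI[of _ "\<lambda>x. h x + k x"]) (auto intro: gspan_add L2_add)
qed

lemma cl_zero: "cl (\<lambda>x. 0)"
  by (rule cl_of_gspan[OF gspan_zero]) (simp add: L2_def)

lemma cl_sum:
  assumes "\<And>i. i \<in> I \<Longrightarrow> cl (f i)" shows "cl (\<lambda>x. \<Sum>i\<in>I. f i x)"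
  using assms by (induction I rule: infinite_finite_induct) (auto intro: cl_zero cl_add)

text \<open>The single closure principle behind all density steps: a pointwise limit with a square
  integrable majorant is a limit in the weighted norm, by dominated convergence with majorant
  \<open>4 * h\<^sup>2\<close>.\<close>

lemma cl_limit:
  assumes fn: "\<And>n. cl (fn n)" and h: "L2 h" and f: "f \<in> borel_measurable borel"
    and lim: "\<And>x. x \<noteq> 0 \<Longrightarrow> (\<lambda>n. fn n x) \<longlonglongrightarrow> f x"
    and bound: "\<And>n x. x \<noteq> 0 \<Longrightarrow> \<bar>fn n x\<bar> \<le> h x"
  shows "cl f"
proof -
  have fb: "\<bar>f x\<bar> \<le> h x" if "x \<noteq> 0" for x
    using bound[OF that] lim[OF that] by (intro tendsto_upperbound[OF tendsto_rabs]) auto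
  have Lf: "L2 f" by (rule L2_bound[OF h f]) (use fb in \<open>force intro: order.trans\<close>)
  have ae: "AE x in lborel. x \<noteq> (0::'a)" by (rule AE_lborel_singleton)
  have [measurable]: "fn n \<in> borel_measurable borel" for n using fn by (simp add: cl_def L2_def)
  note [measurable] = f
  have "(\<lambda>n. LINT x|lborel. (f x - fn n x)\<^sup>2 * wmu x) \<longlonglongrightarrow> (LINT x|(lborel :: 'a measure). (0::real))"
  proof (rule integral_dominated_convergence[where w="\<lambda>x. 4 * ((h x)\<^sup>2 * wmu x)"])
    show "integrable lborel (\<lambda>x. 4 * ((h x)\<^sup>2 * wmu x))" using h by (simp add: L2_def)
    show "AE x in lborel. (\<lambda>n. (f x - fn n x)\<^sup>2 * wmu x) \<longlonglongrightarrow> 0"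
      using ae
    proof eventually_elim
      case (elim x)
      have "(\<lambda>n. (f x - fn n x)\<^sup>2 * wmu x) \<longlonglongrightarrow> (f x - f x)\<^sup>2 * wmu x"
        by (intro tendsto_intros lim elim)
      thus ?case by simp
    qed
    show "AE x in lborel. norm ((f x - fn n x)\<^sup>2 * wmu x) \<le> 4 * ((h x)\<^sup>2 * wmu x)" for n
      using ae
    proof eventually_elim
      case (elim x)
      have "\<bar>f x - fn n x\<bar> \<le> \<bar>2 * h x\<bar>" using fb[OF elim] bound[OF elim, of n] by linarith
      hence "(f x - fn n x)\<^sup>2 \<le> (2 * h x)\<^sup>2" by (simp only: abs_le_square_iff)
      from mult_right_mono[OF this wmu_nonneg[of x]] show ?case by (simp add: wmu_nonneg power_mult_distrib)
    qed
  qed measurable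
  hence lim0: "(\<lambda>n. LINT x|lborel. (f x - fn n x)\<^sup>2 * wmu x) \<longlonglongrightarrow> 0" by simp
  show ?thesis unfolding cl_def
  proof (intro conjI allI impI Lf)
    fix \<epsilon> :: real assume "\<epsilon> > 0"
    hence e: "\<epsilon> / 4 > 0" by simp
    from order_tendstoD(2)[OF lim0 this] obtain n where n: "(LINT x|lborel. (f x - fn n x)\<^sup>2 * wmu x) < \<epsilon> / 4"
      by (auto simp: eventually_sequentially)
    obtain k where k: "gspan k" "L2 k" "(LINT x|lborel. (fn n x - k x)\<^sup>2 * wmu x) < \<epsilon> / 4"
      using fn[of n] e unfolding cl_def by blast
    have "(LINT x|lborel. (f x - k x)\<^sup>2 * wmu x) = (LINT x|lborel. ((f x - fn n x) + (fn n x - k x))\<^sup>2 * wmu x)" by simp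
    also have "\<dots> \<le> 2 * (LINT x|lborel. (f x - fn n x)\<^sup>2 * wmu x) + 2 * (LINT x|lborel. (fn n x - k x)\<^sup>2 * wmu x)"
      using fn[of n] k Lf by (intro L2_triangle L2_diff) (auto simp: cl_def)
    also have "\<dots> < \<epsilon>" using n k by simp
    finally show "\<exists>h. gspan h \<and> L2 h \<and> (LINT x|lborel. (f x - h x)\<^sup>2 * wmu x) < \<epsilon>" using k by blast
  qed
qed

text \<open>The weight decays like \<open>exp (- 2 * S)\<close>, so the square of
  \<open>exp (c * S)\<close> leaves the rate \<open>2 - 2 * c > 0\<close>.\<close>

lemma L2_growth:
  assumes "d \<ge> 0" "c < 1"
  shows "L2 (\<lambda>x. K * (norm x powr d * exp (c * S x)))"
proof -
  have "integrable lborel (\<lambda>x. (K * (norm x powr d * exp (c * S x)))\<^sup>2 * wmu x)"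
  proof (rule integrable_of_bound[where c="2 - 2 * c" and \<beta>="d + d + (al - 2 - 2 * b)" and K="K\<^sup>2"])
    show "- real DIM('a) < d + d + (al - 2 - 2 * b)" using assms al nu_nonneg by linarith
    fix x :: 'a
    have "(K * (norm x powr d * exp (c * S x)))\<^sup>2 * wmu x
       = K\<^sup>2 * (norm x powr (d + d + (al - 2 - 2 * b)) * exp (c * S x + c * S x + - 2 * S x))"
      unfolding wmu_def exp_add powr_add by (simp add: power2_eq_square mult_ac)
    also have "c * S x + c * S x + - 2 * S x = - (2 - 2 * c) * S x" by (simp add: algebra_simps)
    finally show "\<bar>(K * (norm x powr d * exp (c * S x)))\<^sup>2 * wmu x\<bar> \<le> K\<^sup>2 * (norm x powr (d + d + (al - 2 - 2 * b)) * exp (- (2 - 2 * c) * S x))"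
      by simp
  qed (use assms in auto)
  thus ?thesis by (simp add: L2_def)
qed

lemma L2_const: "L2 (\<lambda>x. K)"
  by (rule L2_bound[OF L2_growth[of 0 0 K]]) auto

text \<open>Expanding \<open>exp (- m * S / 2)\<close> at once would need the majorant
  \<open>exp (m * S / 2)\<close>, which is not square integrable for \<open>m >= 2\<close>. Hence
  one factor \<open>exp (- S / 2)\<close> is added per induction step, with the harmless majorant
  \<open>exp (S / 2)\<close>. The Taylor term of order \<open>j\<close> shifts \<open>i\<close> to
  \<open>i + j\<close>, so the induction hypothesis is required for all \<open>i\<close>.\<close>

lemma cl_mon_exp:
  assumes y: "norm y = 1"
  shows "cl (mon (real m / 2) (sk k + al * real i) (geg k) y)"
proof (induction m arbitrary: i)
  case 0
  have d: "sk k + al * real i \<ge> 0" using sk_nonneg al by simp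
  obtain K where K: "K > 0" "\<And>x. \<bar>mon 0 (sk k + al * real i) (geg k) y x\<bar> \<le> K * (norm x powr (sk k + al * real i) * exp (- 0 * S x))"
    "\<And>x. x \<noteq> 0 \<Longrightarrow> norm (dmon 0 (sk k + al * real i) (geg k) y x) \<le> K * (norm x powr (sk k + al * real i - 1) * exp (- 0 * S x) * (1 + \<bar>0\<bar> * S x))"
    using mon_bounds[OF y, of 0 "sk k + al * real i" "geg k"] by blast
  have "L2 (mon 0 (sk k + al * real i) (geg k) y)"
    by (rule L2_bound[OF L2_growth[OF d, of 0 K]]) (use K in auto)
  thus ?case using cl_of_gspan[OF gspan_mon[OF y, of k i]] by simp
next
  case (Suc m)
  define d where "d = sk k + al * real i"
  have d0: "d \<ge> 0" unfolding d_def using sk_nonneg al by simp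
  define c where "c = real m / 2"
  have c0: "c \<ge> 0" by (simp add: c_def)
  obtain K where K: "K > 0" "\<And>x. \<bar>mon c d (geg k) y x\<bar> \<le> K * (norm x powr d * exp (- c * S x))"
    "\<And>x. x \<noteq> 0 \<Longrightarrow> norm (dmon c d (geg k) y x) \<le> K * (norm x powr (d - 1) * exp (- c * S x) * (1 + \<bar>c\<bar> * S x))"
    using mon_bounds[OF y, of c d "geg k"] by blast
  define fn where "fn n x = mon c d (geg k) y x * (\<Sum>j<n. (- (S x / 2)) ^ j / fact j)" for n x
  have exp_term: "mon c d (geg k) y x * ((- (S x / 2)) ^ j / fact j)
     = (- l / (2 * al)) ^ j / fact j * mon (real m / 2) (sk k + al * real (i + j)) (geg k) y x" for x j
  proof (cases "x = 0")
    case False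
    have "norm x powr (sk k + al * real (i + j)) = norm x powr d * (norm x powr al) ^ j"
    proof -
      have "(norm x powr al) ^ j = norm x powr (al * real j)"
        using False by (simp add: powr_powr[symmetric] powr_realpow)
      thus ?thesis unfolding d_def by (simp add: powr_add[symmetric] algebra_simps)
    qed
    moreover have "(- (S x / 2)) ^ j = (- l / (2 * al)) ^ j * (norm x powr al) ^ j"
      unfolding power_mult_distrib[symmetric] by (simp add: S_def mult_ac)
    ultimately show ?thesis by (simp add: mon_def c_def)
  qed (simp add: mon_def)
  show ?case
  proof (rule cl_limit[where fn=fn and h="\<lambda>x. K * (norm x powr d * exp (1/2 * S x))"])
    show "cl (fn n)" for n
      unfolding fn_def sum_distrib_left exp_term by (intro cl_sum cl_cmult Suc)
    show "L2 (\<lambda>x. K * (norm x powr d * exp (1/2 * S x)))" by (rule L2_growth[OF d0]) simp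
    fix x :: 'a assume x: "x \<noteq> 0"
    have sx: "(\<lambda>j. (- (S x / 2)) ^ j / fact j) sums exp (- (S x / 2))"
      using exp_converges[of "- (S x / 2)"] unfolding real_scaleR_def divide_inverse by (simp only: mult.commute)
    have "(\<lambda>n. fn n x) \<longlonglongrightarrow> mon c d (geg k) y x * exp (- (S x / 2))"
      unfolding fn_def using sx unfolding sums_def by (intro tendsto_mult tendsto_const)
    moreover have "mon c d (geg k) y x * exp (- (S x / 2)) = mon (real (Suc m) / 2) (sk k + al * real i) (geg k) y x"
    proof -
      have "exp (- (c * S x)) * exp (- (S x / 2)) = exp (- (real (Suc m) / 2 * S x))"
        unfolding exp_add[symmetric] by (simp add: c_def field_simps)
      thus ?thesis by (simp add: mon_def d_def mult_ac)
    qed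
    ultimately show "(\<lambda>n. fn n x) \<longlonglongrightarrow> mon (real (Suc m) / 2) (sk k + al * real i) (geg k) y x" by simp
    fix n
    have "\<bar>\<Sum>j<n. (- (S x / 2)) ^ j / fact j\<bar> \<le> (\<Sum>j<n. (S x / 2) ^ j / fact j)"
      using S_nonneg[of x] by (intro order.trans[OF sum_abs] sum_mono) (auto simp: power_abs abs_mult)
    also have "\<dots> \<le> exp (S x / 2)"
    proof -
      have "(\<lambda>j. (S x / 2) ^ j / fact j) sums exp (S x / 2)"
        using exp_converges[of "S x / 2"] unfolding real_scaleR_def divide_inverse by (simp only: mult.commute)
      hence su: "summable (\<lambda>j. (S x / 2) ^ j / fact j)" "(\<Sum>j. (S x / 2) ^ j / fact j) = exp (S x / 2)"
        by (simp_all add: sums_iff)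
      show ?thesis unfolding su(2)[symmetric]
        by (rule sum_le_suminf[OF su(1)]) (use S_nonneg[of x] in auto)
    qed
    finally have "\<bar>\<Sum>j<n. (- (S x / 2)) ^ j / fact j\<bar> \<le> exp (S x / 2)" .
    moreover have "\<bar>mon c d (geg k) y x\<bar> \<le> K * norm x powr d"
    proof -
      have "exp (- c * S x) \<le> 1" using c0 S_nonneg[of x] by simp
      hence "K * (norm x powr d * exp (- c * S x)) \<le> K * (norm x powr d * 1)"
        using K(1) by (intro mult_left_mono) auto
      thus ?thesis using K(2)[of x] by simp
    qed
    ultimately have "\<bar>fn n x\<bar> \<le> (K * norm x powr d) * exp (S x / 2)"
      unfolding fn_def abs_mult using K(1) by (intro mult_mono) auto
    thus "\<bar>fn n x\<bar> \<le> K * (norm x powr d * exp (1/2 * S x))" by (simp add: mult.assoc)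
  qed measurable
qed

end

section \<open>Exponential sums, radial cutoffs and density of the span\<close>

text \<open>Products stay in this set because exponents add up, while every summand still depends on
  a single linear form; a product of zonal functions about different axes would in general no longer
  be zonal.\<close>

inductive_set exp_sums :: "('a::real_inner \<Rightarrow> real) set" where
  exp_sums_single: "(\<lambda>x. c * exp (x \<bullet> y)) \<in> exp_sums"
| exp_sums_plus: "f \<in> exp_sums \<Longrightarrow> g \<in> exp_sums \<Longrightarrow> (\<lambda>x. f x + g x) \<in> exp_sums"

lemma exp_sums_mult:
  assumes "f \<in> exp_sums" "g \<in> exp_sums"
  shows "(\<lambda>x. f x * g x) \<in> exp_sums"
  using assms(1)
proof induction
  case (exp_sums_single c y)
  from assms(2) show ?case
  proof induction
    case (exp_sums_single c' y')
    have "(\<lambda>x. c * exp (x \<bullet> y) * (c' * exp (x \<bullet> y'))) = (\<lambda>x. (c * c') * exp (x \<bullet> (y + y')))"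
      by (simp add: fun_eq_iff inner_add_right exp_add mult_ac)
    thus ?case using exp_sums.exp_sums_single[of "c * c'" "y + y'"] by simp
  next
    case (exp_sums_plus f g)
    thus ?case using exp_sums.exp_sums_plus[OF exp_sums_plus.IH] by (simp add: distrib_left)
  qed
next
  case (exp_sums_plus f g)
  thus ?case using exp_sums.exp_sums_plus[OF exp_sums_plus.IH] by (simp add: distrib_right)
qed

lemma exp_sums_dense:
  fixes f :: "'a::euclidean_space \<Rightarrow> real"
  assumes "compact K" "continuous_on K f" "e > 0"
  obtains g where "g \<in> exp_sums" "\<And>x. x \<in> K \<Longrightarrow> \<bar>f x - g x\<bar> < e"
proof -
  interpret function_ring_on exp_sums K
  proof
    show "continuous_on K g" if "g \<in> exp_sums" for g
      using that by induction (auto intro!: continuous_intros)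
    show "(\<lambda>_::'a. c) \<in> exp_sums" for c :: real using exp_sums_single[of c "0::'a"] by simp
    show "\<exists>f\<in>exp_sums. f x \<noteq> f y" if "x \<noteq> y" for x y :: 'a
    \<comment> \<open>Points are separated in the direction \<open>x - y\<close>: the two exponents
      differ by its squared norm.\<close>
    proof (rule bexI[OF _ exp_sums_single[of 1 "x - y"]])
      have "(x - y) \<bullet> (x - y) > 0" using that by simp
      thus "1 * exp (x \<bullet> (x - y)) \<noteq> 1 * exp (y \<bullet> (x - y))" by (simp add: inner_diff_left)
    qed
  qed (use assms exp_sums_plus exp_sums_mult in auto)
  show ?thesis using Stone_Weierstrass_basic[OF assms(2,3)] that by blast
qed

text \<open>A trapezoid in the variable \<open>z = exp (- S / 2)\<close>: zero within
  \<open>1 / n\<close> of both ends, one from distance \<open>2 / n\<close> on. The end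
  \<open>z = 0\<close> is infinity and \<open>z = 1\<close> is the origin.\<close>

definition edge_profile :: "nat \<Rightarrow> real \<Rightarrow> real" where
  "edge_profile n z = max 0 (min 1 (real n * min z (1 - z) - 1))"

lemma edge_profile_bounds: "0 \<le> edge_profile n z" "edge_profile n z \<le> 1" by (auto simp: edge_profile_def)

lemma edge_profile_nonzero:
  assumes "edge_profile n z \<noteq> 0" shows "1 / real n < z" "z < 1 - 1 / real n"
proof -
  have "real n * min z (1 - z) > 1" using assms by (auto simp: edge_profile_def)
  moreover from this have "n > 0" by (cases n) auto
  ultimately have "1 / real n < min z (1 - z)" by (metis pos_divide_less_eq mult.commute of_nat_0_less_iff)
  thus "1 / real n < z" "z < 1 - 1 / real n" by auto
qed

lemma edge_profile_tendsto:
  assumes "0 < z" "z < 1" shows "(\<lambda>n. edge_profile n z) \<longlonglongrightarrow> 1"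
proof (rule tendsto_eventually)
  have m: "min z (1 - z) > 0" using assms by simp
  obtain k :: nat where k: "2 / min z (1 - z) \<le> real k" using real_arch_simple by blast
  show "\<forall>\<^sub>F n in sequentially. edge_profile n z = 1"
    using eventually_ge_at_top[of k]
  proof eventually_elim
    case (elim n)
    hence "2 / min z (1 - z) \<le> real n" using k by linarith
    hence "2 \<le> real n * min z (1 - z)" using m by (simp add: pos_divide_le_eq)
    thus ?case by (simp add: edge_profile_def)
  qed
qed

context admissible_gap
begin

lemma mon_0_bound:
  assumes "norm y = 1"
  obtains K where "K > 0" "\<And>x. \<bar>mon 0 d P y x\<bar> \<le> K * norm x powr d"
proof -
  obtain K where K: "K > 0" "\<And>x. \<bar>mon 0 d P y x\<bar> \<le> K * (norm x powr d * exp (- 0 * S x))"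
    "\<And>x. x \<noteq> 0 \<Longrightarrow> norm (dmon 0 d P y x) \<le> K * (norm x powr (d - 1) * exp (- 0 * S x) * (1 + \<bar>0\<bar> * S x))"
    using mon_bounds[OF assms, of 0 d P] by blast
  have "\<bar>mon 0 d P y x\<bar> \<le> K * norm x powr d" for x using K(2)[of x] by simp
  thus ?thesis using that K(1) by blast
qed

text \<open>Multiplying by \<open>z ^ i\<close> turns \<open>mon 0\<close> into
  \<open>mon (i / 2)\<close>, so Weierstrass approximation in \<open>z\<close> yields all continuous
  radial profiles on the compactified half line.\<close>

lemma cl_profile:
  assumes y: "norm y = 1" and g: "continuous_on {0..1} g"
  shows "cl (\<lambda>x. g (exp (- S x / 2)) * mon 0 (sk k) (geg k) y x)"
proof -
  define z where "z x = exp (- S x / 2)" for x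
  have z: "z x \<in> {0..1}" for x using S_nonneg[of x] by (simp add: z_def)
  have [measurable]: "z \<in> borel_measurable borel" unfolding z_def[abs_def] by measurable
  have "\<exists>p. real_polynomial_function p \<and> (\<forall>t\<in>{0..1}. \<bar>g t - p t\<bar> < 1 / real (Suc n))" for n
    using Stone_Weierstrass_real_polynomial_function[OF compact_Icc g, of "1 / real (Suc n)"] by (metis of_nat_0_less_iff zero_less_Suc zero_less_divide_1_iff)
  then obtain p where p: "\<And>n. real_polynomial_function (p n)" "\<And>n t. t \<in> {0..1} \<Longrightarrow> \<bar>g t - p n t\<bar> < 1 / real (Suc n)"
    by metis
  have "compact (g ` {0..1})" by (intro compact_continuous_image g) auto
  then obtain B where B: "B > 0" "\<And>t. t \<in> {0..1} \<Longrightarrow> \<bar>g t\<bar> \<le> B"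
    using compact_imp_bounded bounded_pos by (metis imageI real_norm_def)
  obtain K where K: "K > 0" "\<And>x. \<bar>mon 0 (sk k) (geg k) y x\<bar> \<le> K * norm x powr sk k"
    using mon_0_bound[OF y] by blast
  show ?thesis
    unfolding z_def[symmetric]
  proof (rule cl_limit[where fn="\<lambda>n x. p n (z x) * mon 0 (sk k) (geg k) y x" and h="\<lambda>x. ((B + 1) * K) * (norm x powr sk k * exp (0 * S x))"])
    fix n
    obtain a m where am: "p n = (\<lambda>t. \<Sum>i\<le>m. a i * t ^ i)"
      using p(1)[of n] unfolding real_polynomial_function_iff_sum by blast
    have "p n (z x) * mon 0 (sk k) (geg k) y x = (\<Sum>i\<le>m. a i * mon (real i / 2) (sk k + al * real 0) (geg k) y x)" for x
      unfolding am sum_distrib_right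
      by (intro sum.cong refl) (simp add: mon_def z_def exp_of_nat_mult[symmetric] mult_ac)
    thus "cl (\<lambda>x. p n (z x) * mon 0 (sk k) (geg k) y x)"
      by (simp only:) (intro cl_sum cl_cmult cl_mon_exp y)
  next
    show "L2 (\<lambda>x. ((B + 1) * K) * (norm x powr sk k * exp (0 * S x)))" by (intro L2_growth sk_nonneg) simp
    \<comment> \<open>Continuity of \<open>g\<close> is known only on the unit interval; clamping
      the argument gives a measurable function on the line without changing the values at
      \<open>z x\<close>.\<close>
    have "continuous_on UNIV (\<lambda>t. g (max 0 (min 1 t)))"
      by (rule continuous_on_compose2[OF g]) (auto intro!: continuous_intros)
    hence [measurable]: "(\<lambda>t. g (max 0 (min 1 t))) \<in> borel_measurable borel" by (rule borel_measurable_continuous_onI)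
    have "(\<lambda>x. g (max 0 (min 1 (z x))) * mon 0 (sk k) (geg k) y x) \<in> borel_measurable borel"
      by (intro borel_measurable_times measurable_compose[where f=z and g="\<lambda>t. g (max 0 (min 1 t))"]) measurable
    moreover have "max 0 (min 1 (z x)) = z x" for x using z[of x] by simp
    ultimately show "(\<lambda>x. g (z x) * mon 0 (sk k) (geg k) y x) \<in> borel_measurable borel" by simp
  next
    fix x :: 'a assume x: "x \<noteq> 0"
    have "(\<lambda>n. p n (z x)) \<longlonglongrightarrow> g (z x)"
    proof (rule LIM_zero_cancel, rule Lim_null_comparison)
      show "\<forall>\<^sub>F n in sequentially. norm (p n (z x) - g (z x)) \<le> inverse (real (Suc n))"
        using p(2)[OF z] by (intro always_eventually allI) (simp add: abs_minus_commute less_imp_le inverse_eq_divide)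
      show "(\<lambda>n. inverse (real (Suc n))) \<longlonglongrightarrow> 0" by (rule LIMSEQ_inverse_real_of_nat)
    qed
    thus "(\<lambda>n. p n (z x) * mon 0 (sk k) (geg k) y x) \<longlonglongrightarrow> g (z x) * mon 0 (sk k) (geg k) y x"
      by (intro tendsto_intros)
    fix n
    have "1 / real (Suc n) \<le> 1" by simp
    hence "\<bar>p n (z x)\<bar> \<le> B + 1" using p(2)[OF z, of x n] B(2)[OF z, of x] by linarith
    hence "\<bar>p n (z x)\<bar> * \<bar>mon 0 (sk k) (geg k) y x\<bar> \<le> (B + 1) * (K * norm x powr sk k)"
      using K(2)[of x] B(1) by (intro mult_mono) auto
    thus "\<bar>p n (z x) * mon 0 (sk k) (geg k) y x\<bar> \<le> ((B + 1) * K) * (norm x powr sk k * exp (0 * S x))"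
      by (simp add: abs_mult mult.assoc)
  qed
qed

definition cutoff :: "nat \<Rightarrow> 'a \<Rightarrow> real" where "cutoff n x = edge_profile n (exp (- S x / 2))"

lemma cutoff_measurable [measurable]: "cutoff n \<in> borel_measurable borel"
  unfolding cutoff_def[abs_def] edge_profile_def by measurable

lemma cutoff_support:
  obtains R where "R > 0" "\<And>x. cutoff n x \<noteq> 0 \<Longrightarrow> norm x \<le> R"
proof -
  define T where "T = \<bar>2 * al * ln (real n) / l\<bar>"
  show ?thesis
  proof (rule that[of "T powr (1 / al) + 1"])
    show "T powr (1 / al) + 1 > 0" by (simp add: add_nonneg_pos)
    fix x assume "cutoff n x \<noteq> 0"
    hence nz: "edge_profile n (exp (- S x / 2)) \<noteq> 0" by (simp add: cutoff_def)
    have n: "n > 0" using nz by (cases n) (auto simp: edge_profile_def)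
    have "ln (1 / real n) < - S x / 2" using edge_profile_nonzero(1)[OF nz] n by (metis exp_gt_zero ln_exp ln_less_cancel_iff of_nat_0_less_iff zero_less_divide_1_iff)
    hence "S x < 2 * ln (real n)" using n by (simp add: ln_div)
    hence "norm x powr al < 2 * al * ln (real n) / l" using al l by (simp add: S_def field_simps)
    hence "norm x powr al \<le> T" unfolding T_def by linarith
    hence "(norm x powr al) powr (1 / al) \<le> T powr (1 / al)" using al by (intro powr_mono2) auto
    moreover have "(norm x powr al) powr (1 / al) = norm x" using al by (simp add: powr_powr)
    ultimately show "norm x \<le> T powr (1 / al) + 1" by simp
  qed
qed

text \<open>Writing \<open>(x \<bullet> y) ^ m\<close> as \<open>norm x ^ m\<close> times a power of
  the cosine and expanding the latter in Gegenbauer polynomials leaves the radial factors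
  \<open>norm x powr (m - sk j)\<close>. These may be singular at the origin and unbounded at
  infinity, but become continuous in \<open>z\<close> after the cutoff.\<close>

lemma cl_cutoff_power:
  assumes y: "norm y = 1" and n: "n \<ge> 3"
  shows "cl (\<lambda>x. cutoff n x * (x \<bullet> y) ^ m)"
proof -
  obtain c where c: "\<And>t. t ^ m = (\<Sum>j\<le>m. c j * poly (geg j) t)" using geg(4)[of m] by blast
  \<comment> \<open>The clamp keeps the logarithm and the powers continuous and changes nothing
    where the cutoff is nonzero. The function \<open>rr\<close> inverts
    \<open>z = exp (- S / 2)\<close>, that is, it solves
    \<open>l * r powr al / al = - 2 * ln z\<close> for the radius.\<close>
  define zc where "zc z = max (1 / real n) (min z (1 - 1 / real n))" for z
  define rr where "rr z = (- 2 * al * ln (zc z) / l) powr (1 / al)" for z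
  define g where "g j z = edge_profile n z * rr z powr (real m - sk j)" for j z
  \<comment> \<open>Here \<open>n >= 3\<close> enters: the clamping interval must not
    degenerate.\<close>
  have n': "0 < 1 / real n" "1 / real n < 1 - 1 / real n" using n by (auto simp: field_simps)
  have zc: "0 < zc z" "zc z < 1" for z using n' unfolding zc_def by linarith+
  have lnz: "- 2 * al * ln (zc z) / l > 0" for z
  proof -
    have "ln (zc z) < 0" using zc[of z] by simp
    hence pos: "2 * al * (- ln (zc z)) / l > 0" using al l by (intro divide_pos_pos mult_pos_pos) auto
    have "- 2 * al * ln (zc z) / l = 2 * al * (- ln (zc z)) / l" by simp
    thus ?thesis using pos by (simp only:)
  qed
  have rr0: "rr z > 0" for z using lnz[of z] unfolding rr_def powr_gt_zero by linarith
  have "continuous_on {0..1} zc" unfolding zc_def[abs_def] by (intro continuous_intros)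
  moreover have nz: "\<forall>z\<in>{0..1}. zc z \<noteq> 0" "\<forall>z\<in>{0..1}. l \<noteq> 0" "\<forall>z\<in>{0..1}. - 2 * al * ln (zc z) / l \<noteq> 0"
    "\<forall>z\<in>{0..1}. rr z \<noteq> 0"
    using zc(1) l lnz rr0 by (metis less_irrefl)+
  ultimately have "continuous_on {0..1} rr" unfolding rr_def[abs_def]
    by (intro continuous_on_powr continuous_on_divide continuous_on_mult continuous_on_ln continuous_on_const nz)
  moreover have "continuous_on {0..1} (edge_profile n)" unfolding edge_profile_def[abs_def] by (intro continuous_intros)
  ultimately have g: "continuous_on {0..1} (g j)" for j unfolding g_def[abs_def]
    by (intro continuous_on_powr continuous_on_mult continuous_on_const nz)
  have eq: "cutoff n x * (x \<bullet> y) ^ m = (\<Sum>j\<le>m. c j * (g j (exp (- S x / 2)) * mon 0 (sk j) (geg j) y x))" for x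
  proof (cases "cutoff n x = 0")
    case True
    thus ?thesis by (simp add: g_def cutoff_def)
  next
    case False
    hence nz: "edge_profile n (exp (- S x / 2)) \<noteq> 0" by (simp add: cutoff_def)
    have x: "x \<noteq> 0" using nz n by (auto simp: S_def edge_profile_def)
    have "zc (exp (- S x / 2)) = exp (- S x / 2)" using edge_profile_nonzero[OF nz] by (simp add: zc_def)
    hence "rr (exp (- S x / 2)) = (norm x powr al) powr (1 / al)"
      using al l by (simp add: rr_def S_def)
    hence rx: "rr (exp (- S x / 2)) = norm x" using al by (simp add: powr_powr)
    have "(x \<bullet> y) ^ m = norm x ^ m * (x \<bullet> y / norm x) ^ m" using x by (simp add: power_divide)
    also have "\<dots> = (\<Sum>j\<le>m. c j * (norm x ^ m * poly (geg j) (x \<bullet> y / norm x)))"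
      unfolding c by (simp add: sum_distrib_left mult_ac)
    finally have xy: "(x \<bullet> y) ^ m = (\<Sum>j\<le>m. c j * (norm x ^ m * poly (geg j) (x \<bullet> y / norm x)))" .
    have pw: "norm x ^ m = norm x powr (real m - sk j) * norm x powr sk j" for j
      using x by (simp add: powr_add[symmetric] powr_realpow)
    have "g j (exp (- S x / 2)) * mon 0 (sk j) (geg j) y x = cutoff n x * (norm x ^ m * poly (geg j) (x \<bullet> y / norm x))" for j
      unfolding g_def rx mon_def cutoff_def pw[of j] by simp
    thus ?thesis unfolding xy by (simp add: sum_distrib_left mult_ac)
  qed
  show ?thesis unfolding eq by (intro cl_sum cl_cmult cl_profile y g)
qed

text \<open>For \<open>al < 1\<close> and \<open>y \<noteq> 0\<close> the exponential itself is not
  square integrable for the weight. The bounded support of the cutoff bounds all Taylor sums by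
  \<open>exp (R * norm y)\<close>.\<close>

lemma cl_cutoff_exp:
  assumes n: "n \<ge> 3"
  shows "cl (\<lambda>x. cutoff n x * exp (x \<bullet> y))"
proof -
  have pw: "cl (\<lambda>x. cutoff n x * (x \<bullet> y) ^ m)" for m
  proof (cases "y = 0")
    case True
    obtain e :: 'a where e: "norm e = 1" using norm_Basis nonempty_Basis by blast
    show ?thesis
    proof (cases "m = 0")
      case True thus ?thesis using cl_cutoff_power[OF e n, of 0] by simp
    next
      case False thus ?thesis using True cl_zero by (simp add: zero_power)
    qed
  next
    case False
    have "cl (\<lambda>x. norm y ^ m * (cutoff n x * (x \<bullet> (y /\<^sub>R norm y)) ^ m))"
      by (rule cl_cmult[OF cl_cutoff_power[OF _ n]]) (use False in simp)
    moreover have "norm y ^ m * (cutoff n x * (x \<bullet> (y /\<^sub>R norm y)) ^ m) = cutoff n x * (x \<bullet> y) ^ m" for x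
      using False by (simp add: power_mult_distrib power_inverse)
    ultimately show ?thesis by (simp only:)
  qed
  obtain R where R: "R > 0" "\<And>x. cutoff n x \<noteq> 0 \<Longrightarrow> norm x \<le> R" using cutoff_support by blast
  show ?thesis
  proof (rule cl_limit[where fn="\<lambda>M x. cutoff n x * (\<Sum>m<M. (x \<bullet> y) ^ m / fact m)" and h="\<lambda>x. exp (R * norm y)"])
    have "cutoff n x * (\<Sum>m<M. (x \<bullet> y) ^ m / fact m) = (\<Sum>m<M. (1 / fact m) * (cutoff n x * (x \<bullet> y) ^ m))" for M x
      by (simp add: sum_distrib_left)
    thus "cl (\<lambda>x. cutoff n x * (\<Sum>m<M. (x \<bullet> y) ^ m / fact m))" for M
      by (simp only:) (intro cl_sum cl_cmult pw)
    show "L2 (\<lambda>x. exp (R * norm y))" by (rule L2_const)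
    fix x :: 'a
    have su: "(\<lambda>m. t ^ m / fact m) sums exp t" for t :: real
      using exp_converges[of t] unfolding real_scaleR_def divide_inverse by (simp only: mult.commute)
    show "(\<lambda>M. cutoff n x * (\<Sum>m<M. (x \<bullet> y) ^ m / fact m)) \<longlonglongrightarrow> cutoff n x * exp (x \<bullet> y)"
      using su[of "x \<bullet> y"] unfolding sums_def by (intro tendsto_mult tendsto_const)
    fix M
    show "\<bar>cutoff n x * (\<Sum>m<M. (x \<bullet> y) ^ m / fact m)\<bar> \<le> exp (R * norm y)"
    proof (cases "cutoff n x = 0")
      case False
      have "\<bar>\<Sum>m<M. (x \<bullet> y) ^ m / fact m\<bar> \<le> (\<Sum>m<M. \<bar>x \<bullet> y\<bar> ^ m / fact m)"
        by (intro order.trans[OF sum_abs] sum_mono) (simp add: power_abs)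
      also have "\<dots> \<le> (\<Sum>m. \<bar>x \<bullet> y\<bar> ^ m / fact m)"
        by (rule sum_le_suminf[OF sums_summable[OF su]]) auto
      also have "\<dots> = exp \<bar>x \<bullet> y\<bar>" by (rule sums_unique[OF su, symmetric])
      also have "\<dots> \<le> exp (R * norm y)"
      proof -
        have "\<bar>x \<bullet> y\<bar> \<le> norm x * norm y" by (rule Cauchy_Schwarz_ineq2)
        also have "\<dots> \<le> R * norm y" by (intro mult_right_mono R(2) False) simp
        finally show ?thesis by simp
      qed
      finally have "\<bar>\<Sum>m<M. (x \<bullet> y) ^ m / fact m\<bar> \<le> exp (R * norm y)" .
      moreover have "\<bar>cutoff n x\<bar> \<le> 1" using edge_profile_bounds[of n "exp (- S x / 2)"] by (simp add: cutoff_def)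
      ultimately have "\<bar>cutoff n x\<bar> * \<bar>\<Sum>m<M. (x \<bullet> y) ^ m / fact m\<bar> \<le> 1 * exp (R * norm y)"
        by (intro mult_mono) auto
      thus ?thesis by (simp add: abs_mult)
    qed simp
  qed measurable
qed

text \<open>Two limits: for a fixed cutoff, exponential sums approximate \<open>F\<close> uniformly
  on its support; then the cutoffs tend to 1 off the origin. The shift \<open>n + 3\<close> respects
  the restriction on the index of the cutoff.\<close>

lemma cl_bounded_continuous:
  assumes F: "continuous_on UNIV F" and B: "\<And>x. \<bar>F x\<bar> \<le> B"
  shows "cl F"
proof -
  have [measurable]: "F \<in> borel_measurable borel" using F by (rule borel_measurable_continuous_onI)
  have B0: "B \<ge> 0" using B[of 0] by linarith
  have cutF: "cl (\<lambda>x. cutoff n x * F x)" if n: "n \<ge> 3" for n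
  proof -
    obtain R where R: "R > 0" "\<And>x. cutoff n x \<noteq> 0 \<Longrightarrow> norm x \<le> R" using cutoff_support by blast
    have "\<exists>g\<in>exp_sums. \<forall>x\<in>cball 0 R. \<bar>F x - g x\<bar> < 1 / real (Suc m)" for m
      using exp_sums_dense[OF compact_cball continuous_on_subset[OF F], of 0 R "1 / real (Suc m)"]
      by (metis of_nat_0_less_iff subset_UNIV zero_less_Suc zero_less_divide_1_iff)
    then obtain g where g: "\<And>m. g m \<in> exp_sums" "\<And>m x. norm x \<le> R \<Longrightarrow> \<bar>F x - g m x\<bar> < 1 / real (Suc m)"
      by (metis mem_cball_0)
    have cg: "cl (\<lambda>x. cutoff n x * f x)" if "f \<in> exp_sums" for f
      using that
    proof induction
      case (exp_sums_single c y)
      thus ?case using cl_cmult[OF cl_cutoff_exp[OF n], of c y] by (simp add: mult_ac)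
    next
      case (exp_sums_plus f g)
      thus ?case using cl_add[OF exp_sums_plus.IH] by (simp add: distrib_left)
    qed
    show ?thesis
    proof (rule cl_limit[where fn="\<lambda>m x. cutoff n x * g m x" and h="\<lambda>x. B + 1"])
      show "cl (\<lambda>x. cutoff n x * g m x)" for m by (rule cg[OF g(1)])
      show "L2 (\<lambda>x. B + 1)" by (rule L2_const)
      fix x :: 'a
      show "(\<lambda>m. cutoff n x * g m x) \<longlonglongrightarrow> cutoff n x * F x"
      proof (cases "cutoff n x = 0")
        case False
        have "(\<lambda>m. g m x) \<longlonglongrightarrow> F x"
        proof (rule LIM_zero_cancel, rule Lim_null_comparison)
          show "\<forall>\<^sub>F m in sequentially. norm (g m x - F x) \<le> inverse (real (Suc m))"
            using g(2)[OF R(2)[OF False]] by (intro always_eventually allI) (simp add: abs_minus_commute less_imp_le inverse_eq_divide)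
          show "(\<lambda>n. inverse (real (Suc n))) \<longlonglongrightarrow> 0" by (rule LIMSEQ_inverse_real_of_nat)
        qed
        thus ?thesis by (intro tendsto_intros)
      qed simp
      fix m
      show "\<bar>cutoff n x * g m x\<bar> \<le> B + 1"
      proof (cases "cutoff n x = 0")
        case False
        have "1 / real (Suc m) \<le> 1" by simp
        hence "\<bar>g m x\<bar> \<le> B + 1" using g(2)[OF R(2)[OF False], of m] B[of x] by linarith
        moreover have "\<bar>cutoff n x\<bar> \<le> 1" using edge_profile_bounds[of n "exp (- S x / 2)"] by (simp add: cutoff_def)
        ultimately have "\<bar>cutoff n x\<bar> * \<bar>g m x\<bar> \<le> 1 * (B + 1)" by (intro mult_mono) auto
        thus ?thesis by (simp add: abs_mult)
      qed (use B0 in simp)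
    qed measurable
  qed
  show ?thesis
  proof (rule cl_limit[where fn="\<lambda>n x. cutoff (n + 3) x * F x" and h="\<lambda>x. B"])
    show "cl (\<lambda>x. cutoff (n + 3) x * F x)" for n by (rule cutF) simp
    show "L2 (\<lambda>x. B)" by (rule L2_const)
    fix x :: 'a assume x: "x \<noteq> 0"
    have "S x > 0" using x l al by (simp add: S_def)
    hence "(\<lambda>n. cutoff (n + 3) x) \<longlonglongrightarrow> 1"
      unfolding cutoff_def by (intro LIMSEQ_ignore_initial_segment edge_profile_tendsto) auto
    from tendsto_mult[OF this tendsto_const[of "F x"]]
    show "(\<lambda>n. cutoff (n + 3) x * F x) \<longlonglongrightarrow> F x" by simp
    fix n
    have "\<bar>cutoff (n + 3) x\<bar> \<le> 1" using edge_profile_bounds[of "n + 3" "exp (- S x / 2)"] by (simp add: cutoff_def)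
    from mult_mono[OF this B[of x]] show "\<bar>cutoff (n + 3) x * F x\<bar> \<le> B" by (simp add: abs_mult)
  qed measurable
qed

theorem spectral_gap_inequality:
  assumes v: "cls v Dv" and cont: "continuous_on UNIV v" and B: "\<And>x. \<bar>v x\<bar> \<le> B"
    and I1: "\<And>f. low1 f \<Longrightarrow> I1 \<le> (LINT x|lborel. (v x - f x)\<^sup>2 * wmu x)"
    and I2: "\<And>f. low2 f \<Longrightarrow> I2 \<le> (LINT x|lborel. (v x - f x)\<^sup>2 * wmu x)"
  shows "l * t1 * I1 + l * (t2 - t1) * I2 \<le> (LINT x|lborel. (Dv x \<bullet> Dv x) * wm x)"
proof (rule field_le_epsilon)
  fix \<epsilon> :: real assume e: "\<epsilon> > 0"
  have lt: "l * t2 \<ge> 0" using l t by simp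
  \<comment> \<open>The summand 1 keeps the denominator positive when \<open>t2 = 0\<close>.\<close>
  hence "\<epsilon> / (l * t2 + 1) > 0" using e by (intro divide_pos_pos) auto
  then obtain w where w: "gspan w" "(LINT x|lborel. (v x - w x)\<^sup>2 * wmu x) < \<epsilon> / (l * t2 + 1)"
    using cl_bounded_continuous[OF cont B] unfolding cl_def by blast
  have "l * t2 * (LINT x|lborel. (v x - w x)\<^sup>2 * wmu x) \<le> l * t2 * (\<epsilon> / (l * t2 + 1))"
    using w(2) lt by (intro mult_left_mono) auto
  also have "\<dots> \<le> \<epsilon>" using lt e by (simp add: divide_le_eq algebra_simps)
  finally show "l * t1 * I1 + l * (t2 - t1) * I2 \<le> (LINT x|lborel. (Dv x \<bullet> Dv x) * wm x) + \<epsilon>"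
    using spectral_gap_approx[OF v w(1) I1 I2] by linarith
qed

end

subsection \<open>The deficits\<close>

text \<open>On the ball of radius \<open>R\<close> the factor \<open>exp R * exp (- norm x)\<close>
  is at least 1, so a power times an exponential is a majorant.\<close>

lemma integrable_powr_compact_support:
  fixes h :: "'a::euclidean_space \<Rightarrow> real"
  assumes h: "h \<in> borel_measurable borel" and \<beta>: "\<beta> > - real DIM('a)"
    and bound: "\<And>x. x \<noteq> 0 \<Longrightarrow> \<bar>h x\<bar> \<le> M * norm x powr \<beta>" and supp: "\<And>x. norm x > R \<Longrightarrow> h x = 0"
  shows "integrable lborel h"
proof (rule Bochner_Integration.integrable_bound)
  show "integrable lborel (\<lambda>x::'a. M * exp R * (norm x powr \<beta> * exp (- (1 * norm x powr 1))))"
    using \<beta> by (intro integrable_mult_right integrable_powr_exp) auto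
  show "AE x in lborel. norm (h x) \<le> norm (M * exp R * (norm x powr \<beta> * exp (- (1 * norm x powr 1))))"
    using AE_lborel_singleton[of "0::'a"]
  proof eventually_elim
    case (elim x)
    show ?case
    proof (cases "norm x \<le> R")
      case True
      have b: "\<bar>h x\<bar> \<le> M * norm x powr \<beta>" by (rule bound[OF elim])
      hence m: "M * norm x powr \<beta> \<ge> 0" by linarith
      have "1 \<le> exp R * exp (- norm x)" using True by (simp add: exp_add[symmetric])
      from mult_left_mono[OF this m] b
      have "\<bar>h x\<bar> \<le> M * exp R * (norm x powr \<beta> * exp (- norm x))" by (simp add: mult_ac)
      thus ?thesis by simp
    qed (use supp in auto)
  qed
qed (use h in simp)

text \<open>Continuity of the gradient comes from one order more: the first partial derivatives are
  themselves differentiable.\<close>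

lemma test_function_grad:
  fixes u :: "real^'n \<Rightarrow> real"
  assumes "test_function u"
  shows "(u has_derivative (\<lambda>h. grad u x \<bullet> h)) (at x)" and "continuous_on UNIV (grad u)"
proof -
  have d: "iter_pderiv is u differentiable (at x)" for "is" x
    using assms by (simp add: test_function_def)
  have gr: "grad u x = (\<chi> i. iter_pderiv [i] u x) \<and> (u has_derivative (\<lambda>h. grad u x \<bullet> h)) (at x)" for x
  proof -
    define f where "f = frechet_derivative u (at x)"
    have "u differentiable (at x)" using d[of "[]" x] by simp
    hence f: "(u has_derivative f) (at x)" unfolding f_def by (simp add: frechet_derivative_works)
    have lf: "linear f" using f by (simp add: has_derivative_linear)
    define D where "D = adjoint f 1"
    have fD: "f h = h \<bullet> D" for h using adjoint_works[OF lf, of h 1] by (simp add: D_def)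
    have "(\<lambda>h. h \<bullet> D) = f" using fD by (simp add: fun_eq_iff)
    hence g: "GDERIV u x :> D" unfolding gderiv_def using f by simp
    have "grad u x = D" unfolding grad_def
    proof (rule the_equality)
      show "GDERIV u x :> D" by (rule g)
      fix D' assume "GDERIV u x :> D'"
      hence "(u has_derivative (\<lambda>h. h \<bullet> D')) (at x)" by (simp add: gderiv_def)
      hence "(\<lambda>h. h \<bullet> D') = f" using f by (rule has_derivative_unique)
      hence "h \<bullet> D' = h \<bullet> D" for h using fD by metis
      thus "D' = D" using vector_eq_ldot[of D' D] by blast
    qed
    moreover have "D = (\<chi> i. iter_pderiv [i] u x)"
      using fD by (simp add: vec_eq_iff f_def inner_axis' )
    moreover have "(\<lambda>h. D \<bullet> h) = f" using fD by (simp add: fun_eq_iff inner_commute)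
    ultimately show ?thesis using f by simp
  qed
  show "(u has_derivative (\<lambda>h. grad u x \<bullet> h)) (at x)" using gr by blast
  have "grad u = (\<lambda>x. \<chi> i. iter_pderiv [i] u x)" using gr by (intro ext) blast
  moreover have "continuous_on UNIV (iter_pderiv [i] u)" for i
    using d by (intro differentiable_imp_continuous_on) (simp add: differentiable_on_def differentiable_at_withinI del: iter_pderiv.simps)
  ultimately show "continuous_on UNIV (grad u)" by (auto intro!: continuous_on_vec_lambda simp del: iter_pderiv.simps)
qed

lemma test_function_support:
  fixes u :: "real^'n \<Rightarrow> real"
  assumes "test_function u"
  obtains R M where "R > 0" "\<And>x. norm x > R \<Longrightarrow> u x = 0" "\<And>x. norm x > R \<Longrightarrow> grad u x = 0"
    "M > 0" "\<And>x. \<bar>u x\<bar> \<le> M" "\<And>x. norm (grad u x) \<le> M"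
proof -
  have "bounded (closure {x. u x \<noteq> 0})" using assms by (auto simp: test_function_def intro: compact_imp_bounded)
  then obtain R where R: "R > 0" "\<And>x. x \<in> closure {x. u x \<noteq> 0} \<Longrightarrow> norm x \<le> R" using bounded_pos by metis
  have u0: "u x = 0" if "norm x > R" for x
    using R(2)[of x] closure_subset[of "{x. u x \<noteq> 0}"] that by fastforce
  have g0: "grad u x = 0" if "norm x > R" for x
  proof -
    have "((\<lambda>_. 0) has_derivative (\<lambda>h. grad u x \<bullet> h)) (at x)"
    proof (rule has_derivative_transform_within_open[OF test_function_grad(1)[OF assms]])
      show "open {x :: real^'n. norm x > R}" by (intro open_Collect_less continuous_intros)
    qed (use that u0 in auto)
    from has_derivative_unique[OF this has_derivative_const]
    have "grad u x \<bullet> grad u x = 0" by metis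
    thus ?thesis by simp
  qed
  have cu: "continuous_on UNIV u"
    using test_function_grad(1)[OF assms] by (auto intro!: continuous_at_imp_continuous_on dest: has_derivative_continuous)
  have "compact (u ` cball 0 R)" "compact (grad u ` cball 0 R)"
    by (intro compact_continuous_image continuous_on_subset[OF cu] continuous_on_subset[OF test_function_grad(2)[OF assms]]; simp)+
  then obtain M1 M2 where M: "M1 > 0" "\<And>y. y \<in> u ` cball 0 R \<Longrightarrow> norm y \<le> M1" "M2 > 0" "\<And>y. y \<in> grad u ` cball 0 R \<Longrightarrow> norm y \<le> M2"
    by (metis bounded_pos compact_imp_bounded)
  show ?thesis
  proof (rule that[OF R(1) u0 g0, of "M1 + M2"])
    fix x
    show "\<bar>u x\<bar> \<le> M1 + M2" using M u0[of x] by (cases "norm x \<le> R") force+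
    show "norm (grad u x) \<le> M1 + M2" using M g0[of x] by (cases "norm x \<le> R") force+
  qed (use M in auto)
qed

lemma wnorm2_nonneg: "0 \<le> wnorm2 a b f"
  unfolding wnorm2_def by (intro integral_nonneg_AE AE_I2) auto

context
  fixes a b :: real and u :: "real^'n \<Rightarrow> real"
  assumes ab: "b + 1 - a > 0" and bN: "b \<le> (real CARD('n) - 2) / 2" and tu: "test_function u"
begin

definition gradient_energy where "gradient_energy = (LINT x|lborel. (norm (grad u x))\<^sup>2 / norm x powr (2 * b))"

definition potential_energy where "potential_energy = (LINT x|lborel. \<bar>u x\<bar>\<^sup>2 / norm x powr (2 * a))"

definition mass where "mass = (LINT x|lborel. \<bar>u x\<bar>\<^sup>2 / norm x powr (a + b + 1))"

text \<open>With \<open>al = 1 + b - a > 0\<close> and \<open>nu = N - 2 - 2 * b >= 0\<close> the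
  two entries of the maximum are half of \<open>nu + al\<close> and half of
  \<open>\<bar>nu - al\<bar>\<close>, so the first one wins.\<close>

lemma C_CKN_eq: "2 * C_CKN CARD('n) a b = real CARD('n) - (a + b + 1)" "C_CKN CARD('n) a b > 0"
proof -
  have "\<bar>real CARD('n) - (3 * b - a + 3)\<bar> \<le> real CARD('n) - (a + b + 1)" "real CARD('n) - (a + b + 1) > 0"
    using ab bN by (auto simp: field_simps)
  thus "2 * C_CKN CARD('n) a b = real CARD('n) - (a + b + 1)" "C_CKN CARD('n) a b > 0"
    by (auto simp: C_CKN_def)
qed

text \<open>The last two facts concern the mixed term of the completed square. Its value is the
  radial divergence formula for \<open>u\<^sup>2 * norm x powr - (a + b + 1)\<close> and is the
  source of \<open>C_CKN\<close>.\<close>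

lemma integrable_energies:
  shows "integrable lborel (\<lambda>x. (norm (grad u x))\<^sup>2 / norm x powr (2 * b))"
    "integrable lborel (\<lambda>x. \<bar>u x\<bar>\<^sup>2 / norm x powr (2 * a))"
    "integrable lborel (\<lambda>x. \<bar>u x\<bar>\<^sup>2 / norm x powr (a + b + 1))"
    "(LINT x|lborel. 2 * u x * norm x powr - (a + b + 1) * (grad u x \<bullet> x)) = - (real CARD('n) - (a + b + 1)) * mass"
    "integrable lborel (\<lambda>x. 2 * u x * norm x powr - (a + b + 1) * (grad u x \<bullet> x))"
proof -
  obtain R M where R: "R > 0" "\<And>x. norm x > R \<Longrightarrow> u x = 0" "\<And>x. norm x > R \<Longrightarrow> grad u x = 0"
    and M: "M > 0" "\<And>x. \<bar>u x\<bar> \<le> M" "\<And>x. norm (grad u x) \<le> M"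
    using test_function_support[OF tu] by blast
  have uc: "continuous_on UNIV u"
    using test_function_grad(1)[OF tu] by (auto intro!: continuous_at_imp_continuous_on dest: has_derivative_continuous)
  have [measurable]: "u \<in> borel_measurable borel" "grad u \<in> borel_measurable borel"
    using uc test_function_grad(2)[OF tu] by (auto intro: borel_measurable_continuous_onI)
  have quot: "z / norm x powr p = z * norm x powr (- p)" for z p and x :: "real^'n"
    by (simp add: powr_minus divide_inverse)
  have u2: "\<bar>u x\<bar>\<^sup>2 \<le> M\<^sup>2" "(norm (grad u x))\<^sup>2 \<le> M\<^sup>2" for x
    by (intro power_mono M; simp)+
  show "integrable lborel (\<lambda>x. (norm (grad u x))\<^sup>2 / norm x powr (2 * b))"
    unfolding quot
    by (rule integrable_powr_compact_support[where R=R and \<beta>="- (2 * b)" and M="M\<^sup>2"])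
       (use bN R(3) u2 in \<open>auto intro!: mult_right_mono\<close>)
  show "integrable lborel (\<lambda>x. \<bar>u x\<bar>\<^sup>2 / norm x powr (2 * a))"
    unfolding quot
    by (rule integrable_powr_compact_support[where R=R and \<beta>="- (2 * a)" and M="M\<^sup>2"])
       (use ab bN R(2) u2 in \<open>auto intro!: mult_right_mono\<close>)
  have Mi: "integrable lborel (\<lambda>x. \<bar>u x\<bar>\<^sup>2 * norm x powr - (a + b + 1))"
    by (rule integrable_powr_compact_support[where R=R and \<beta>="- (a + b + 1)" and M="M\<^sup>2"])
       (use ab bN R(2) u2 in \<open>auto intro!: mult_right_mono\<close>)
  thus Mi': "integrable lborel (\<lambda>x. \<bar>u x\<bar>\<^sup>2 / norm x powr (a + b + 1))" unfolding quot .
  define e where "e = - (a + b + 1)"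
  define D where "D x = (2 * u x * norm x powr e) *\<^sub>R grad u x + ((u x)\<^sup>2 * e * norm x powr (e - 2)) *\<^sub>R x" for x
  have der: "((\<lambda>x. (u x)\<^sup>2 * norm x powr e) has_derivative (\<lambda>h. D x \<bullet> h)) (at x)" if x: "x \<noteq> 0" for x
  proof -
    have 2: "((\<lambda>x. (u x)\<^sup>2) has_derivative (\<lambda>h. 2 * u x * (grad u x \<bullet> h))) (at x)"
      by (auto intro!: derivative_eq_intros test_function_grad(1)[OF tu])
    show ?thesis
      using has_derivative_mult[OF 2 norm_powr_has_derivative[OF x, of e]] unfolding D_def
      by (rule has_derivative_eq_rhs) (simp add: fun_eq_iff inner_add_left algebra_simps)
  qed
  have cont: "continuous_on (- {0}) D" unfolding D_def
    by (intro continuous_intros continuous_on_subset[OF uc] continuous_on_subset[OF test_function_grad(2)[OF tu]]) auto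
  have Fi: "integrable lborel (\<lambda>x. (u x)\<^sup>2 * norm x powr e)" using Mi by (simp add: e_def)
  have eN: "e > - real DIM(real^'n)" using ab bN by (simp add: e_def field_simps)
  have nxp: "norm x * norm x powr q = norm x powr (q + 1)" if "x \<noteq> 0" for x :: "real^'n" and q
    using that by (simp add: powr_add)
  have i1: "integrable lborel (\<lambda>x. norm x * \<bar>2 * u x * norm x powr e\<bar> * norm (grad u x))"
  proof (rule integrable_powr_compact_support[where R=R and \<beta>="e + 1" and M="2 * M * M"])
    fix x :: "real^'n" assume x: "x \<noteq> 0"
    have "\<bar>u x\<bar> * norm (grad u x) \<le> M * M" by (intro mult_mono M) (use M(1) in auto)
    from mult_left_mono[OF this, of "2 * (norm x * norm x powr e)"]
    show "\<bar>norm x * \<bar>2 * u x * norm x powr e\<bar> * norm (grad u x)\<bar> \<le> 2 * M * M * norm x powr (e + 1)"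
      unfolding nxp[OF x, symmetric] by (simp add: abs_mult mult_ac)
  qed (use eN R(2) in auto)
  have i2: "integrable lborel (\<lambda>x. norm x * \<bar>(u x)\<^sup>2 * e * norm x powr (e - 2)\<bar> * norm x)"
  proof (rule integrable_powr_compact_support[where R=R and \<beta>="e" and M="M\<^sup>2 * \<bar>e\<bar>"])
    fix x :: "real^'n" assume x: "x \<noteq> 0"
    have pw: "norm x * (norm x * norm x powr (e - 2)) = norm x powr e" using nxp[OF x] by simp
    have "(u x)\<^sup>2 * \<bar>e\<bar> \<le> M\<^sup>2 * \<bar>e\<bar>" using u2(1)[of x] by (intro mult_right_mono) auto
    from mult_left_mono[OF this, of "norm x * (norm x * norm x powr (e - 2))"]
    show "\<bar>norm x * \<bar>(u x)\<^sup>2 * e * norm x powr (e - 2)\<bar> * norm x\<bar> \<le> M\<^sup>2 * \<bar>e\<bar> * norm x powr e"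
      unfolding pw[symmetric] by (simp add: abs_mult mult_ac)
  qed (use eN R(2) in auto)
  have Di: "integrable lborel (\<lambda>x. norm x * norm (D x))"
  proof (rule Bochner_Integration.integrable_bound[OF Bochner_Integration.integrable_add[OF i1 i2]])
    have [measurable]: "D \<in> borel_measurable borel" using cont by (rule borel_measurable_punctured)
    show "(\<lambda>x. norm x * norm (D x)) \<in> borel_measurable lborel" by measurable
    show "AE x in lborel. norm (norm x * norm (D x)) \<le> norm (norm x * \<bar>2 * u x * norm x powr e\<bar> * norm (grad u x)
        + norm x * \<bar>(u x)\<^sup>2 * e * norm x powr (e - 2)\<bar> * norm x)"
    proof (intro AE_I2)
      fix x :: "real^'n"
      have "norm (D x) \<le> \<bar>2 * u x * norm x powr e\<bar> * norm (grad u x) + \<bar>(u x)\<^sup>2 * e * norm x powr (e - 2)\<bar> * norm x"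
        unfolding D_def by (rule order.trans[OF norm_triangle_ineq]) simp
      from mult_left_mono[OF this norm_ge_zero[of x]]
      have "norm x * norm (D x) \<le> norm x * \<bar>2 * u x * norm x powr e\<bar> * norm (grad u x)
          + norm x * \<bar>(u x)\<^sup>2 * e * norm x powr (e - 2)\<bar> * norm x" by (simp only: distrib_left mult.assoc)
      also have "\<dots> \<le> norm (norm x * \<bar>2 * u x * norm x powr e\<bar> * norm (grad u x)
          + norm x * \<bar>(u x)\<^sup>2 * e * norm x powr (e - 2)\<bar> * norm x)"
        unfolding real_norm_def by (rule abs_ge_self)
      finally show "norm (norm x * norm (D x)) \<le> norm (norm x * \<bar>2 * u x * norm x powr e\<bar> * norm (grad u x)
          + norm x * \<bar>(u x)\<^sup>2 * e * norm x powr (e - 2)\<bar> * norm x)" by simp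
    qed
  qed
  note rad = integral_divergence_radial[OF der cont Fi Di]
  have Dx: "D x \<bullet> x = 2 * u x * norm x powr e * (grad u x \<bullet> x) + e * ((u x)\<^sup>2 * norm x powr e)" for x
  proof (cases "x = 0")
    case False
    have "norm x powr (e - 2) * (x \<bullet> x) = norm x powr e"
      using nxp[OF False, of "e - 2"] nxp[OF False, of "e - 1"] by (simp add: dot_square_norm power2_eq_square mult_ac)
    thus ?thesis by (simp add: D_def inner_add_left mult_ac)
  qed (simp add: D_def)
  have gi: "integrable lborel (\<lambda>x. (D x \<bullet> x) - e * ((u x)\<^sup>2 * norm x powr e))"
    using rad(1) Fi by auto
  thus "integrable lborel (\<lambda>x. 2 * u x * norm x powr - (a + b + 1) * (grad u x \<bullet> x))"
    unfolding Dx e_def by simp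
  have "(LINT x|lborel. 2 * u x * norm x powr e * (grad u x \<bullet> x)) = (LINT x|lborel. (D x \<bullet> x) - e * ((u x)\<^sup>2 * norm x powr e))"
    unfolding Dx by simp
  also have "\<dots> = - (real CARD('n) + e) * (LINT x|lborel. (u x)\<^sup>2 * norm x powr e)"
    using rad Fi by (simp add: algebra_simps)
  also have "(LINT x|lborel. (u x)\<^sup>2 * norm x powr e) = mass" by (simp add: mass_def quot e_def)
  finally show "(LINT x|lborel. 2 * u x * norm x powr - (a + b + 1) * (grad u x \<bullet> x)) = - (real CARD('n) - (a + b + 1)) * mass"
    by (simp add: e_def)
qed

text \<open>All eigenvalues are proportional to \<open>l\<close>, hence the factor \<open>l\<close>
  on the left. Keeping \<open>l\<close> free serves both deficits: \<open>l = 1\<close> for the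
  first, an optimal \<open>l\<close> for the second.\<close>

lemma deficit_lower_bound:
  fixes l t1 t2 I1 I2 :: real and radial axial :: bool
  assumes l: "l > 0" and tt: "0 \<le> t1" "t1 \<le> t2" "t1 \<le> C1 a b" "t1 \<le> D1 b CARD('n)"
    and tt2: "t2 \<le> 2 * C1 a b" "t2 \<le> C1 a b + D1 b CARD('n)" "t2 \<le> D2 b CARD('n)"
      "\<not> radial \<Longrightarrow> t2 \<le> C1 a b" "\<not> axial \<Longrightarrow> t2 \<le> D1 b CARD('n)"
    and I1: "\<And>c. I1 \<le> wnorm2 a b (\<lambda>x. u x - c * E a b l x)"
    and I2: "\<And>c d v. (\<not> radial \<longrightarrow> d = 0) \<Longrightarrow> (\<not> axial \<longrightarrow> v = 0) \<Longrightarrow>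
      I2 \<le> wnorm2 a b (\<lambda>x. u x - (c + d * norm x powr (1 + b - a) + norm x powr (D1 b CARD('n) / 2 - 1) * (v \<bullet> x)) * E a b l x)"
  shows "l * t1 * I1 + l * (t2 - t1) * I2 \<le> gradient_energy + l\<^sup>2 * potential_energy - 2 * l * C_CKN CARD('n) a b * mass"
proof -
  define al where "al = 1 + b - a"
  define N where "N = real CARD('n)"
  define nn where "nn = N - 2 - 2 * b"
  have al: "al > 0" using ab by (simp add: al_def)
  have N1: "N \<ge> 1" unfolding N_def using zero_less_card_finite[where 'a='n] by linarith
  have nn: "nn \<ge> 0" using bN by (simp add: nn_def N_def)
  have D2pos: "D2 b CARD('n) > 0"
  proof -
    have "nn = sqrt (nn\<^sup>2)" using nn by simp
    also have "\<dots> < sqrt (nn\<^sup>2 + 8 * N)" using N1 by (subst real_sqrt_less_iff) simp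
    finally show ?thesis by (simp add: D2_def nn_def N_def)
  qed
  have D1pos: "D1 b CARD('n) > 0" if "CARD('n) \<ge> 2"
  proof -
    have "N > 1" using that by (simp add: N_def)
    have "nn = sqrt (nn\<^sup>2)" using nn by simp
    also have "\<dots> < sqrt (nn\<^sup>2 + 4 * (N - 1))" using \<open>N > 1\<close> by (subst real_sqrt_less_iff) simp
    finally show ?thesis by (simp add: D1_def nn_def N_def)
  qed
  \<comment> \<open>The bound by 1 accommodates the merely bounded \<open>grad u\<close>, the one by
    \<open>al\<close> the gradient of \<open>exp S\<close>, the others the exponents
    \<open>sk 2\<close> and \<open>sk 1\<close>. In dimension one \<open>D1\<close> is 0 and is
    replaced by 1, since the sign function has no gradient.\<close>
  define sg where "sg = min (min al 1) (min (D2 b CARD('n) / 2) (if CARD('n) \<ge> 2 then D1 b CARD('n) / 2 else 1))"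
  have sg: "sg > 0" using al D2pos D1pos by (auto simp: sg_def)
  have sgle: "sg \<le> al" "sg \<le> 1" "sg \<le> D2 b CARD('n) / 2" "CARD('n) \<ge> 2 \<Longrightarrow> sg \<le> D1 b CARD('n) / 2"
    by (auto simp: sg_def)
  interpret spectral_gap al b l sg "TYPE(real^'n)" t1 t2 radial axial
    using al l sg tt nn by unfold_locales (auto simp: nn_def N_def)
  have sk1: "2 * sk 1 = D1 b CARD('n)"
  proof -
    have e: "real 1 * (real 1 + real DIM(real^'n) - 2) = real CARD('n) - 1" by simp
    show ?thesis unfolding sk_def nu_def D1_def e by simp
  qed
  have sk2: "2 * sk 2 = D2 b CARD('n)"
  proof -
    have e: "4 * (real 2 * (real 2 + real DIM(real^'n) - 2)) = 8 * real CARD('n)" by simp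
    show ?thesis unfolding sk_def nu_def D2_def e by simp
  qed
  have C1: "C1 a b = 2 * al" by (simp add: C1_def al_def)
  interpret admissible_gap al b l sg "TYPE(real^'n)" t1 t2 radial axial
    by unfold_locales (use sgle tt tt2 sk1 sk2 C1 in auto)
  obtain R M where R: "R > 0" "\<And>x. norm x > R \<Longrightarrow> u x = 0" "\<And>x. norm x > R \<Longrightarrow> grad u x = 0"
    and M: "M > 0" "\<And>x. \<bar>u x\<bar> \<le> M" "\<And>x. norm (grad u x) \<le> M"
    using test_function_support[OF tu] by blast
  define v where "v x = u x * exp (S x)" for x
  define Dv where "Dv x = exp (S x) *\<^sub>R (grad u x + (l * norm x powr (al - 2) * u x) *\<^sub>R x)" for x
  have uc: "continuous_on A u" for A
    using test_function_grad(1)[OF tu] by (auto intro!: continuous_at_imp_continuous_on dest: has_derivative_continuous)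
  have gc: "continuous_on A (grad u)" for A
    using continuous_on_subset[OF test_function_grad(2)[OF tu]] by blast
  have Sc: "continuous_on A S" for A
    unfolding S_def using al by (intro continuous_intros continuous_on_powr') auto
  have vc: "continuous_on UNIV v" unfolding v_def[abs_def] by (intro continuous_intros uc Sc)
  define L where "L = exp (l * R powr al / al)"
  have expS: "exp (S x) \<le> L" if "norm x \<le> R" for x
  proof -
    have "norm x powr al \<le> R powr al" using that al by (intro powr_mono2) auto
    thus ?thesis using l al by (simp add: L_def S_def divide_right_mono)
  qed
  have L0: "L > 0" by (simp add: L_def)
  have vb: "\<bar>v x\<bar> \<le> M * L" for x
  proof (cases "norm x \<le> R")
    case True
    have "\<bar>u x\<bar> * exp (S x) \<le> M * L" using M(1) by (intro mult_mono M expS True) auto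
    thus ?thesis by (simp add: v_def abs_mult)
  next
    case False thus ?thesis using R(2)[of x] M(1) L0 by (simp add: v_def)
  qed
  have vcls: "cls v Dv"
  proof -
    have der: "(v has_derivative (\<lambda>h. Dv x \<bullet> h)) (at x)" if x: "x \<noteq> 0" for x
    proof -
      have e: "((\<lambda>x. exp (S x)) has_derivative (\<lambda>h. l * norm x powr (al - 2) * (x \<bullet> h) * exp (S x))) (at x)"
        using has_derivative_exp[OF S_has_derivative[OF x]] by (simp add: mult_ac)
      show ?thesis unfolding v_def[abs_def]
        using has_derivative_mult[OF test_function_grad(1)[OF tu] e]
        by (rule has_derivative_eq_rhs) (simp add: fun_eq_iff Dv_def inner_add_left algebra_simps)
    qed
    have cont: "continuous_on (- {0}) Dv" unfolding Dv_def[abs_def]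
      by (intro continuous_intros uc gc Sc) auto
    define K where "K = M * L + L * (M * R powr (1 - sg) + l * M * R powr (al - sg))"
    have K: "K \<ge> M * L" "K \<ge> L * (M * R powr (1 - sg) + l * M * R powr (al - sg))" "K \<ge> 0"
      unfolding K_def using M L0 l by (auto intro!: add_nonneg_nonneg mult_nonneg_nonneg)
    have "\<bar>v x\<bar> \<le> K * exp (S x / 4) \<and> norm (Dv x) \<le> K * (norm x powr (sg - 1) * exp (S x / 4))" if x: "x \<noteq> 0" for x
    proof
      have e1: "1 \<le> exp (S x / 4)" using S_nonneg[of x] by simp
      have "\<bar>v x\<bar> \<le> K * 1" using vb[of x] K(1) by linarith
      also have "\<dots> \<le> K * exp (S x / 4)" by (intro mult_left_mono e1 K(3))
      finally show "\<bar>v x\<bar> \<le> K * exp (S x / 4)" .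
      show "norm (Dv x) \<le> K * (norm x powr (sg - 1) * exp (S x / 4))"
      proof (cases "norm x \<le> R")
        case True
        have p1: "1 = norm x powr (1 - sg) * norm x powr (sg - 1)" using x by (simp add: powr_add[symmetric])
        have p2: "norm x powr (al - 2) * norm x = norm x powr (al - sg) * norm x powr (sg - 1)"
          using x powr_add[of "norm x" "al - 2" 1] by (simp add: powr_add[symmetric])
        have q1: "norm x powr (1 - sg) \<le> R powr (1 - sg)" using True sgle by (intro powr_mono2) auto
        have q2: "norm x powr (al - sg) \<le> R powr (al - sg)" using True sgle by (intro powr_mono2) auto
        have "norm (grad u x + (l * norm x powr (al - 2) * u x) *\<^sub>R x)
          \<le> norm (grad u x) + l * \<bar>u x\<bar> * (norm x powr (al - 2) * norm x)"
          using l by (intro order.trans[OF norm_triangle_ineq]) (simp add: abs_mult mult_ac)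
        also have "\<dots> \<le> M * 1 + l * M * (norm x powr (al - 2) * norm x)"
          using l M by (intro add_mono mult_mono) auto
        also have "\<dots> = (M * norm x powr (1 - sg) + l * M * norm x powr (al - sg)) * norm x powr (sg - 1)"
          unfolding p2 by (subst p1) (simp add: algebra_simps)
        also have "\<dots> \<le> (M * R powr (1 - sg) + l * M * R powr (al - sg)) * norm x powr (sg - 1)"
          using l M(1) by (intro mult_right_mono add_mono mult_left_mono q1 q2) auto
        finally have g: "norm (grad u x + (l * norm x powr (al - 2) * u x) *\<^sub>R x)
           \<le> (M * R powr (1 - sg) + l * M * R powr (al - sg)) * norm x powr (sg - 1)" .
        have "norm (Dv x) = exp (S x) * norm (grad u x + (l * norm x powr (al - 2) * u x) *\<^sub>R x)" by (simp add: Dv_def)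
        also have "\<dots> \<le> L * ((M * R powr (1 - sg) + l * M * R powr (al - sg)) * norm x powr (sg - 1))"
          using L0 by (intro mult_mono expS True g) auto
        also have "\<dots> \<le> K * norm x powr (sg - 1)"
          using mult_right_mono[OF K(2), of "norm x powr (sg - 1)"] by (simp add: mult.assoc)
        also have "\<dots> \<le> K * (norm x powr (sg - 1) * exp (S x / 4))"
          using K(3) e1 mult_left_mono[OF e1, of "norm x powr (sg - 1)"] by (intro mult_left_mono) auto
        finally show ?thesis .
      next
        case False
        thus ?thesis using R(2)[of x] R(3)[of x] K(3) by (simp add: Dv_def)
      qed
    qed
    thus ?thesis unfolding cls_def using der cont by blast
  qed
  \<comment> \<open>Undoes the substitution: \<open>v - f\<close> times \<open>exp (- S)\<close> is
    \<open>u\<close> minus the correction times \<open>E\<close>, and the square of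
    \<open>exp (- S)\<close> is part of \<open>wmu\<close>.\<close>
  have wn: "(LINT x|lborel. (v x - f x)\<^sup>2 * wmu x) = wnorm2 a b (\<lambda>x. u x - g x * E a b l x)"
    if fg: "\<And>x. x \<noteq> 0 \<Longrightarrow> f x = g x" for f g
    unfolding wnorm2_def
  proof (rule Bochner_Integration.integral_cong[OF refl])
    fix x :: "real^'n"
    show "(v x - f x)\<^sup>2 * wmu x = \<bar>u x - g x * E a b l x\<bar>\<^sup>2 / norm x powr (a + b + 1)"
    proof (cases "x = 0")
      case False
      have E: "E a b l x = exp (- S x)" unfolding E_def S_def by (simp add: al_def)
      have ex: "al - 2 - 2 * b = - (a + b + 1)" by (simp add: al_def)
      have "u x - g x * E a b l x = (v x - f x) * exp (- S x)"
        unfolding fg[OF False] E v_def by (simp add: algebra_simps exp_add[symmetric])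
      hence "\<bar>u x - g x * E a b l x\<bar>\<^sup>2 = (v x - f x)\<^sup>2 * exp (- 2 * S x)"
        by (simp add: power_mult_distrib exp_of_nat_mult[symmetric] exp_double[symmetric])
      thus ?thesis unfolding wmu_def ex powr_minus divide_inverse by (simp add: mult_ac)
    qed (simp add: wmu_def)
  qed
  have J1: "I1 \<le> (LINT x|lborel. (v x - f x)\<^sup>2 * wmu x)" if low: "low1 f" for f
  proof -
    obtain c where "\<forall>x. x \<noteq> 0 \<longrightarrow> f x = c" using low unfolding low1_def by blast
    hence "f x = c" if "x \<noteq> 0" for x using that by blast
    from wn[of f "\<lambda>_. c", OF this] show ?thesis using I1[of c] by simp
  qed
  have J2: "I2 \<le> (LINT x|lborel. (v x - f x)\<^sup>2 * wmu x)" if low: "low2 f" for f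
  proof -
    obtain c d w where cdw: "\<not> radial \<longrightarrow> d = 0" "\<not> axial \<longrightarrow> w = 0"
      and f': "\<forall>x. x \<noteq> 0 \<longrightarrow> f x = c + d * norm x powr al + norm x powr (sk 1 - 1) * (w \<bullet> x)"
      using low unfolding low2_def by blast
    have f: "f x = c + d * norm x powr al + norm x powr (sk 1 - 1) * (w \<bullet> x)" if "x \<noteq> 0" for x
      using f' that by blast
    have sk1': "sk 1 = D1 b CARD('n) / 2" using sk1 by simp
    have "I2 \<le> wnorm2 a b (\<lambda>x. u x - (c + d * norm x powr al + norm x powr (sk 1 - 1) * (w \<bullet> x)) * E a b l x)"
      using I2[OF cdw, of c] unfolding sk1' al_def .
    also have "\<dots> = (LINT x|lborel. (v x - f x)\<^sup>2 * wmu x)" by (rule wn[symmetric]) (rule f)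
    finally show ?thesis .
  qed
  note en = integrable_energies
  \<comment> \<open>Since \<open>Dv = exp S *\<^sub>R (grad u + l * norm x powr (al - 2) * u
    *\<^sub>R x)\<close>, the exponentials cancel. The powers combine by
    \<open>2 * (al - 2) + 2 - 2 * b = - 2 * a\<close> and
    \<open>al - 2 - 2 * b = - (a + b + 1)\<close>.\<close>
  have "(LINT x|lborel. (Dv x \<bullet> Dv x) * wm x) = (LINT x|lborel. (norm (grad u x))\<^sup>2 / norm x powr (2 * b)
      + l\<^sup>2 * (\<bar>u x\<bar>\<^sup>2 / norm x powr (2 * a)) + l * (2 * u x * norm x powr - (a + b + 1) * (grad u x \<bullet> x)))"
  proof (rule Bochner_Integration.integral_cong[OF refl])
    fix x :: "real^'n"
    show "(Dv x \<bullet> Dv x) * wm x = (norm (grad u x))\<^sup>2 / norm x powr (2 * b)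
      + l\<^sup>2 * (\<bar>u x\<bar>\<^sup>2 / norm x powr (2 * a)) + l * (2 * u x * norm x powr - (a + b + 1) * (grad u x \<bullet> x))"
    proof (cases "x = 0")
      case False
      define r where "r = norm x"
      have r: "r > 0" using False by (simp add: r_def)
      define g p where "g = grad u x" and "p = g \<bullet> x"
      have e: "exp (S x) * exp (S x) * exp (- 2 * S x) = 1" by (simp add: exp_add[symmetric])
      have "(Dv x \<bullet> Dv x) * wm x = (exp (S x) * exp (S x) * exp (- 2 * S x)) * r powr (- 2 * b) *
          ((norm g)\<^sup>2 + 2 * (l * r powr (al - 2) * u x) * p + (l * r powr (al - 2) * u x)\<^sup>2 * (r * r))"
        unfolding Dv_def wm_def r_def[symmetric] g_def[symmetric]
        by (simp add: inner_add_left inner_add_right p_def dot_square_norm[symmetric] power2_eq_square[of "norm x"] inner_commute[of x g] r_def[symmetric])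
           (simp add: dot_square_norm r_def[symmetric] power2_eq_square algebra_simps)
      also have "\<dots> = (norm g)\<^sup>2 * r powr (- 2 * b) + l * (2 * u x * (r powr (al - 2) * r powr (- 2 * b)) * p)
          + l\<^sup>2 * ((u x)\<^sup>2 * (r powr (al - 2) * r powr (al - 2) * r powr 1 * r powr 1 * r powr (- 2 * b)))"
        unfolding e using r by (simp add: algebra_simps power2_eq_square)
      also have "r powr (al - 2) * r powr (- 2 * b) = r powr - (a + b + 1)"
        unfolding powr_add[symmetric] by (rule arg_cong[where f="\<lambda>z. r powr z"]) (simp add: al_def)
      also have "r powr (al - 2) * r powr (al - 2) * r powr 1 * r powr 1 * r powr (- 2 * b) = r powr (- (2 * a))"
        unfolding powr_add[symmetric] by (rule arg_cong[where f="\<lambda>z. r powr z"]) (simp add: al_def)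
      finally show ?thesis
        by (simp add: r_def g_def p_def powr_minus divide_inverse)
    qed (simp add: wm_def)
  qed
  also have "\<dots> = gradient_energy + l\<^sup>2 * potential_energy + l * (- (real CARD('n) - (a + b + 1)) * mass)"
    unfolding gradient_energy_def potential_energy_def en(4)[symmetric]
    by (subst Bochner_Integration.integral_add[OF Bochner_Integration.integrable_add[OF en(1) integrable_mult_right[OF en(2)]] integrable_mult_right[OF en(5)]],
        subst Bochner_Integration.integral_add[OF en(1) integrable_mult_right[OF en(2)]]) (simp only: integral_mult_right_zero)
  also have "\<dots> = gradient_energy + l\<^sup>2 * potential_energy - 2 * l * C_CKN CARD('n) a b * mass"
    unfolding C_CKN_eq(1)[symmetric] by (simp add: algebra_simps)
  finally show ?thesis using spectral_gap_inequality[OF vcls vc vb J1 J2] by simp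
qed

lemma delta1_lower_bound:
  assumes "0 \<le> t1" "t1 \<le> t2" "t1 \<le> C1 a b" "t1 \<le> D1 b CARD('n)"
    and "t2 \<le> 2 * C1 a b" "t2 \<le> C1 a b + D1 b CARD('n)" "t2 \<le> D2 b CARD('n)"
      "\<not> radial \<Longrightarrow> t2 \<le> C1 a b" "\<not> axial \<Longrightarrow> t2 \<le> D1 b CARD('n)"
    and "\<And>c. I1 \<le> wnorm2 a b (\<lambda>x. u x - c * E a b 1 x)"
    and "\<And>c d v. (\<not> radial \<longrightarrow> d = 0) \<Longrightarrow> (\<not> axial \<longrightarrow> v = 0) \<Longrightarrow>
      I2 \<le> wnorm2 a b (\<lambda>x. u x - (c + d * norm x powr (1 + b - a) + norm x powr (D1 b CARD('n) / 2 - 1) * (v \<bullet> x)) * E a b 1 x)"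
  shows "t1 * I1 + (t2 - t1) * I2 \<le> delta1 a b u"
  using deficit_lower_bound[of 1, OF _ assms]
  unfolding gradient_energy_def potential_energy_def mass_def by (simp add: delta1_def)

text \<open>The scale \<open>\<lambda>\<close> is chosen to balance the two energies.\<close>

lemma delta2_lower_bound:
  assumes t: "0 \<le> t1" "t1 \<le> t2" "t1 \<le> C1 a b" "t1 \<le> D1 b CARD('n)"
    and t2: "t2 \<le> 2 * C1 a b" "t2 \<le> C1 a b + D1 b CARD('n)" "t2 \<le> D2 b CARD('n)"
      "\<not> radial \<Longrightarrow> t2 \<le> C1 a b" "\<not> axial \<Longrightarrow> t2 \<le> D1 b CARD('n)"
    and I1: "\<And>c l. l > 0 \<Longrightarrow> I1 \<le> wnorm2 a b (\<lambda>x. u x - c * E a b l x)"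
    and I2: "\<And>c d v l. l > 0 \<Longrightarrow> (\<not> radial \<longrightarrow> d = 0) \<Longrightarrow> (\<not> axial \<longrightarrow> v = 0) \<Longrightarrow>
      I2 \<le> wnorm2 a b (\<lambda>x. u x - (c + d * norm x powr (1 + b - a) + norm x powr (D1 b CARD('n) / 2 - 1) * (v \<bullet> x)) * E a b l x)"
  shows "t1 / 2 * I1 + (t2 - t1) / 2 * I2 \<le> delta2 a b u"
proof -
  define A B where "A = gradient_energy" and "B = potential_energy"
  have A0: "A \<ge> 0" unfolding A_def gradient_energy_def by (intro integral_nonneg_AE AE_I2) auto
  have B0: "B \<ge> 0" unfolding B_def potential_energy_def by (intro integral_nonneg_AE AE_I2) auto
  have M0: "mass \<ge> 0" unfolding mass_def by (intro integral_nonneg_AE AE_I2) auto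
  have d2: "delta2 a b u = sqrt A * sqrt B - C_CKN CARD('n) a b * mass"
    by (simp add: delta2_def A_def B_def gradient_energy_def potential_energy_def mass_def)
  have core: "l * t1 * I1 + l * (t2 - t1) * I2 \<le> A + l\<^sup>2 * B - 2 * l * C_CKN CARD('n) a b * mass" if l: "l > 0" for l
    unfolding A_def B_def by (rule deficit_lower_bound[OF l t t2 I1[OF l] I2[OF l]])
  show ?thesis
  proof (cases "A > 0 \<and> B > 0")
    case True
    define l where "l = sqrt A / sqrt B"
    have l: "l > 0" using True by (simp add: l_def)
    have lB: "l\<^sup>2 * B = A" using True by (simp add: l_def power_divide)
    have lAB: "l * (sqrt A * sqrt B) = A" using True by (simp add: l_def)
    \<comment> \<open>With \<open>l\<^sup>2 * B = A\<close> and
      \<open>l * sqrt A * sqrt B = A\<close> the right side of \<open>core\<close> equals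
      \<open>2 * l\<close> times \<open>delta2\<close>.\<close>
    have "l * (t1 * I1 + (t2 - t1) * I2) \<le> l * (2 * delta2 a b u)"
      using core[OF l] lB lAB unfolding d2 by (simp add: algebra_simps)
    hence "t1 * I1 + (t2 - t1) * I2 \<le> 2 * delta2 a b u" using l by simp
    thus ?thesis by simp
  next
    case False
    \<comment> \<open>Degenerate energies, where no balancing \<open>l\<close> exists. If
      \<open>B = 0\<close>, then \<open>u\<close> vanishes almost everywhere off the origin. If
      \<open>A = 0 < B\<close>, the bound with both thresholds 0 gives
      \<open>2 * C_CKN * mass <= l * B\<close> for every \<open>l > 0\<close>.\<close>
    have m: "mass = 0"
    proof (cases "B = 0")
      case True
      have "AE x in lborel. \<bar>u x\<bar>\<^sup>2 / norm x powr (2 * a) = 0"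
        using True integral_nonneg_eq_0_iff_AE[OF integrable_energies(2)] by (simp add: B_def potential_energy_def)
      hence "AE x in lborel. \<bar>u x\<bar>\<^sup>2 / norm x powr (a + b + 1) = 0" by eventually_elim auto
      thus ?thesis unfolding mass_def by (rule integral_eq_zero_AE)
    next
      case B: False
      hence "A = 0" using False A0 B0 by auto
      have le: "2 * C_CKN CARD('n) a b * mass \<le> l * B" if l: "l > 0" for l
      proof -
        have "l * 0 * 0 + l * (0 - 0) * 0 \<le> A + l\<^sup>2 * B - 2 * l * C_CKN CARD('n) a b * mass"
          unfolding A_def B_def
          by (rule deficit_lower_bound[OF l]) (use t t2 in \<open>auto intro: wnorm2_nonneg order.trans\<close>)
        hence "l * (2 * C_CKN CARD('n) a b * mass) \<le> l * (l * B)" using \<open>A = 0\<close> by (simp add: power2_eq_square mult_ac)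
        thus ?thesis using l by simp
      qed
      show ?thesis
      proof (rule ccontr)
        assume "mass \<noteq> 0"
        hence pos: "C_CKN CARD('n) a b * mass > 0" using M0 C_CKN_eq(2) by simp
        \<comment> \<open>The choice \<open>l = C_CKN * mass / B\<close> makes the right side half
          of the left one.\<close>
        hence "2 * C_CKN CARD('n) a b * mass \<le> C_CKN CARD('n) a b * mass / B * B"
          using B B0 by (intro le) (simp add: less_le)
        moreover have "C_CKN CARD('n) a b * mass / B * B = C_CKN CARD('n) a b * mass" using B by simp
        ultimately show False using pos by linarith
      qed
    qed
    \<comment> \<open>The zero correction already has distance 0, so neither lower bound
      \<open>I1\<close>, \<open>I2\<close> can be positive.\<close>
    have w0: "wnorm2 a b (\<lambda>x. u x - 0 * E a b 1 x) = 0" using m by (simp add: wnorm2_def mass_def)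
    have i1: "I1 \<le> 0" using I1[of 1 0] w0 by simp
    have i2: "I2 \<le> 0" using I2[of 1 0 0 0] w0 by simp
    have "t1 / 2 * I1 + (t2 - t1) / 2 * I2 \<le> 0"
      using t i1 i2 by (intro add_nonpos_nonpos mult_nonneg_nonpos) auto
    also have "0 \<le> delta2 a b u" unfolding d2 m using A0 B0 by simp
    finally show ?thesis .
  qed
qed

end

section \<open>Choice of the thresholds and the final inequalities\<close>

lemma INF_nonneg_le:
  fixes f :: "'b \<Rightarrow> real"
  assumes "\<And>z. 0 \<le> f z" "z \<in> A"
  shows "(INF z\<in>A. f z) \<le> f z"
  by (rule cINF_lower[OF _ assms(2)]) (use assms(1) in \<open>auto intro!: bdd_belowI2[where m=0]\<close>)

theorem theorem3p2:
  fixes N :: nat and a b :: real and u :: "real^'n \<Rightarrow> real"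
  assumes "N = CARD('n)" and "N \<ge> 1"
    and "b + 1 - a > 0" and "b \<le> (real N - 2) / 2"
    and "test_function u"
  shows "(delta1 a b u \<ge> C_PI a b N * (INF c. wnorm2 a b (\<lambda>x. u x - c * E a b 1 x)))
    \<and> (delta2 a b u \<ge> C_PI a b N / 2
           * (INF (c, l) \<in> UNIV \<times> {0<..}. wnorm2 a b (\<lambda>x. u x - c * E a b l x)))
    \<and> (C1 a b < D1 b N \<longrightarrow>
           R1 a b u \<ge> min (C1 a b) (D1 b N - C1 a b)
             * (INF (c, d) \<in> UNIV.
                  wnorm2 a b (\<lambda>x. u x - (c + d * norm x powr (1 + b - a)) * E a b 1 x)))
    \<and> (C1 a b < D1 b N \<longrightarrow>
           R2 a b u \<ge> min (C1 a b) (D1 b N - C1 a b) / 2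
             * (INF (c, d, l) \<in> UNIV \<times> UNIV \<times> {0<..}.
                  wnorm2 a b (\<lambda>x. u x - (c + d * norm x powr (1 + b - a)) * E a b l x)))
    \<and> (C1 a b > D1 b N \<longrightarrow>
           R1 a b u \<ge> min (C1 a b - D1 b N) (D2 b N - D1 b N)
             * (INF (c, v) \<in> UNIV.
                  wnorm2 a b (\<lambda>x. u x - (c + norm x powr (D1 b N / 2 - 1) * (v \<bullet> x)) * E a b 1 x)))
    \<and> (C1 a b > D1 b N \<longrightarrow>
           R2 a b u \<ge> min (C1 a b - D1 b N) (D2 b N - D1 b N) / 2
             * (INF (c, l, v) \<in> UNIV \<times> {0<..} \<times> UNIV.
                  wnorm2 a b (\<lambda>x. u x - (c + norm x powr (D1 b N / 2 - 1) * (v \<bullet> x)) * E a b l x)))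
    \<and> (C1 a b = D1 b N \<longrightarrow>
           R1 a b u \<ge> min (D1 b N) (D2 b N - D1 b N)
             * (INF (c, d, v) \<in> UNIV.
                  wnorm2 a b (\<lambda>x. u x - (c + d * norm x powr (1 + b - a)
                    + norm x powr (D1 b N / 2 - 1) * (v \<bullet> x)) * E a b 1 x)))
    \<and> (C1 a b = D1 b N \<longrightarrow>
           R2 a b u \<ge> min (D1 b N) (D2 b N - D1 b N) / 2
             * (INF (c, d, l, v) \<in> UNIV \<times> UNIV \<times> {0<..} \<times> UNIV.
                  wnorm2 a b (\<lambda>x. u x - (c + d * norm x powr (1 + b - a)
                    + norm x powr (D1 b N / 2 - 1) * (v \<bullet> x)) * E a b l x)))"
proof -
  have N: "N = CARD('n)" and ab: "b + 1 - a > 0" and bN: "b \<le> (real CARD('n) - 2) / 2" and u: "test_function u"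
    using assms by auto
  have N1: "real CARD('n) \<ge> 1" using assms(1,2) by simp
  define t where "t = C_PI a b N"
  have C1: "C1 a b > 0" using ab by (simp add: C1_def)
  have D1: "D1 b N \<ge> 0"
  proof -
    have "real N - 2 - 2 * b \<le> sqrt ((real N - 2 - 2 * b)\<^sup>2)" by simp
    also have "\<dots> \<le> sqrt ((real N - 2 - 2 * b)\<^sup>2 + 4 * (real N - 1))"
      using N1 N by (intro real_sqrt_le_mono) simp
    finally show ?thesis by (simp add: D1_def)
  qed
  have D12: "D1 b N \<le> D2 b N"
    unfolding D1_def D2_def by (intro diff_right_mono real_sqrt_le_mono) simp
  have t: "0 \<le> t" "t \<le> C1 a b" "t \<le> D1 b N" using C1 D1 by (auto simp: t_def C_PI_def)
  define J1 where "J1 = (INF c. wnorm2 a b (\<lambda>x. u x - c * E a b 1 x))"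
  define J2 where "J2 = (INF (c, l) \<in> UNIV \<times> {0<..}. wnorm2 a b (\<lambda>x. u x - c * E a b l x))"
  have J1: "J1 \<le> wnorm2 a b (\<lambda>x. u x - c * E a b 1 x)" for c
    unfolding J1_def by (rule INF_nonneg_le) (auto intro: wnorm2_nonneg)
  have J2: "J2 \<le> wnorm2 a b (\<lambda>x. u x - c * E a b l x)" if "l > 0" for c l
    unfolding J2_def using that
    by (intro order.trans[OF INF_nonneg_le[where z="(c, l)"]]) (auto intro: wnorm2_nonneg)
  have R: "R1 a b u = delta1 a b u - t * J1" "R2 a b u = delta2 a b u - t / 2 * J2"
    by (simp_all add: R1_def R2_def t_def J1_def J2_def N)
  \<comment> \<open>The first threshold is always \<open>t\<close>, whose contribution is exactly
    what \<open>R1\<close> subtracts. Only the second threshold \<open>s\<close> and the modes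
    switched on vary between the cases.\<close>
  have gap1: "(s - t) * I \<le> R1 a b u"
    if "t \<le> s" "s \<le> 2 * C1 a b" "s \<le> C1 a b + D1 b N" "s \<le> D2 b N" "\<not> radial \<Longrightarrow> s \<le> C1 a b" "\<not> axial \<Longrightarrow> s \<le> D1 b N"
      and "\<And>c d v. (\<not> radial \<longrightarrow> d = 0) \<Longrightarrow> (\<not> axial \<longrightarrow> v = 0) \<Longrightarrow> I \<le> wnorm2 a b
        (\<lambda>x. u x - (c + d * norm x powr (1 + b - a) + norm x powr (D1 b N / 2 - 1) * (v \<bullet> x)) * E a b 1 x)"
    for s I radial axial
    using delta1_lower_bound[where radial=radial and axial=axial, OF ab bN u t(1) that(1) t(2) t(3)[unfolded N] that(2) that(3,4)[unfolded N] that(5) that(6)[unfolded N] J1 that(7)[unfolded N]]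
    unfolding R by simp
  have gap2: "(s - t) / 2 * I \<le> R2 a b u"
    if g: "t \<le> s" "s \<le> 2 * C1 a b" "s \<le> C1 a b + D1 b N" "s \<le> D2 b N" "\<not> radial \<Longrightarrow> s \<le> C1 a b" "\<not> axial \<Longrightarrow> s \<le> D1 b N"
      and I: "\<And>c d v l. l > 0 \<Longrightarrow> (\<not> radial \<longrightarrow> d = 0) \<Longrightarrow> (\<not> axial \<longrightarrow> v = 0) \<Longrightarrow> I \<le> wnorm2 a b
        (\<lambda>x. u x - (c + d * norm x powr (1 + b - a) + norm x powr (D1 b N / 2 - 1) * (v \<bullet> x)) * E a b l x)"
    for s I radial axial
  proof -
    have "t / 2 * J2 + (s - t) / 2 * I \<le> delta2 a b u"
    proof (rule delta2_lower_bound[where radial=radial and axial=axial, OF ab bN u t(1) g(1) t(2) t(3)[unfolded N] g(2) g(3,4)[unfolded N]])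
      show "J2 \<le> wnorm2 a b (\<lambda>x. u x - c * E a b l x)" if "l > 0" for c l by (rule J2[OF that])
      show "I \<le> wnorm2 a b (\<lambda>x. u x - (c + d * norm x powr (1 + b - a) + norm x powr (D1 b CARD('n) / 2 - 1) * (v \<bullet> x)) * E a b l x)"
        if "l > 0" "\<not> radial \<longrightarrow> d = 0" "\<not> axial \<longrightarrow> v = 0" for c d v l
        using I[OF that] unfolding N .
    qed (use g(5,6) N in auto)
    thus ?thesis unfolding R by simp
  qed
  \<comment> \<open>Equal thresholds with the trivial bound 0 reduce the estimate to the plain
    inequality.\<close>
  have "(t - t) * 0 \<le> R1 a b u"
    by (rule gap1[where radial=True and axial=True]) (use t D12 C1 D1 wnorm2_nonneg in auto)
  hence P1: "t * J1 \<le> delta1 a b u" unfolding R by simp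
  have "(t - t) / 2 * 0 \<le> R2 a b u"
    by (rule gap2[where radial=True and axial=True]) (use t D12 C1 D1 wnorm2_nonneg in auto)
  hence P2: "t / 2 * J2 \<le> delta2 a b u" unfolding R by simp
  have A1: "R1 a b u \<ge> min (C1 a b) (D1 b N - C1 a b) * (INF (c, d) \<in> UNIV. wnorm2 a b (\<lambda>x. u x - (c + d * norm x powr (1 + b - a)) * E a b 1 x))" (is "_ \<ge> _ * ?I")
    if h: "C1 a b < D1 b N"
  proof -
    have t_eq: "t = C1 a b" using h by (simp add: t_def C_PI_def)
    have le: "?I \<le> wnorm2 a b (\<lambda>x. u x - (c + d * norm x powr (1 + b - a)) * E a b 1 x)" for c d and v :: "real^'n"
      by (rule order.trans[OF INF_nonneg_le[where z="(c, d)"]]) (use TrueI in \<open>auto intro: wnorm2_nonneg\<close>)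
    \<comment> \<open>The second threshold is \<open>min (2 * C1) D1\<close>: with the first radial
      mode removed, the next candidates are the second radial and the first axial mode.\<close>
    have "(t + min (C1 a b) (D1 b N - C1 a b) - t) * ?I \<le> R1 a b u"
    proof (rule gap1[where radial=True and axial=False])
      fix c d :: real and v :: "real^'n"
      assume "\<not> True \<longrightarrow> d = 0" "\<not> False \<longrightarrow> v = 0"
      thus "?I \<le> wnorm2 a b (\<lambda>x. u x - (c + d * norm x powr (1 + b - a) + norm x powr (D1 b N / 2 - 1) * (v \<bullet> x)) * E a b 1 x)"
        using le by simp
    qed (use h t_eq C1 D1 D12 in auto)
    thus ?thesis by simp
  qed
  have A2: "R2 a b u \<ge> min (C1 a b) (D1 b N - C1 a b) / 2 * (INF (c, d, l) \<in> UNIV \<times> UNIV \<times> {0<..}. wnorm2 a b (\<lambda>x. u x - (c + d * norm x powr (1 + b - a)) * E a b l x))" (is "_ \<ge> _ * ?I")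
    if h: "C1 a b < D1 b N"
  proof -
    have t_eq: "t = C1 a b" using h by (simp add: t_def C_PI_def)
    have le: "?I \<le> wnorm2 a b (\<lambda>x. u x - (c + d * norm x powr (1 + b - a)) * E a b l x)" if "l > 0" for c d l and v :: "real^'n"
      by (rule order.trans[OF INF_nonneg_le[where z="(c, d, l)"]]) (use that in \<open>auto intro: wnorm2_nonneg\<close>)
    have "(t + min (C1 a b) (D1 b N - C1 a b) - t) / 2 * ?I \<le> R2 a b u"
    proof (rule gap2[where radial=True and axial=False])
      fix c d :: real and v :: "real^'n" and l :: real
      assume "l > 0" "\<not> True \<longrightarrow> d = 0" "\<not> False \<longrightarrow> v = 0"
      thus "?I \<le> wnorm2 a b (\<lambda>x. u x - (c + d * norm x powr (1 + b - a) + norm x powr (D1 b N / 2 - 1) * (v \<bullet> x)) * E a b l x)"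
        using le by simp
    qed (use h t_eq C1 D1 D12 in auto)
    thus ?thesis by simp
  qed
  have B1: "R1 a b u \<ge> min (C1 a b - D1 b N) (D2 b N - D1 b N) * (INF (c, v) \<in> UNIV. wnorm2 a b (\<lambda>x. u x - (c + norm x powr (D1 b N / 2 - 1) * (v \<bullet> x)) * E a b 1 x))" (is "_ \<ge> _ * ?I")
    if h: "C1 a b > D1 b N"
  proof -
    have t_eq: "t = D1 b N" using h by (simp add: t_def C_PI_def)
    have le: "?I \<le> wnorm2 a b (\<lambda>x. u x - (c + norm x powr (D1 b N / 2 - 1) * (v \<bullet> x)) * E a b 1 x)" for c d and v :: "real^'n"
      by (rule order.trans[OF INF_nonneg_le[where z="(c, v)"]]) (use TrueI in \<open>auto intro: wnorm2_nonneg\<close>)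
    \<comment> \<open>The second threshold is \<open>min C1 D2\<close>: with the axial mode removed,
      the next candidates are the first radial mode and the modes of degree
      \<open>k = 2\<close>.\<close>
    have "(t + min (C1 a b - D1 b N) (D2 b N - D1 b N) - t) * ?I \<le> R1 a b u"
    proof (rule gap1[where radial=False and axial=True])
      fix c d :: real and v :: "real^'n"
      assume "\<not> False \<longrightarrow> d = 0" "\<not> True \<longrightarrow> v = 0"
      thus "?I \<le> wnorm2 a b (\<lambda>x. u x - (c + d * norm x powr (1 + b - a) + norm x powr (D1 b N / 2 - 1) * (v \<bullet> x)) * E a b 1 x)"
        using le by simp
    qed (use h t_eq C1 D1 D12 in auto)
    thus ?thesis by simp
  qed
  have B2: "R2 a b u \<ge> min (C1 a b - D1 b N) (D2 b N - D1 b N) / 2 * (INF (c, l, v) \<in> UNIV \<times> {0<..} \<times> UNIV. wnorm2 a b (\<lambda>x. u x - (c + norm x powr (D1 b N / 2 - 1) * (v \<bullet> x)) * E a b l x))" (is "_ \<ge> _ * ?I")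
    if h: "C1 a b > D1 b N"
  proof -
    have t_eq: "t = D1 b N" using h by (simp add: t_def C_PI_def)
    have le: "?I \<le> wnorm2 a b (\<lambda>x. u x - (c + norm x powr (D1 b N / 2 - 1) * (v \<bullet> x)) * E a b l x)" if "l > 0" for c d l and v :: "real^'n"
      by (rule order.trans[OF INF_nonneg_le[where z="(c, l, v)"]]) (use that in \<open>auto intro: wnorm2_nonneg\<close>)
    have "(t + min (C1 a b - D1 b N) (D2 b N - D1 b N) - t) / 2 * ?I \<le> R2 a b u"
    proof (rule gap2[where radial=False and axial=True])
      fix c d :: real and v :: "real^'n" and l :: real
      assume "l > 0" "\<not> False \<longrightarrow> d = 0" "\<not> True \<longrightarrow> v = 0"
      thus "?I \<le> wnorm2 a b (\<lambda>x. u x - (c + d * norm x powr (1 + b - a) + norm x powr (D1 b N / 2 - 1) * (v \<bullet> x)) * E a b l x)"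
        using le by simp
    qed (use h t_eq C1 D1 D12 in auto)
    thus ?thesis by simp
  qed
  have G1: "R1 a b u \<ge> min (D1 b N) (D2 b N - D1 b N) * (INF (c, d, v) \<in> UNIV. wnorm2 a b (\<lambda>x. u x - (c + d * norm x powr (1 + b - a) + norm x powr (D1 b N / 2 - 1) * (v \<bullet> x)) * E a b 1 x))" (is "_ \<ge> _ * ?I")
    if h: "C1 a b = D1 b N"
  proof -
    have t_eq: "t = D1 b N" using h by (simp add: t_def C_PI_def)
    have le: "?I \<le> wnorm2 a b (\<lambda>x. u x - (c + d * norm x powr (1 + b - a) + norm x powr (D1 b N / 2 - 1) * (v \<bullet> x)) * E a b 1 x)" for c d and v :: "real^'n"
      by (rule order.trans[OF INF_nonneg_le[where z="(c, d, v)"]]) (use TrueI in \<open>auto intro: wnorm2_nonneg\<close>)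
    \<comment> \<open>The radial and axial modes share the eigenvalue \<open>D1\<close> and are both
      removed. The second threshold is \<open>min (2 * D1) D2\<close>, where \<open>2 * D1\<close>
      stands for \<open>2 * C1\<close> as well as for the mixed eigenvalue
      \<open>C1 + D1\<close>.\<close>
    have "(t + min (D1 b N) (D2 b N - D1 b N) - t) * ?I \<le> R1 a b u"
    proof (rule gap1[where radial=True and axial=True])
      fix c d :: real and v :: "real^'n"
      assume "\<not> True \<longrightarrow> d = 0" "\<not> True \<longrightarrow> v = 0"
      thus "?I \<le> wnorm2 a b (\<lambda>x. u x - (c + d * norm x powr (1 + b - a) + norm x powr (D1 b N / 2 - 1) * (v \<bullet> x)) * E a b 1 x)"
        using le by simp
    qed (use h t_eq C1 D1 D12 in auto)
    thus ?thesis by simp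
  qed
  have G2: "R2 a b u \<ge> min (D1 b N) (D2 b N - D1 b N) / 2 * (INF (c, d, l, v) \<in> UNIV \<times> UNIV \<times> {0<..} \<times> UNIV. wnorm2 a b (\<lambda>x. u x - (c + d * norm x powr (1 + b - a) + norm x powr (D1 b N / 2 - 1) * (v \<bullet> x)) * E a b l x))" (is "_ \<ge> _ * ?I")
    if h: "C1 a b = D1 b N"
  proof -
    have t_eq: "t = D1 b N" using h by (simp add: t_def C_PI_def)
    have le: "?I \<le> wnorm2 a b (\<lambda>x. u x - (c + d * norm x powr (1 + b - a) + norm x powr (D1 b N / 2 - 1) * (v \<bullet> x)) * E a b l x)" if "l > 0" for c d l and v :: "real^'n"
      by (rule order.trans[OF INF_nonneg_le[where z="(c, d, l, v)"]]) (use that in \<open>auto intro: wnorm2_nonneg\<close>)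
    have "(t + min (D1 b N) (D2 b N - D1 b N) - t) / 2 * ?I \<le> R2 a b u"
    proof (rule gap2[where radial=True and axial=True])
      fix c d :: real and v :: "real^'n" and l :: real
      assume "l > 0" "\<not> True \<longrightarrow> d = 0" "\<not> True \<longrightarrow> v = 0"
      thus "?I \<le> wnorm2 a b (\<lambda>x. u x - (c + d * norm x powr (1 + b - a) + norm x powr (D1 b N / 2 - 1) * (v \<bullet> x)) * E a b l x)"
        using le by simp
    qed (use h t_eq C1 D1 D12 in auto)
    thus ?thesis by simp
  qed
  show ?thesis
    using P1 P2 A1 A2 B1 B2 G1 G2 unfolding t_def J1_def J2_def by blast
qed

end
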